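(* Let $p$ be an Ising model on $n$ nodes in the high-temperature regime with maximum degree $d_{\max}$, and suppose $\beta=\frac{1}{4d_{\max}}$, where $\beta$ bounds the absolute values of all edge parameters. Given $\tilde O\!\left(\frac{n^{10/3}}{\varepsilon^2 d_{\max}^2}\right)$ i.i.d. samples from $p$ with no external field, there is a polynomial-time algorithm distinguishing with probability at least $2/3$ between $p\in\mathcal{I}_n$ and $d_{\mathrm{SKL}}(p,\mathcal{I}_n)\ge\varepsilon$. For testing identity of such $p$ to a given Ising model $q$ in the high-temperature regime (with no external field), i.e. distinguishing $p=q$ from $d_{\mathrm{SKL}}(p,q)\ge\varepsilon$, the same sample complexity suffices.
   Context: An Ising model on vertex set $V$, $|V|=n$, is the distribution on $\{-1,1\}^V$ with $p(x)\propto\exp\big(\sum_{v}\theta_v x_v+\sum_{u\ne v}\theta_{uv}x_ux_v\big)$; $(u,v)$ is an edge iff $\theta_{uv}\ne0$ and $d_{\max}$ is the maximum degree. "No external field" means $\theta_v=0$ for all $v$. High-temperature regime: $\max_{v}\sum_{u\ne v}\tanh(|\theta_{uv}|)\le1-\eta$ for some constant $\eta>0$. $\mathcal{I}_n$ is the set of product distributions on $\{-1,1\}^n$; $d_{\mathrm{SKL}}(p,q)=d_{\mathrm{KL}}(p\|q)+d_{\mathrm{KL}}(q\|p)$, $d_{\mathrm{SKL}}(p,\mathcal{I}_n)=\min_{q\in\mathcal{I}_n}d_{\mathrm{SKL}}(p,q)$. In identity testing, the algorithm is given the parameters and the node and edge marginals of $q$. $\tilde O$ hides polylogarithmic factors.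 *)

theory Defs
  imports "HOL-Probability.Probability" "HOL-Probability.Information"
begin

section \<open>Ising models\<close>

text \<open>The vertex set is \<open>{..<n}\<close>; configurations are extensional functions on it.\<close>

definition configs :: "nat \<Rightarrow> (nat \<Rightarrow> real) set" where
  "configs n = PiE {..<n} (\<lambda>_. {-1, 1})"

definition edge_params :: "nat \<Rightarrow> (nat \<Rightarrow> nat \<Rightarrow> real) \<Rightarrow> bool" where
  "edge_params n \<theta> \<longleftrightarrow> (\<forall>u<n. \<forall>v<n. \<theta> u v = \<theta> v u) \<and> (\<forall>v<n. \<theta> v v = 0)"

text \<open>
  Every unordered pair of distinct vertices contributes once to the exponent. With this
  normalisation \<open>tanh \<bar>\<theta> u v\<bar>\<close> is the influence of \<open>u\<close> on \<open>v\<close> in Dobrushin's condition.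
\<close>

definition ising_exponent :: "nat \<Rightarrow> (nat \<Rightarrow> real) \<Rightarrow> (nat \<Rightarrow> nat \<Rightarrow> real) \<Rightarrow> (nat \<Rightarrow> real) \<Rightarrow> real" where
  "ising_exponent n h \<theta> x =
     (\<Sum>v<n. h v * x v) + (\<Sum>u<n. \<Sum>v\<in>{u<..<n}. \<theta> u v * x u * x v)"

definition partition_function :: "nat \<Rightarrow> (nat \<Rightarrow> real) \<Rightarrow> (nat \<Rightarrow> nat \<Rightarrow> real) \<Rightarrow> real" where
  "partition_function n h \<theta> = (\<Sum>x\<in>configs n. exp (ising_exponent n h \<theta> x))"

definition ising :: "nat \<Rightarrow> (nat \<Rightarrow> real) \<Rightarrow> (nat \<Rightarrow> nat \<Rightarrow> real) \<Rightarrow> (nat \<Rightarrow> real) pmf" where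
  "ising n h \<theta> = embed_pmf (\<lambda>x.
     if x \<in> configs n then exp (ising_exponent n h \<theta> x) / partition_function n h \<theta> else 0)"

definition no_external_field :: "nat \<Rightarrow> (nat \<Rightarrow> real) \<Rightarrow> bool" where
  "no_external_field n h \<longleftrightarrow> (\<forall>v<n. h v = 0)"

definition vertex_degree :: "nat \<Rightarrow> (nat \<Rightarrow> nat \<Rightarrow> real) \<Rightarrow> nat \<Rightarrow> nat" where
  "vertex_degree n \<theta> v = card {u\<in>{..<n} - {v}. \<theta> u v \<noteq> 0}"

definition max_degree :: "nat \<Rightarrow> (nat \<Rightarrow> nat \<Rightarrow> real) \<Rightarrow> nat" where
  "max_degree n \<theta> = (MAX v\<in>{..<n}. vertex_degree n \<theta> v)"

definition edge_params_bounded :: "nat \<Rightarrow> (nat \<Rightarrow> nat \<Rightarrow> real) \<Rightarrow> real \<Rightarrow> bool" where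
  "edge_params_bounded n \<theta> \<beta> \<longleftrightarrow> (\<forall>u<n. \<forall>v<n. u \<noteq> v \<longrightarrow> \<bar>\<theta> u v\<bar> \<le> \<beta>)"

definition high_temperature :: "real \<Rightarrow> nat \<Rightarrow> (nat \<Rightarrow> nat \<Rightarrow> real) \<Rightarrow> bool" where
  "high_temperature \<eta> n \<theta> \<longleftrightarrow> (MAX v\<in>{..<n}. \<Sum>u\<in>{..<n} - {v}. tanh \<bar>\<theta> u v\<bar>) \<le> 1 - \<eta>"

definition node_marginal :: "(nat \<Rightarrow> real) pmf \<Rightarrow> nat \<Rightarrow> real" where
  "node_marginal p v = measure_pmf.expectation p (\<lambda>x. x v)"

definition edge_marginal :: "(nat \<Rightarrow> real) pmf \<Rightarrow> nat \<Rightarrow> nat \<Rightarrow> real" where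
  "edge_marginal p u v = measure_pmf.expectation p (\<lambda>x. x u * x v)"

lemma finite_configs: "finite (configs n)"
  unfolding configs_def by (rule finite_PiE) auto

lemma partition_function_pos: "partition_function n h \<theta> > 0"
  unfolding partition_function_def
  by (rule sum_pos[OF finite_configs]) (simp_all add: configs_def PiE_eq_empty_iff)

lemma pmf_ising:
  "pmf (ising n h \<theta>) x =
     (if x \<in> configs n then exp (ising_exponent n h \<theta> x) / partition_function n h \<theta> else 0)"
proof -
  define w where "w = (\<lambda>x. if x \<in> configs n
     then exp (ising_exponent n h \<theta> x) / partition_function n h \<theta> else 0)"
  have w0: "w x \<ge> 0" for x
    using partition_function_pos[of n h \<theta>] by (simp add: w_def)
  have "(\<integral>\<^sup>+x. ennreal (w x) \<partial>count_space UNIV) = (\<Sum>x\<in>configs n. ennreal (w x))"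
    by (rule nn_integral_count_space') (auto simp: finite_configs w_def)
  also have "\<dots> = ennreal (\<Sum>x\<in>configs n. w x)"
    using w0 by (simp add: sum_ennreal)
  also have "(\<Sum>x\<in>configs n. w x) = 1"
    using partition_function_pos[of n h \<theta>]
    by (simp add: w_def flip: sum_divide_distrib partition_function_def)
  finally have "pmf (embed_pmf w) x = w x"
    using w0 by (intro pmf_embed_pmf) auto
  then show ?thesis
    by (simp add: ising_def w_def)
qed

lemma set_pmf_ising: "set_pmf (ising n h \<theta>) = configs n"
  using partition_function_pos[of n h \<theta>] by (auto simp: set_pmf_eq pmf_ising)


section \<open>Product distributions and symmetrised Kullback--Leibler divergence\<close>

definition product_dists :: "nat \<Rightarrow> (nat \<Rightarrow> real) pmf set" where
  "product_dists n = {Pi_pmf {..<n} undefined r |r. \<forall>v<n. set_pmf (r v) \<subseteq> {-1, 1}}"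

text \<open>
  \<^const>\<open>KL_divergence\<close> takes the reference measure first, so its arguments appear swapped. It is
  real-valued and meaningless without absolute continuity, where the divergence is infinite.
\<close>

definition d_KL :: "'a pmf \<Rightarrow> 'a pmf \<Rightarrow> ereal" where
  "d_KL p q = (if set_pmf p \<subseteq> set_pmf q
     then ereal (KL_divergence (exp 1) (measure_pmf q) (measure_pmf p)) else \<infinity>)"

definition d_SKL :: "'a pmf \<Rightarrow> 'a pmf \<Rightarrow> ereal" where
  "d_SKL p q = d_KL p q + d_KL q p"

definition d_SKL_prod :: "(nat \<Rightarrow> real) pmf \<Rightarrow> nat \<Rightarrow> ereal" where
  "d_SKL_prod p n = (INF q\<in>product_dists n. d_SKL p q)"

lemma d_KL_finite:
  assumes fin: "finite (set_pmf q)" and sub: "set_pmf p \<subseteq> set_pmf q"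
  shows "d_KL p q = ereal (\<Sum>x\<in>set_pmf p. pmf p x * ln (pmf p x / pmf q x))"
proof -
  have p: "measure_pmf p = density (measure_pmf q) (\<lambda>x. ennreal (pmf p x / pmf q x))"
  proof (rule measure_eqI)
    fix A
    have "emeasure (density (measure_pmf q) (\<lambda>x. ennreal (pmf p x / pmf q x))) A
        = (\<integral>\<^sup>+x. ennreal (pmf p x / pmf q x) * indicator A x \<partial>measure_pmf q)"
      by (simp add: emeasure_density)
    also have "\<dots> = (\<integral>\<^sup>+x. ennreal (pmf q x) * (ennreal (pmf p x / pmf q x) * indicator A x)
                     \<partial>count_space UNIV)"
      by (simp add: nn_integral_measure_pmf)
    also have "\<dots> = (\<integral>\<^sup>+x. ennreal (pmf p x) * indicator A x \<partial>count_space UNIV)"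
    proof (rule nn_integral_cong)
      fix x
      have "pmf q x * (pmf p x / pmf q x) = pmf p x"
        using sub by (auto simp: set_pmf_eq)
      then show "ennreal (pmf q x) * (ennreal (pmf p x / pmf q x) * indicator A x)
          = ennreal (pmf p x) * indicator A x"
        by (simp add: mult.assoc[symmetric] ennreal_mult[symmetric])
    qed
    also have "\<dots> = emeasure (measure_pmf p) A"
      by (simp flip: nn_integral_measure_pmf)
    finally show "emeasure (measure_pmf p) A
        = emeasure (density (measure_pmf q) (\<lambda>x. ennreal (pmf p x / pmf q x))) A" ..
  qed simp
  have "KL_divergence (exp 1) (measure_pmf q) (measure_pmf p)
      = (\<integral>x. pmf p x / pmf q x * log (exp 1) (pmf p x / pmf q x) \<partial>measure_pmf q)"
    by (subst p, rule sigma_finite_measure.KL_density[OF measure_pmf.sigma_finite_measure_axioms]) auto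
  also have "\<dots> = (\<Sum>x\<in>set_pmf q. pmf p x * ln (pmf p x / pmf q x))"
    by (subst integral_measure_pmf_real[OF fin])
       (auto simp: log_def set_pmf_eq intro!: sum.cong)
  also have "\<dots> = (\<Sum>x\<in>set_pmf p. pmf p x * ln (pmf p x / pmf q x))"
    using sub fin by (intro sum.mono_neutral_right) (auto simp: set_pmf_eq)
  finally show ?thesis
    using sub by (simp add: d_KL_def)
qed


section \<open>A real random-access machine\<close>

text \<open>
  Algorithms are structured programs for a real RAM: a memory of natural numbers and a memory of
  exact reals, both addressed by natural numbers computed at run time. The reals have unit-cost
  field operations and comparisons (with \<open>x / 0 = 0\<close>). The naturals have only addition and truncated
  subtraction, so that their bit length grows at most linearly with the running time; there is no
  rounding from reals to naturals. The only constants in programs are natural numbers, so programs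
  carry no non-uniform advice.
\<close>

datatype nexp = NConst nat | NMem nexp | NAdd nexp nexp | NSub nexp nexp

datatype rexp = ROfNat nexp | RMem nexp
  | RAdd rexp rexp | RSub rexp rexp | RMul rexp rexp | RDiv rexp rexp

datatype test = NLess nexp nexp | RLess rexp rexp | TNot test | TAnd test test

datatype prog = Skip | NSet nexp nexp | RSet nexp rexp
  | Seq prog prog | Cond test prog prog | While test prog

type_synonym ram_state = "(nat \<Rightarrow> nat) \<times> (nat \<Rightarrow> real)"

fun nval :: "nexp \<Rightarrow> ram_state \<Rightarrow> nat" where
  "nval (NConst k) s = k"
| "nval (NMem a) s = fst s (nval a s)"
| "nval (NAdd a b) s = nval a s + nval b s"
| "nval (NSub a b) s = nval a s - nval b s"

fun rval :: "rexp \<Rightarrow> ram_state \<Rightarrow> real" where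
  "rval (ROfNat a) s = real (nval a s)"
| "rval (RMem a) s = snd s (nval a s)"
| "rval (RAdd a b) s = rval a s + rval b s"
| "rval (RSub a b) s = rval a s - rval b s"
| "rval (RMul a b) s = rval a s * rval b s"
| "rval (RDiv a b) s = rval a s / rval b s"

fun tval :: "test \<Rightarrow> ram_state \<Rightarrow> bool" where
  "tval (NLess a b) s \<longleftrightarrow> nval a s < nval b s"
| "tval (RLess a b) s \<longleftrightarrow> rval a s < rval b s"
| "tval (TNot b) s \<longleftrightarrow> \<not> tval b s"
| "tval (TAnd b c) s \<longleftrightarrow> tval b s \<and> tval c s"

text \<open>
  \<open>exec c s t s'\<close>: from \<open>s\<close>, program \<open>c\<close> terminates in \<open>s'\<close> after \<open>t\<close> steps. Charging one step
  per assignment or test is the number of machine operations up to a constant factor depending on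
  the program only, since its finitely many expressions have fixed size.
\<close>

inductive exec :: "prog \<Rightarrow> ram_state \<Rightarrow> nat \<Rightarrow> ram_state \<Rightarrow> bool" where
  Skip: "exec Skip s 1 s"
| NSet: "exec (NSet a e) s 1 ((fst s)(nval a s := nval e s), snd s)"
| RSet: "exec (RSet a e) s 1 (fst s, (snd s)(nval a s := rval e s))"
| Seq: "exec c1 s t1 s' \<Longrightarrow> exec c2 s' t2 s'' \<Longrightarrow> exec (Seq c1 c2) s (t1 + t2) s''"
| CondTrue: "tval b s \<Longrightarrow> exec c1 s t s' \<Longrightarrow> exec (Cond b c1 c2) s (1 + t) s'"
| CondFalse: "\<not> tval b s \<Longrightarrow> exec c2 s t s' \<Longrightarrow> exec (Cond b c1 c2) s (1 + t) s'"
| WhileFalse: "\<not> tval b s \<Longrightarrow> exec (While b c) s 1 s"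
| WhileTrue: "tval b s \<Longrightarrow> exec c s t1 s' \<Longrightarrow> exec (While b c) s' t2 s'' \<Longrightarrow>
    exec (While b c) s (1 + t1 + t2) s''"

inductive_cases exec_SkipE: "exec Skip s t s'"
inductive_cases exec_NSetE: "exec (NSet a e) s t s'"
inductive_cases exec_RSetE: "exec (RSet a e) s t s'"
inductive_cases exec_SeqE: "exec (Seq c1 c2) s t s'"
inductive_cases exec_CondE: "exec (Cond b c1 c2) s t s'"
inductive_cases exec_WhileE: "exec (While b c) s t s'"

lemma exec_deterministic:
  "exec c s t s' \<Longrightarrow> exec c s u s'' \<Longrightarrow> u = t \<and> s'' = s'"
proof (induction arbitrary: u s'' rule: exec.induct)
  case (Skip s)
  then show ?case by (rule exec_SkipE) simp
next
  case (NSet a e s)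
  then show ?case by (rule exec_NSetE) simp
next
  case (RSet a e s)
  then show ?case by (rule exec_RSetE) simp
next
  case Seq
  from Seq.prems show ?case by (rule exec_SeqE) (metis Seq.IH)
next
  case CondTrue
  from CondTrue.prems show ?case by (rule exec_CondE) (metis CondTrue.hyps(1) CondTrue.IH plus_1_eq_Suc)+
next
  case CondFalse
  from CondFalse.prems show ?case by (rule exec_CondE) (metis CondFalse.hyps(1) CondFalse.IH plus_1_eq_Suc)+
next
  case WhileFalse
  from WhileFalse.prems show ?case by (rule exec_WhileE) (use WhileFalse.hyps in simp_all)
next
  case WhileTrue
  from WhileTrue.prems show ?case by (rule exec_WhileE) (metis WhileTrue.hyps(1) WhileTrue.IH plus_1_eq_Suc add_Suc)+
qed

definition load :: "'a::zero list \<Rightarrow> nat \<Rightarrow> 'a" where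
  "load xs i = (if i < length xs then xs ! i else 0)"

definition init_state :: "nat list \<Rightarrow> real list \<Rightarrow> ram_state" where
  "init_state ns rs = (load ns, load rs)"

definition halts_within :: "prog \<Rightarrow> ram_state \<Rightarrow> nat \<Rightarrow> bool" where
  "halts_within c s T \<longleftrightarrow> (\<exists>t s'. exec c s t s' \<and> t \<le> T)"

definition accepts :: "prog \<Rightarrow> ram_state \<Rightarrow> bool" where
  "accepts c s \<longleftrightarrow> (\<exists>t s'. exec c s t s' \<and> fst s' 0 = 1)"

definition rejects :: "prog \<Rightarrow> ram_state \<Rightarrow> bool" where
  "rejects c s \<longleftrightarrow> (\<exists>t s'. exec c s t s' \<and> fst s' 0 \<noteq> 1)"


section \<open>Inputs of the testers\<close>

definition node_table :: "nat \<Rightarrow> (nat \<Rightarrow> real) \<Rightarrow> real list" where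
  "node_table n f = map f [0..<n]"

definition edge_table :: "nat \<Rightarrow> (nat \<Rightarrow> nat \<Rightarrow> real) \<Rightarrow> real list" where
  "edge_table n f = concat (map (\<lambda>u. map (f u) [0..<n]) [0..<n])"

definition sample_table :: "nat \<Rightarrow> (nat \<Rightarrow> real) list \<Rightarrow> real list" where
  "sample_table n xs = concat (map (node_table n) xs)"

definition independence_input :: "nat \<Rightarrow> nat \<Rightarrow> real \<Rightarrow> (nat \<Rightarrow> real) list \<Rightarrow> ram_state" where
  "independence_input n d \<epsilon> xs = init_state [n, d, length xs] (\<epsilon> # sample_table n xs)"

text \<open>
  Marginals are supplied for all pairs of vertices, not just for those with a nonzero parameter in
  the given model, because the edges of the unknown model are not known.
\<close>

definition identity_input ::
  "nat \<Rightarrow> nat \<Rightarrow> real \<Rightarrow> (nat \<Rightarrow> real) \<Rightarrow> (nat \<Rightarrow> nat \<Rightarrow> real) \<Rightarrow> (nat \<Rightarrow> real) list \<Rightarrow> ram_state" where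
  "identity_input n d \<epsilon> h \<theta> xs = init_state [n, d, length xs]
     (\<epsilon> # node_table n h @ edge_table n \<theta>
        @ node_table n (node_marginal (ising n h \<theta>)) @ edge_table n (edge_marginal (ising n h \<theta>))
        @ sample_table n xs)"

definition sample_lists :: "nat \<Rightarrow> (nat \<Rightarrow> real) list set" where
  "sample_lists n = lists (configs n)"


section \<open>Sample complexity\<close>

definition sample_bound :: "real \<Rightarrow> nat \<Rightarrow> nat \<Rightarrow> nat \<Rightarrow> real \<Rightarrow> real" where
  "sample_bound C k n d \<epsilon> =
     C * (real n powr (10/3) / (\<epsilon>\<^sup>2 * (real d)\<^sup>2)) * ln (real n + 1 / \<epsilon> + 3) ^ k"

end

theory Submission
  imports Defs
begin

text \<open>
  The tester splits the samples into two halves of size \<open>k\<close> and compares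
  \<open>T = \<Sum>\<^bsub>u<v\<^esub> A\<^bsub>uv\<^esub> B\<^bsub>uv\<^esub>\<close> with a threshold, where \<open>A\<^bsub>uv\<^esub>\<close> and \<open>B\<^bsub>uv\<^esub>\<close> are the
  sums of \<open>x\<^sub>u x\<^sub>v - M\<^bsub>uv\<^esub>\<close> over the two halves and \<open>M\<close> are the reference edge marginals. Its
  mean is \<open>k\<^sup>2 L\<close>, with \<open>L\<close> the squared Euclidean distance between the edge marginals of \<open>p\<close> and
  \<open>M\<close>. Since the symmetrised divergence is \<open>\<Sum>\<^bsub>u<v\<^esub> (\<theta>\<^bsub>uv\<^esub> - \<theta>'\<^bsub>uv\<^esub>) (\<mu>\<^bsub>uv\<^esub> - M\<^bsub>uv\<^esub>)\<close>
  and the parameters differ by at most \<open>1 / (2 d)\<close>, Cauchy--Schwarz gives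
  \<open>L \<ge> 4 d\<^sup>2 \<epsilon>\<^sup>2 / n\<^sup>2\<close> in the far case. Under Dobrushin's condition the Glauber dynamics contracts
  oscillations, hence has a spectral gap, and the resulting Poincare inequality, applied twice,
  bounds the variance of a quadratic form \<open>\<Sum> a\<^bsub>uv\<^esub> x\<^sub>u x\<^sub>v\<close> without external field by
  \<open>(2 / \<eta>\<^sup>2) \<Sum> a\<^bsub>uv\<^esub>\<^sup>2\<close>. Chebyshev's inequality then shows that \<open>O (n\<^sup>3 / (\<epsilon>\<^sup>2 d\<^sup>2))\<close> samples
  suffice, which is below the claimed bound, without logarithmic factors.
\<close>

section \<open>Pairs of vertices and quadratic forms\<close>

text \<open>The product of two independent halves is an unbiased estimate of each squared difference
  of marginals; squaring one empirical mean would add its sampling variance. The error terms have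
  second moments of order \<open>k^2 n^2\<close> and \<open>k^3 L\<close>, up to powers of \<eta>,
  so the signal \<open>k^2 L\<close> dominates both once \<open>k L\<close> is a large multiple of
  \<open>n\<close>; with \<open>L\<close> at least \<open>4 d^2 \<epsilon>^2 / n^2\<close> this
  gives the cubic sample size. The obstacle is that pairs within one sample are dependent: a
  variance bound for a whole quadratic form keeps the linear part of the error at
  \<open>k^3 L\<close>. It comes from flip differences: those of a quadratic form are linear forms,
  those of a linear form are constants, and the vanishing node means let the Poincare inequality
  bound second moments of the linear forms. Independence testing is identity testing against the
  uniform law: that law is itself a product distribution, so being far from all products includes
  being far from it, while every field-free product distribution has the same zero edge
  marginals.\<close>

definition vertex_pairs :: "nat \<Rightarrow> (nat \<times> nat) set" where
  "vertex_pairs n = {(u, v). u < v \<and> v < n}"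

lemma vertex_pairs_Sigma: "vertex_pairs n = Sigma {..<n} (\<lambda>u. {u<..<n})"
  by (auto simp: vertex_pairs_def)

lemma vertex_pairs_subset: "vertex_pairs n \<subseteq> {..<n} \<times> {..<n}"
  by (auto simp: vertex_pairs_def)

lemma finite_vertex_pairs [simp]: "finite (vertex_pairs n)"
  by (rule finite_subset[OF vertex_pairs_subset]) auto

lemma card_vertex_pairs_le: "card (vertex_pairs n) \<le> n\<^sup>2"
  using card_mono[OF _ vertex_pairs_subset, of n]
  by (simp add: card_cartesian_product power2_eq_square)

definition pair_form :: "nat \<Rightarrow> (nat \<Rightarrow> nat \<Rightarrow> real) \<Rightarrow> (nat \<Rightarrow> real) \<Rightarrow> real" where
  "pair_form n a x = (\<Sum>(u, v)\<in>vertex_pairs n. a u v * (x u * x v))"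

lemma ising_exponent_pair_form:
  "ising_exponent n h \<theta> x = (\<Sum>v<n. h v * x v) + pair_form n \<theta> x"
  unfolding ising_exponent_def pair_form_def vertex_pairs_Sigma
  by (subst sum.Sigma[symmetric]) (auto simp: mult.assoc)

text \<open>Pairs carry their smaller vertex first, so those through \<open>w\<close> split
  according to which end is \<open>w\<close>; the ranges to the right and to the left of
  \<open>w\<close> recombine to all other vertices.\<close>

lemma sum_vertex_pairs_incident:
  fixes g :: "nat \<Rightarrow> real"
  assumes "w < n"
  shows "(\<Sum>(u, v)\<in>vertex_pairs n. (if u = w then g v else 0) + (if v = w then g u else 0))
    = (\<Sum>u\<in>{..<n} - {w}. g u)"
proof -
  have "(\<Sum>(u, v)\<in>vertex_pairs n. (if u = w then g v else 0) + (if v = w then g u else 0))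
    = (\<Sum>e\<in>vertex_pairs n. if fst e = w then g (snd e) else 0)
      + (\<Sum>e\<in>vertex_pairs n. if snd e = w then g (fst e) else 0)"
    by (simp add: case_prod_unfold sum.distrib)
  also have "(\<Sum>e\<in>vertex_pairs n. if fst e = w then g (snd e) else 0)
      = (\<Sum>e\<in>{e\<in>vertex_pairs n. fst e = w}. g (snd e))"
    by (simp add: sum.inter_filter)
  also have "\<dots> = (\<Sum>u\<in>{w<..<n}. g u)"
    by (rule sum.reindex_bij_witness[of _ "\<lambda>u. (w, u)" snd]) (auto simp: vertex_pairs_def)
  also have "(\<Sum>e\<in>vertex_pairs n. if snd e = w then g (fst e) else 0)
      = (\<Sum>e\<in>{e\<in>vertex_pairs n. snd e = w}. g (fst e))"
    by (simp add: sum.inter_filter)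
  also have "\<dots> = (\<Sum>u\<in>{..<w}. g u)"
    using assms by (intro sum.reindex_bij_witness[of _ "\<lambda>u. (u, w)" fst]) (auto simp: vertex_pairs_def)
  also have "(\<Sum>u\<in>{w<..<n}. g u) + (\<Sum>u\<in>{..<w}. g u) = (\<Sum>u\<in>{w<..<n} \<union> {..<w}. g u)"
    by (rule sum.union_disjoint[symmetric]) auto
  also have "{w<..<n} \<union> {..<w} = {..<n} - {w}"
    using assms by auto
  finally show ?thesis .
qed

text \<open>A quadratic form without diagonal is affine in each coordinate, so its flip difference
  is twice the coefficient of \<open>x w\<close>. Symmetry of \<open>a\<close> lets both kinds of
  incident pairs be read from column \<open>w\<close>.\<close>

lemma pair_form_flip:
  assumes "w < n" and sym: "\<And>u v. u < n \<Longrightarrow> v < n \<Longrightarrow> a u v = a v u"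
  shows "pair_form n a (x(w := 1)) - pair_form n a (x(w := -1))
    = 2 * (\<Sum>u\<in>{..<n} - {w}. a u w * x u)"
proof -
  have "pair_form n a (x(w := 1)) - pair_form n a (x(w := -1))
     = (\<Sum>(u, v)\<in>vertex_pairs n. (if u = w then 2 * (a v w * x v) else 0)
           + (if v = w then 2 * (a u w * x u) else 0))"
    unfolding pair_form_def sum_subtractf[symmetric]
    using assms by (intro sum.cong refl) (auto simp: vertex_pairs_def sym[of w])
  also have "\<dots> = (\<Sum>u\<in>{..<n} - {w}. 2 * (a u w * x u))"
    by (rule sum_vertex_pairs_incident[OF assms(1)])
  finally show ?thesis
    by (simp add: sum_distrib_left)
qed

text \<open>Each unordered pair is met from both of its ends.\<close>

lemma sum_vertex_pairs_symmetric:
  fixes b :: "nat \<Rightarrow> nat \<Rightarrow> real"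
  assumes sym: "\<And>u v. u < n \<Longrightarrow> v < n \<Longrightarrow> b u v = b v u"
  shows "(\<Sum>w<n. \<Sum>u\<in>{..<n} - {w}. b u w) = 2 * (\<Sum>(u, v)\<in>vertex_pairs n. b u v)"
proof -
  have "(\<Sum>w<n. \<Sum>u\<in>{..<n} - {w}. b u w)
    = (\<Sum>w<n. \<Sum>(u, v)\<in>vertex_pairs n. (if u = w then b v w else 0) + (if v = w then b u w else 0))"
    by (simp add: sum_vertex_pairs_incident)
  also have "\<dots> = (\<Sum>(u, v)\<in>vertex_pairs n. \<Sum>w<n. (if u = w then b v w else 0) + (if v = w then b u w else 0))"
    by (subst sum.swap) (simp add: case_prod_unfold)
  also have "\<dots> = (\<Sum>(u, v)\<in>vertex_pairs n. 2 * b u v)"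
    by (intro sum.cong refl) (auto simp: vertex_pairs_def sum.distrib sym)
  finally show ?thesis
    by (simp add: sum_distrib_left case_prod_unfold)
qed

section \<open>Configurations\<close>

lemma configs_update: "x \<in> configs n \<Longrightarrow> v < n \<Longrightarrow> s \<in> {-1, 1} \<Longrightarrow> x(v := s) \<in> configs n"
  by (auto simp: configs_def PiE_iff extensional_def)

lemma configs_value: "x \<in> configs n \<Longrightarrow> v < n \<Longrightarrow> x v = 1 \<or> x v = -1"
  by (auto simp: configs_def PiE_iff)

text \<open>The two values on the right are those at \<open>x\<close> and at its flip in
  \<open>v\<close>, in some order, so each configuration is counted twice. This reduces sums against
  a single-site update to two-point fibres.\<close>

lemma sum_configs_flip:
  fixes f :: "(nat \<Rightarrow> real) \<Rightarrow> real"
  assumes "v < n"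
  shows "(\<Sum>x\<in>configs n. f x) = (\<Sum>x\<in>configs n. f (x(v := 1)) + f (x(v := -1))) / 2"
proof -
  have "(\<Sum>x\<in>configs n. f (x(v := - x v))) = (\<Sum>x\<in>configs n. f x)"
    using assms configs_value[of _ n v]
    by (intro sum.reindex_bij_witness[of _ "\<lambda>x. x(v := - x v)" "\<lambda>x. x(v := - x v)"])
       (force intro!: configs_update)+
  moreover have "(\<Sum>x\<in>configs n. f (x(v := 1)) + f (x(v := -1)))
      = (\<Sum>x\<in>configs n. f x + f (x(v := - x v)))"
  proof (rule sum.cong[OF refl])
    fix x assume "x \<in> configs n"
    with configs_value[OF this assms] show "f (x(v := 1)) + f (x(v := -1)) = f x + f (x(v := - x v))"
      by (metis add.commute fun_upd_triv minus_minus)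
  qed
  ultimately show ?thesis
    by (simp add: sum.distrib)
qed

text \<open>Interpolation: \<open>z k\<close> takes its coordinates below \<open>k\<close> from
  \<open>y\<close> and the others from \<open>x\<close>, so neighbours on the path differ in at most
  one coordinate.\<close>

lemma osc_sum_bound:
  fixes f :: "(nat \<Rightarrow> real) \<Rightarrow> real"
  assumes osc: "\<And>v x. v < n \<Longrightarrow> x \<in> configs n \<Longrightarrow> \<bar>f (x(v := 1)) - f (x(v := -1))\<bar> \<le> \<delta> v"
    and x: "x \<in> configs n" and y: "y \<in> configs n"
  shows "\<bar>f x - f y\<bar> \<le> (\<Sum>v<n. \<delta> v)"
proof -
  define z where "z k = (\<lambda>i. if i < k then y i else x i)" for k
  have z: "z k \<in> configs n" for k
    using x y by (auto simp: z_def configs_def PiE_iff extensional_def)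
  have "k \<le> n \<Longrightarrow> \<bar>f x - f (z k)\<bar> \<le> (\<Sum>v<k. \<delta> v)" for k
  proof (induction k)
    case 0
    have "z 0 = x" by (auto simp: z_def)
    then show ?case by simp
  next
    case (Suc k)
    have zS: "z (Suc k) = (z k)(k := y k)"
      by (auto simp: z_def less_Suc_eq)
    have zk: "z k = (z k)(k := x k)"
      by (auto simp: z_def)
    have "\<bar>f ((z k)(k := x k)) - f ((z k)(k := y k))\<bar> \<le> \<delta> k"
      using osc[of k "z k"] Suc.prems z[of k] configs_value[OF x, of k] configs_value[OF y, of k]
      by (auto simp: abs_minus_commute)
    then have "\<bar>f (z k) - f (z (Suc k))\<bar> \<le> \<delta> k"
      using zS zk by simp
    with Suc show ?case by simp
  qed
  from this[of n] have "\<bar>f x - f (z n)\<bar> \<le> (\<Sum>v<n. \<delta> v)" by simp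
  moreover have "z n = y"
    using x y by (auto simp: z_def configs_def PiE_iff extensional_def)
  ultimately show ?thesis by simp
qed

section \<open>Expectations and conditional laws of Ising models\<close>

lemma expectation_ising:
  fixes f :: "(nat \<Rightarrow> real) \<Rightarrow> real"
  shows "measure_pmf.expectation (ising n h \<theta>) f = (\<Sum>x\<in>configs n. pmf (ising n h \<theta>) x * f x)"
  by (subst integral_measure_pmf_real[OF finite_configs])
     (auto simp: set_pmf_ising mult.commute)

lemma pmf_ising_pos: "x \<in> configs n \<Longrightarrow> pmf (ising n h \<theta>) x > 0"
  by (simp add: pmf_ising partition_function_pos)

lemma integrable_ising [simp]:
  fixes f :: "(nat \<Rightarrow> real) \<Rightarrow> real"
  shows "integrable (measure_pmf (ising n h \<theta>)) f"
  by (rule integrable_measure_pmf_finite) (simp add: set_pmf_ising finite_configs)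

text \<open>Half the log odds of \<open>x v = 1\<close> given the other coordinates.\<close>

definition local_field :: "nat \<Rightarrow> (nat \<Rightarrow> real) \<Rightarrow> (nat \<Rightarrow> nat \<Rightarrow> real) \<Rightarrow> nat \<Rightarrow> (nat \<Rightarrow> real) \<Rightarrow> real" where
  "local_field n h \<theta> v x = h v + (\<Sum>u\<in>{..<n} - {v}. \<theta> u v * x u)"

lemma ising_exponent_flip:
  assumes "edge_params n \<theta>" "v < n"
  shows "ising_exponent n h \<theta> (x(v := 1)) - ising_exponent n h \<theta> (x(v := -1))
    = 2 * local_field n h \<theta> v x"
proof -
  have "(\<Sum>u<n. h u * (x(v := 1)) u) - (\<Sum>u<n. h u * (x(v := -1)) u)
      = (\<Sum>u<n. if u = v then 2 * h v else 0)"
    unfolding sum_subtractf[symmetric] by (intro sum.cong) auto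
  with assms show ?thesis
    using pair_form_flip[of v n \<theta> x]
    by (simp add: ising_exponent_pair_form local_field_def edge_params_def)
qed

lemma local_field_flip:
  assumes "u < n" "u \<noteq> v"
  shows "local_field n h \<theta> v (x(u := 1)) - local_field n h \<theta> v (x(u := -1)) = 2 * \<theta> u v"
proof -
  have "(\<Sum>w\<in>{..<n} - {v}. \<theta> w v * (x(u := 1)) w) - (\<Sum>w\<in>{..<n} - {v}. \<theta> w v * (x(u := -1)) w)
      = (\<Sum>w\<in>{..<n} - {v}. if w = u then 2 * \<theta> u v else 0)"
    unfolding sum_subtractf[symmetric] by (intro sum.cong) auto
  with assms show ?thesis
    by (simp add: local_field_def)
qed

definition cond_plus :: "((nat \<Rightarrow> real) \<Rightarrow> real) \<Rightarrow> nat \<Rightarrow> (nat \<Rightarrow> real) \<Rightarrow> real" where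
  "cond_plus w v x = w (x(v := 1)) / (w (x(v := 1)) + w (x(v := -1)))"

text \<open>The partition function cancels and the logistic function of twice the local field
  remains. Writing it through \<open>tanh\<close> matches the form of the high-temperature
  condition.\<close>

lemma cond_plus_ising:
  assumes "edge_params n \<theta>" "v < n" "x \<in> configs n"
  shows "cond_plus (pmf (ising n h \<theta>)) v x = (1 + tanh (local_field n h \<theta> v x)) / 2"
proof -
  let ?F = "local_field n h \<theta> v x"
  let ?H = "ising_exponent n h \<theta>"
  have c: "x(v := 1) \<in> configs n" "x(v := -1) \<in> configs n"
    using assms by (auto intro: configs_update)
  have Z: "partition_function n h \<theta> > 0" by (rule partition_function_pos)
  have "cond_plus (pmf (ising n h \<theta>)) v x
      = exp (?H (x(v := 1))) / (exp (?H (x(v := 1))) + exp (?H (x(v := -1))))"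
    using c Z by (simp add: cond_plus_def pmf_ising flip: add_divide_distrib)
  also have "?H (x(v := -1)) = ?H (x(v := 1)) - 2 * ?F"
    using ising_exponent_flip[OF assms(1,2), of h x] by simp
  also have "exp (?H (x(v := 1))) / (exp (?H (x(v := 1))) + exp (?H (x(v := 1)) - 2 * ?F))
      = exp (?H (x(v := 1))) / (exp (?H (x(v := 1))) * (1 + exp (- 2 * ?F)))"
    by (simp add: exp_diff exp_minus field_simps)
  also have "\<dots> = 1 / (1 + exp (- 2 * ?F))"
    by simp
  also have "\<dots> = (1 + tanh ?F) / 2"
  proof -
    have "1 + exp (-2 * ?F) > 0" by (simp add: add_pos_pos)
    then show ?thesis by (simp add: tanh_real_altdef field_simps)
  qed
  finally show ?thesis .
qed

text \<open>With midpoint \<open>c\<close> and half difference \<open>t\<close>, the difference for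
  \<open>b \<le> a\<close> is \<open>sinh (2 t) / (cosh^2 t + sinh^2 c)\<close>, largest at
  \<open>c = 0\<close>. The Lipschitz bound would give \<open>\<bar>\<theta>\<bar>\<close> itself as
  influence, whereas the temperature condition controls only its \<open>tanh\<close>.\<close>

lemma tanh_diff_le:
  fixes a b :: real
  shows "\<bar>tanh a - tanh b\<bar> \<le> 2 * tanh (\<bar>a - b\<bar> / 2)"
proof -
  have *: "tanh a - tanh b \<le> 2 * tanh ((a - b) / 2)" if "b \<le> a" for a b :: real
  proof -
    define t where "t = (a - b) / 2"
    define c where "c = (a + b) / 2"
    have ab: "a = c + t" "b = c - t" by (auto simp: t_def c_def field_simps)
    have t: "t \<ge> 0" using that by (simp add: t_def)
    have pos: "cosh a > 0" "cosh b > 0" "cosh t > 0" by (auto intro: cosh_real_pos)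
    have "tanh a - tanh b = (sinh a * cosh b - cosh a * sinh b) / (cosh a * cosh b)"
      using pos by (simp add: tanh_def field_simps)
    also have "sinh a * cosh b - cosh a * sinh b = 2 * sinh t * cosh t"
      using sinh_diff[of a b] sinh_double[of t] by (simp add: ab mult.commute)
    also have "cosh a * cosh b = (cosh t)\<^sup>2 + (sinh c)\<^sup>2"
    proof -
      have "cosh a * cosh b = (cosh c)\<^sup>2 * (cosh t)\<^sup>2 - (sinh c)\<^sup>2 * (sinh t)\<^sup>2"
        by (simp add: ab cosh_add cosh_diff algebra_simps power2_eq_square)
      also have "\<dots> = (cosh t)\<^sup>2 + (sinh c)\<^sup>2"
        by (simp add: cosh_square_eq algebra_simps)
      finally show ?thesis .
    qed
    also have "2 * sinh t * cosh t / ((cosh t)\<^sup>2 + (sinh c)\<^sup>2) \<le> 2 * sinh t * cosh t / (cosh t)\<^sup>2"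
      using pos t by (intro divide_left_mono) (auto simp: sinh_real_nonneg_iff add_pos_nonneg)
    also have "\<dots> = 2 * tanh t"
      using pos by (simp add: tanh_def power2_eq_square)
    finally show ?thesis by (simp add: t_def)
  qed
  show ?thesis
  proof (cases "b \<le> a")
    case True
    then show ?thesis using *[of b a] by (simp add: tanh_real_le_iff)
  next
    case False
    then show ?thesis using *[of a b] by (simp add: abs_minus_commute)
  qed
qed

section \<open>Glauber dynamics\<close>

text \<open>The conditional expectation of \<open>f\<close> given all coordinates except
  \<open>v\<close>. The weight is a parameter because reversibility and the Dirichlet form hold for
  every positive weight; the Ising structure enters through the contraction.\<close>

definition heat_bath ::
  "((nat \<Rightarrow> real) \<Rightarrow> real) \<Rightarrow> nat \<Rightarrow> ((nat \<Rightarrow> real) \<Rightarrow> real) \<Rightarrow> (nat \<Rightarrow> real) \<Rightarrow> real" where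
  "heat_bath w v f x = cond_plus w v x * f (x(v := 1)) + (1 - cond_plus w v x) * f (x(v := -1))"

text \<open>Dobrushin's comparison: a flip at \<open>u\<close> acts directly, through the average of
  \<open>A\<close> and \<open>B\<close> over the resampled value at \<open>v\<close>, and
  indirectly, by shifting the probability of that value by at most
  \<open>tanh \<bar>\<theta> u v\<bar>\<close>, which is multiplied by the difference
  \<open>D\<close> at \<open>v\<close>. For \<open>u = v\<close> the resampling erases the
  flip.\<close>

lemma heat_bath_osc:
  assumes ep: "edge_params n \<theta>" and uv: "u < n" "v < n" and x: "x \<in> configs n"
    and osc: "\<And>v x. v < n \<Longrightarrow> x \<in> configs n \<Longrightarrow> \<bar>f (x(v := 1)) - f (x(v := -1))\<bar> \<le> \<delta> v"
  shows "\<bar>heat_bath (pmf (ising n h \<theta>)) v f (x(u := 1)) - heat_bath (pmf (ising n h \<theta>)) v f (x(u := -1))\<bar>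
    \<le> (if u = v then 0 else \<delta> u + tanh \<bar>\<theta> u v\<bar> * \<delta> v)"
proof (cases "u = v")
  case True
  then show ?thesis by (simp add: heat_bath_def cond_plus_def)
next
  case False
  let ?c = "cond_plus (pmf (ising n h \<theta>)) v"
  define c where "c = ?c (x(u := 1))"
  define c' where "c' = ?c (x(u := -1))"
  have xu: "x(u := 1) \<in> configs n" "x(u := -1) \<in> configs n"
    and xv: "x(v := 1) \<in> configs n" "x(v := -1) \<in> configs n"
    using x uv by (auto intro: configs_update)
  have c_eq: "c = (1 + tanh (local_field n h \<theta> v (x(u := 1)))) / 2"
    "c' = (1 + tanh (local_field n h \<theta> v (x(u := -1)))) / 2"
    unfolding c_def c'_def using cond_plus_ising[OF ep uv(2)] xu by auto
  have "\<bar>c - c'\<bar> = \<bar>tanh (local_field n h \<theta> v (x(u := 1))) - tanh (local_field n h \<theta> v (x(u := -1)))\<bar> / 2"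
    by (simp add: c_eq diff_divide_distrib[symmetric])
  also have "\<dots> \<le> tanh \<bar>\<theta> u v\<bar>"
    using tanh_diff_le[of "local_field n h \<theta> v (x(u := 1))" "local_field n h \<theta> v (x(u := -1))"]
      local_field_flip[OF uv(1) False, of h \<theta> x] by (simp add: abs_mult)
  finally have cc: "\<bar>c - c'\<bar> \<le> tanh \<bar>\<theta> u v\<bar>" .
  have c01: "0 \<le> c" "c \<le> 1"
    using tanh_real_gt_neg1[of "local_field n h \<theta> v (x(u := 1))"]
      tanh_real_lt_1[of "local_field n h \<theta> v (x(u := 1))"] by (auto simp: c_eq)
  define A where "A = f (x(v := 1, u := 1)) - f (x(v := 1, u := -1))"
  define B where "B = f (x(v := -1, u := 1)) - f (x(v := -1, u := -1))"
  define D where "D = f (x(u := -1, v := 1)) - f (x(u := -1, v := -1))"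
  have bounds: "\<bar>A\<bar> \<le> \<delta> u" "\<bar>B\<bar> \<le> \<delta> u" "\<bar>D\<bar> \<le> \<delta> v"
    unfolding A_def B_def D_def using osc[OF uv(1) xv(1)] osc[OF uv(1) xv(2)] osc[OF uv(2) xu(2)] by auto
  have "\<bar>heat_bath (pmf (ising n h \<theta>)) v f (x(u := 1)) - heat_bath (pmf (ising n h \<theta>)) v f (x(u := -1))\<bar>
     = \<bar>c * A + (1 - c) * B + (c - c') * D\<bar>"
    unfolding heat_bath_def c_def[symmetric] c'_def[symmetric] A_def B_def D_def
    using False by (simp add: fun_upd_twist[of u v] algebra_simps)
  also have "\<dots> \<le> \<bar>c * A\<bar> + \<bar>(1 - c) * B\<bar> + \<bar>(c - c') * D\<bar>"
    by linarith
  also have "\<dots> \<le> c * \<delta> u + (1 - c) * \<delta> u + tanh \<bar>\<theta> u v\<bar> * \<delta> v"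
    unfolding abs_mult using c01 bounds cc by (intro add_mono mult_mono) auto
  finally show ?thesis using False by (simp add: algebra_simps)
qed

text \<open>On a fibre of two configurations the update replaces \<open>f\<close> by its weighted
  mean. The right side is therefore symmetric in \<open>f\<close> and \<open>g\<close>, which gives
  self-adjointness, and for \<open>g = f\<close> it gives the Dirichlet form.\<close>

lemma heat_bath_inner:
  assumes w: "\<forall>x\<in>configs n. w x > 0" and "v < n"
  shows "(\<Sum>x\<in>configs n. w x * (g x * heat_bath w v f x))
    = (\<Sum>x\<in>configs n. (w (x(v := 1)) * g (x(v := 1)) + w (x(v := -1)) * g (x(v := -1)))
         * (w (x(v := 1)) * f (x(v := 1)) + w (x(v := -1)) * f (x(v := -1)))
         / (w (x(v := 1)) + w (x(v := -1)))) / 2"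
  unfolding sum_configs_flip[OF assms(2), of "\<lambda>x. w x * (g x * heat_bath w v f x)"]
proof (intro arg_cong[where f = "\<lambda>z. z / 2"] sum.cong refl)
  fix x assume x: "x \<in> configs n"
  define a b where "a = w (x(v := 1))" and "b = w (x(v := -1))"
  define N where "N = a * f (x(v := 1)) + b * f (x(v := -1))"
  have "a > 0" "b > 0"
    using w configs_update[OF x assms(2)] by (auto simp: a_def b_def)
  then have "a + b \<noteq> 0" by linarith
  then have hb: "heat_bath w v f (x(v := s)) = N / (a + b)" for s
    proof -
    have "1 - a / (a + b) = b / (a + b)"
      using \<open>a + b \<noteq> 0\<close> by (simp add: field_simps)
    then show ?thesis
      by (simp add: heat_bath_def cond_plus_def N_def add_divide_distrib flip: a_def b_def)
  qed
  have "a * (g (x(v := 1)) * (N / (a + b))) + b * (g (x(v := -1)) * (N / (a + b)))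
      = (a * g (x(v := 1)) + b * g (x(v := -1))) * N / (a + b)"
    by (simp add: algebra_simps add_divide_distrib)
  then show "w (x(v := 1)) * (g (x(v := 1)) * heat_bath w v f (x(v := 1))) +
         w (x(v := - 1)) * (g (x(v := - 1)) * heat_bath w v f (x(v := - 1))) =
         (w (x(v := 1)) * g (x(v := 1)) + w (x(v := - 1)) * g (x(v := - 1))) *
         (w (x(v := 1)) * f (x(v := 1)) + w (x(v := - 1)) * f (x(v := - 1))) /
         (w (x(v := 1)) + w (x(v := - 1)))"
    unfolding hb by (simp add: N_def a_def b_def)
qed

lemma heat_bath_self_adjoint:
  assumes "\<forall>x\<in>configs n. w x > 0" and "v < n"
  shows "(\<Sum>x\<in>configs n. w x * (g x * heat_bath w v f x)) = (\<Sum>x\<in>configs n. w x * (heat_bath w v g x * f x))"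
proof -
  have "(\<Sum>x\<in>configs n. w x * (heat_bath w v g x * f x)) = (\<Sum>x\<in>configs n. w x * (f x * heat_bath w v g x))"
    by (simp add: mult.commute)
  then show ?thesis
    unfolding heat_bath_inner[OF assms] by (simp add: mult.commute)
qed

text \<open>On a fibre with weights \<open>a\<close> and \<open>b\<close> the Dirichlet form is
  \<open>a b / (a + b)\<close> times the squared difference, and
  \<open>a b / (a + b) \<le> (a + b) / 4\<close>. The squared difference does not depend on
  \<open>x v\<close>, so the fibre weights recombine into the full sum.\<close>

lemma heat_bath_dirichlet:
  assumes w: "\<forall>x\<in>configs n. w x > 0" and v: "v < n"
  shows "(\<Sum>x\<in>configs n. w x * (f x * (f x - heat_bath w v f x)))
    \<le> (\<Sum>x\<in>configs n. w x * (f (x(v := 1)) - f (x(v := -1)))\<^sup>2) / 4"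
proof -
  have "(\<Sum>x\<in>configs n. w x * (f x * (f x - heat_bath w v f x)))
      = (\<Sum>x\<in>configs n. w x * (f x)\<^sup>2) - (\<Sum>x\<in>configs n. w x * (f x * heat_bath w v f x))"
    by (simp add: algebra_simps sum_subtractf power2_eq_square)
  also have "\<dots> = (\<Sum>x\<in>configs n. (w (x(v := 1)) * w (x(v := -1)) / (w (x(v := 1)) + w (x(v := -1))))
      * (f (x(v := 1)) - f (x(v := -1)))\<^sup>2) / 2"
  proof -
    have eq: "a * s\<^sup>2 + b * t\<^sup>2 - (a * s + b * t) * (a * s + b * t) / (a + b) = a * b / (a + b) * (s - t)\<^sup>2"
      if "a > 0" "b > 0" for a b s t :: real
    proof -
      have "a + b \<noteq> 0" using that by linarith
      then show ?thesis by (simp add: field_simps power2_eq_square)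
    qed
    have pos: "w (x(v := 1)) > 0" "w (x(v := -1)) > 0" if "x \<in> configs n" for x
      using w configs_update[OF that v] by auto
    show ?thesis
      unfolding heat_bath_inner[of n w v f f, OF assms]
        sum_configs_flip[OF v, of "\<lambda>x. w x * (f x)\<^sup>2"] diff_divide_distrib[symmetric]
        sum_subtractf[symmetric]
      by (intro arg_cong[where f = "\<lambda>z. z / 2"] sum.cong refl eq pos)
  qed
  also have "\<dots> \<le> (\<Sum>x\<in>configs n. (w (x(v := 1)) + w (x(v := -1))) / 4
      * (f (x(v := 1)) - f (x(v := -1)))\<^sup>2) / 2"
  proof (intro divide_right_mono sum_mono mult_right_mono)
    fix x assume x: "x \<in> configs n"
    have pos: "w (x(v := 1)) > 0" "w (x(v := -1)) > 0"
      using w configs_update[OF x v] by auto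
    have "0 \<le> (w (x(v := 1)) - w (x(v := -1)))\<^sup>2" by simp
    then show "w (x(v := 1)) * w (x(v := - 1)) / (w (x(v := 1)) + w (x(v := - 1)))
        \<le> (w (x(v := 1)) + w (x(v := - 1))) / 4"
      using pos by (simp add: divide_le_eq power2_eq_square algebra_simps)
  qed auto
  also have "\<dots> = (\<Sum>x\<in>configs n. w x * (f (x(v := 1)) - f (x(v := -1)))\<^sup>2) / 4"
    unfolding sum_configs_flip[OF v, of "\<lambda>x. w x * (f (x(v := 1)) - f (x(v := -1)))\<^sup>2"]
    by (simp add: sum_divide_distrib algebra_simps)
  finally show ?thesis .
qed

section \<open>Random-scan chain: reversibility, Dirichlet form and contraction\<close>

definition glauber ::
  "nat \<Rightarrow> ((nat \<Rightarrow> real) \<Rightarrow> real) \<Rightarrow> ((nat \<Rightarrow> real) \<Rightarrow> real) \<Rightarrow> (nat \<Rightarrow> real) \<Rightarrow> real" where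
  "glauber n w f x = (\<Sum>v<n. heat_bath w v f x) / real n"

lemma glauber_self_adjoint:
  assumes "\<forall>x\<in>configs n. w x > 0"
  shows "(\<Sum>x\<in>configs n. w x * (g x * glauber n w f x)) = (\<Sum>x\<in>configs n. w x * (glauber n w g x * f x))"
proof -
  have "(\<Sum>x\<in>configs n. w x * (g x * glauber n w f x))
      = (\<Sum>v<n. \<Sum>x\<in>configs n. w x * (g x * heat_bath w v f x)) / real n"
    unfolding glauber_def
    by (subst sum.swap) (simp add: sum_distrib_left sum_distrib_right sum_divide_distrib mult.assoc)
  also have "\<dots> = (\<Sum>v<n. \<Sum>x\<in>configs n. w x * (heat_bath w v g x * f x)) / real n"
    by (simp add: heat_bath_self_adjoint[OF assms])
  also have "\<dots> = (\<Sum>x\<in>configs n. w x * (glauber n w g x * f x))"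
    unfolding glauber_def
    by (subst sum.swap) (simp add: sum_distrib_left sum_distrib_right sum_divide_distrib mult.assoc)
  finally show ?thesis .
qed

lemma glauber_dirichlet:
  assumes w: "\<forall>x\<in>configs n. w x > 0" and n: "n > 0"
  shows "(\<Sum>x\<in>configs n. w x * (f x * (f x - glauber n w f x)))
    \<le> (\<Sum>v<n. \<Sum>x\<in>configs n. w x * (f (x(v := 1)) - f (x(v := -1)))\<^sup>2) / (4 * real n)"
proof -
  have "f x - glauber n w f x = (\<Sum>v<n. f x - heat_bath w v f x) / real n" for x
    using n by (simp add: glauber_def sum_subtractf field_simps)
  then have "(\<Sum>x\<in>configs n. w x * (f x * (f x - glauber n w f x)))
      = (\<Sum>v<n. \<Sum>x\<in>configs n. w x * (f x * (f x - heat_bath w v f x))) / real n"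
    by (subst sum.swap) (simp add: sum_distrib_left sum_divide_distrib)
  also have "\<dots> \<le> (\<Sum>v<n. (\<Sum>x\<in>configs n. w x * (f (x(v := 1)) - f (x(v := -1)))\<^sup>2) / 4) / real n"
    by (intro divide_right_mono sum_mono heat_bath_dirichlet[OF w]) auto
  finally show ?thesis
    by (simp add: sum_divide_distrib[symmetric] divide_divide_eq_left)
qed

text \<open>Averaging over the resampled vertex keeps \<open>\<delta> u\<close> in
  \<open>n - 1\<close> of \<open>n\<close> cases and spreads each \<open>\<delta> v\<close> with
  total weight at most \<open>1 - \<eta>\<close>, so the sum of oscillations shrinks by the factor
  \<open>(n - \<eta>) / n\<close>. The condition bounds the influences on \<open>v\<close> summed
  over their sources \<open>u\<close>, hence the sum of oscillations is the norm that
  contracts.\<close>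

lemma glauber_osc_contract:
  assumes ep: "edge_params n \<theta>" and ht: "high_temperature \<eta> n \<theta>" and n: "n > 0"
    and osc: "\<And>v x. v < n \<Longrightarrow> x \<in> configs n \<Longrightarrow> \<bar>f (x(v := 1)) - f (x(v := -1))\<bar> \<le> \<delta> v"
  shows "\<exists>\<delta>'. (\<forall>v<n. \<forall>x\<in>configs n.
      \<bar>glauber n (pmf (ising n h \<theta>)) f (x(v := 1)) - glauber n (pmf (ising n h \<theta>)) f (x(v := -1))\<bar> \<le> \<delta>' v)
    \<and> (\<Sum>v<n. \<delta>' v) \<le> (1 - \<eta> / real n) * (\<Sum>v<n. \<delta> v)"
proof -
  let ?w = "pmf (ising n h \<theta>)"
  define b where "b u v = (if u = v then 0 else \<delta> u + tanh \<bar>\<theta> u v\<bar> * \<delta> v)" for u v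
  define \<delta>' where "\<delta>' u = (\<Sum>v<n. b u v) / real n" for u
  have \<delta>0: "0 \<le> \<delta> v" if "v < n" for v
  proof -
    obtain x where "x \<in> configs n"
      using set_pmf_not_empty[of "ising n h \<theta>"] by (auto simp: set_pmf_ising)
    from osc[OF that this] show ?thesis by linarith
  qed
  have row: "(\<Sum>u\<in>{..<n} - {v}. tanh \<bar>\<theta> u v\<bar>) \<le> 1 - \<eta>" if "v < n" for v
  proof -
    have "(\<Sum>u\<in>{..<n} - {v}. tanh \<bar>\<theta> u v\<bar>) \<le> (MAX v\<in>{..<n}. \<Sum>u\<in>{..<n} - {v}. tanh \<bar>\<theta> u v\<bar>)"
      using that by (intro Max_ge) auto
    with ht show ?thesis by (simp add: high_temperature_def)
  qed
  have "\<bar>glauber n ?w f (x(u := 1)) - glauber n ?w f (x(u := -1))\<bar> \<le> \<delta>' u"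
    if "u < n" "x \<in> configs n" for u x
  proof -
    have "\<bar>glauber n ?w f (x(u := 1)) - glauber n ?w f (x(u := -1))\<bar>
        = \<bar>(\<Sum>v<n. heat_bath ?w v f (x(u := 1)) - heat_bath ?w v f (x(u := -1))) / real n\<bar>"
      by (simp add: glauber_def sum_subtractf diff_divide_distrib)
    also have "\<dots> \<le> (\<Sum>v<n. \<bar>heat_bath ?w v f (x(u := 1)) - heat_bath ?w v f (x(u := -1))\<bar>) / real n"
      unfolding abs_divide abs_of_nat by (intro divide_right_mono sum_abs) simp
    also have "\<dots> \<le> \<delta>' u"
      unfolding \<delta>'_def
    proof (intro divide_right_mono sum_mono)
      fix v assume "v \<in> {..<n}"
      then have "v < n" by simp
      show "\<bar>heat_bath ?w v f (x(u := 1)) - heat_bath ?w v f (x(u := -1))\<bar> \<le> b u v"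
        unfolding b_def by (rule heat_bath_osc[OF ep that(1) \<open>v < n\<close> that(2)]) (rule osc)
    qed simp
    finally show ?thesis .
  qed
  moreover have "(\<Sum>u<n. \<delta>' u) \<le> (1 - \<eta> / real n) * (\<Sum>v<n. \<delta> v)"
  proof -
    have "(\<Sum>u<n. \<Sum>v<n. b u v) = (\<Sum>u<n. \<Sum>v<n. (if u = v then 0 else \<delta> u))
        + (\<Sum>u<n. \<Sum>v<n. (if u = v then 0 else tanh \<bar>\<theta> u v\<bar> * \<delta> v))"
      unfolding sum.distrib[symmetric] b_def by (intro sum.cong refl) auto
    also have "(\<Sum>u<n. \<Sum>v<n. (if u = v then 0 else \<delta> u)) = (\<Sum>u<n. (real n - 1) * \<delta> u)"
    proof (intro sum.cong refl)
      fix u assume "u \<in> {..<n}"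
      moreover have "(\<Sum>v<n. (if u = v then 0 else \<delta> u)) = (\<Sum>v<n. \<delta> u - (if u = v then \<delta> u else 0))"
        by (intro sum.cong) auto
      ultimately show "(\<Sum>v<n. (if u = v then 0 else \<delta> u)) = (real n - 1) * \<delta> u"
        by (simp add: sum_subtractf algebra_simps)
    qed
    also have "(\<Sum>u<n. \<Sum>v<n. (if u = v then 0 else tanh \<bar>\<theta> u v\<bar> * \<delta> v))
        = (\<Sum>v<n. (\<Sum>u\<in>{..<n} - {v}. tanh \<bar>\<theta> u v\<bar>) * \<delta> v)"
    proof (subst sum.swap, intro sum.cong refl)
      fix v assume "v \<in> {..<n}"
      have "(\<Sum>u<n. if u = v then 0 else tanh \<bar>\<theta> u v\<bar> * \<delta> v)
          = (\<Sum>u\<in>{..<n} - {v}. tanh \<bar>\<theta> u v\<bar> * \<delta> v)"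
        by (intro sum.mono_neutral_cong_right) auto
      then show "(\<Sum>u<n. if u = v then 0 else tanh \<bar>\<theta> u v\<bar> * \<delta> v)
          = (\<Sum>u\<in>{..<n} - {v}. tanh \<bar>\<theta> u v\<bar>) * \<delta> v"
        by (simp add: sum_distrib_right)
    qed
    also have "\<dots> \<le> (\<Sum>v<n. (1 - \<eta>) * \<delta> v)"
      using row \<delta>0 by (intro sum_mono mult_right_mono) auto
    finally have "(\<Sum>u<n. \<Sum>v<n. b u v) \<le> (real n - \<eta>) * (\<Sum>v<n. \<delta> v)"
      by (simp add: sum_distrib_left[symmetric] sum_subtractf algebra_simps)
    then have "(\<Sum>u<n. \<Sum>v<n. b u v) / real n \<le> (real n - \<eta>) * (\<Sum>v<n. \<delta> v) / real n"
      by (rule divide_right_mono) simp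
    also have "\<dots> = (1 - \<eta> / real n) * (\<Sum>v<n. \<delta> v)"
      using n by (simp add: field_simps)
    finally show ?thesis
      by (simp add: \<delta>'_def sum_divide_distrib[symmetric])
  qed
  ultimately show ?thesis by blast
qed

lemma glauber_pow_self_adjoint:
  assumes "\<forall>x\<in>configs n. w x > 0"
  shows "(\<Sum>x\<in>configs n. w x * (g x * (glauber n w ^^ k) f x))
    = (\<Sum>x\<in>configs n. w x * ((glauber n w ^^ k) g x * f x))"
proof (induction k arbitrary: g)
  case (Suc k)
  have "(\<Sum>x\<in>configs n. w x * (g x * (glauber n w ^^ Suc k) f x))
      = (\<Sum>x\<in>configs n. w x * (glauber n w g x * (glauber n w ^^ k) f x))"
    using glauber_self_adjoint[OF assms] by simp
  also have "\<dots> = (\<Sum>x\<in>configs n. w x * ((glauber n w ^^ Suc k) g x * f x))"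
    unfolding Suc.IH by (simp add: funpow_swap1)
  finally show ?case .
qed simp

section \<open>From contraction of oscillations to a spectral gap\<close>

lemma weighted_Cauchy_Schwarz:
  fixes w f g :: "'a \<Rightarrow> real"
  assumes "\<And>x. x \<in> A \<Longrightarrow> w x \<ge> 0"
  shows "(\<Sum>x\<in>A. w x * (f x * g x))\<^sup>2 \<le> (\<Sum>x\<in>A. w x * (f x)\<^sup>2) * (\<Sum>x\<in>A. w x * (g x)\<^sup>2)"
proof -
  have "(\<Sum>x\<in>A. (sqrt (w x) * f x) * (sqrt (w x) * g x))\<^sup>2
      \<le> (\<Sum>x\<in>A. (sqrt (w x) * f x)\<^sup>2) * (\<Sum>x\<in>A. (sqrt (w x) * g x)\<^sup>2)"
    by (rule Cauchy_Schwarz_ineq_sum)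
  moreover have "(\<Sum>x\<in>A. (sqrt (w x) * f x) * (sqrt (w x) * g x)) = (\<Sum>x\<in>A. w x * (f x * g x))"
  proof (intro sum.cong refl)
    fix x assume "x \<in> A"
    have "(sqrt (w x) * f x) * (sqrt (w x) * g x) = (sqrt (w x) * sqrt (w x)) * (f x * g x)"
      by (simp only: mult_ac)
    with assms[OF \<open>x \<in> A\<close>] show "(sqrt (w x) * f x) * (sqrt (w x) * g x) = w x * (f x * g x)"
      by simp
  qed
  moreover have "(\<Sum>x\<in>A. (sqrt (w x) * f x)\<^sup>2) = (\<Sum>x\<in>A. w x * (f x)\<^sup>2)" for f
    using assms by (intro sum.cong refl) (simp add: power_mult_distrib)
  ultimately show ?thesis by simp
qed

text \<open>
  Read with \<open>a k = \<langle>f, P\<^sup>k f\<rangle>\<close> for a self-adjoint \<open>P\<close>: geometric decay in any norm bounds the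
  Rayleigh quotient, which replaces the spectral theorem.
\<close>

lemma doubling_decay:
  fixes a :: "nat \<Rightarrow> real"
  assumes a0: "a 0 > 0" and \<rho>: "\<rho> \<ge> 0"
    and sq: "\<And>j. (a (2 ^ j))\<^sup>2 \<le> a 0 * a (2 ^ Suc j)"
    and decay: "\<And>k. a k \<le> B * \<rho> ^ k"
  shows "a 1 \<le> \<rho> * a 0"
proof (rule ccontr)
  assume "\<not> ?thesis"
  then have gt: "\<rho> * a 0 < a 1" by simp
  define r where "r = a 1 / a 0"
  have r: "r > \<rho>" using gt a0 by (simp add: r_def field_simps)
  then have r0: "r > 0" using \<rho> by linarith
  \<comment> \<open>Each doubling squares the initial ratio \<open>r\<close>, so this lower bound
    persists; a ratio above \<rho> would eventually outgrow
    \<open>B * \<rho> ^ (2 ^ j)\<close>.\<close>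
  have pow: "r ^ (2 ^ j) * a 0 \<le> a (2 ^ j)" for j
  proof (induction j)
    case 0
    show ?case using a0 by (simp add: r_def)
  next
    case (Suc j)
    have "(r ^ (2 ^ j) * a 0)\<^sup>2 \<le> (a (2 ^ j))\<^sup>2"
      using Suc r0 a0 by (intro power_mono) auto
    also have "\<dots> \<le> a 0 * a (2 ^ Suc j)" by (rule sq)
    finally have "a 0 * (r ^ (2 ^ Suc j) * a 0) \<le> a 0 * a (2 ^ Suc j)"
      by (simp add: power2_eq_square mult_2 power_add algebra_simps)
    then show ?case using a0 by simp
  qed
  show False
  proof (cases "\<rho> = 0")
    case True
    with pow[of 0] decay[of 1] a0 r0 mult_pos_pos[OF r0 a0] show ?thesis by simp
  next
    case False
    with \<rho> have \<rho>0: "\<rho> > 0" by simp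
    have s1: "r / \<rho> > 1" using r \<rho>0 by simp
    then obtain N where N: "B / a 0 < (r / \<rho>) ^ N"
      using real_arch_pow by blast
    also have "(r / \<rho>) ^ N \<le> (r / \<rho>) ^ (2 ^ N)"
      using s1 less_exp[of N] by (intro power_increasing) auto
    also have "\<dots> \<le> B / a 0"
    proof -
      have "r ^ (2 ^ N) * a 0 \<le> B * \<rho> ^ (2 ^ N)"
        using pow[of N] decay[of "2 ^ N"] by linarith
      then show ?thesis
        using a0 \<rho>0 by (simp add: power_divide field_simps)
    qed
    finally show False by simp
  qed
qed

text \<open>Influences are nonnegative. The bound keeps the contraction factor nonnegative and makes
  \<open>1 / \<eta>\<^sup>2\<close> at least 1 in the error estimates.\<close>

lemma high_temperature_le_one:
  assumes "high_temperature \<eta> n \<theta>" and "n > 0"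
  shows "\<eta> \<le> 1"
proof -
  have "0 \<le> (\<Sum>u\<in>{..<n} - {0}. tanh \<bar>\<theta> u 0\<bar>)"
    by (intro sum_nonneg) simp
  also have "\<dots> \<le> (MAX v\<in>{..<n}. \<Sum>u\<in>{..<n} - {v}. tanh \<bar>\<theta> u v\<bar>)"
    using assms(2) by (intro Max_ge) auto
  finally show ?thesis
    using assms(1) by (simp add: high_temperature_def)
qed

text \<open>The mean stays zero under the chain, so small total oscillation makes an iterate
  uniformly small: the iterates decay like \<open>\<rho> ^ k\<close> with a constant depending on
  \<open>f\<close>. Reversibility and \<open>doubling_decay\<close> turn this rate into a bound on a
  single step, from which the constant has disappeared.\<close>

lemma glauber_spectral_gap:
  fixes f :: "(nat \<Rightarrow> real) \<Rightarrow> real"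
  assumes ep: "edge_params n \<theta>" and ht: "high_temperature \<eta> n \<theta>" and n: "n > 0"
    and mean0: "(\<Sum>x\<in>configs n. pmf (ising n h \<theta>) x * f x) = 0"
  shows "(\<Sum>x\<in>configs n. pmf (ising n h \<theta>) x * (f x * glauber n (pmf (ising n h \<theta>)) f x))
    \<le> (1 - \<eta> / real n) * (\<Sum>x\<in>configs n. pmf (ising n h \<theta>) x * (f x)\<^sup>2)"
proof -
  define w where "w = pmf (ising n h \<theta>)"
  define \<rho> where "\<rho> = 1 - \<eta> / real n"
  define P where "P k = (glauber n w ^^ k) f" for k
  define a where "a k = (\<Sum>x\<in>configs n. w x * (f x * P k x))" for k
  have w: "\<forall>x\<in>configs n. w x > 0" by (simp add: w_def pmf_ising_pos)
  have sum_w: "(\<Sum>x\<in>configs n. w x) = 1"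
    using expectation_ising[of n h \<theta> "\<lambda>_. 1"] by (simp add: w_def)
  have \<rho>: "\<rho> \<ge> 0"
    using high_temperature_le_one[OF ht n] n by (simp add: \<rho>_def field_simps)
  define S where "S = (\<Sum>v<n. MAX x\<in>configs n. \<bar>f (x(v := 1)) - f (x(v := -1))\<bar>)"
  have osc: "\<exists>\<delta>. (\<forall>v<n. \<forall>x\<in>configs n. \<bar>P k (x(v := 1)) - P k (x(v := -1))\<bar> \<le> \<delta> v)
      \<and> (\<Sum>v<n. \<delta> v) \<le> \<rho> ^ k * S" for k
  proof (induction k)
    case 0
    show ?case
      by (rule exI[of _ "\<lambda>v. MAX x\<in>configs n. \<bar>f (x(v := 1)) - f (x(v := -1))\<bar>"])
         (use finite_configs[of n] in \<open>auto simp: P_def S_def simp del: fun_upd_apply intro!: Max_ge\<close>)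
  next
    case (Suc k)
    then obtain \<delta> where \<delta>: "\<forall>v<n. \<forall>x\<in>configs n. \<bar>P k (x(v := 1)) - P k (x(v := -1))\<bar> \<le> \<delta> v"
      "(\<Sum>v<n. \<delta> v) \<le> \<rho> ^ k * S" by blast
    have "P (Suc k) = glauber n w (P k)" by (simp add: P_def)
    with glauber_osc_contract[OF ep ht n, of "P k" \<delta> h] \<delta>(1)
    obtain \<delta>' where \<delta>': "\<forall>v<n. \<forall>x\<in>configs n. \<bar>P (Suc k) (x(v := 1)) - P (Suc k) (x(v := -1))\<bar> \<le> \<delta>' v"
      "(\<Sum>v<n. \<delta>' v) \<le> \<rho> * (\<Sum>v<n. \<delta> v)"
      by (auto simp: w_def \<rho>_def)
    have "\<rho> * (\<Sum>v<n. \<delta> v) \<le> \<rho> ^ Suc k * S"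
      using mult_left_mono[OF \<delta>(2) \<rho>] by (simp add: mult.assoc)
    with \<delta>' show ?case by fastforce
  qed
  \<comment> \<open>Self-adjointness moves all powers onto the constant 1, which the chain
    fixes.\<close>
  have mean: "(\<Sum>x\<in>configs n. w x * P k x) = 0" for k
  proof -
    have "(\<Sum>x\<in>configs n. w x * (1 * P k x)) = (\<Sum>x\<in>configs n. w x * ((glauber n w ^^ k) (\<lambda>_. 1) x * f x))"
      unfolding P_def by (rule glauber_pow_self_adjoint[OF w])
    also have "(glauber n w ^^ k) (\<lambda>_. 1) = (\<lambda>_. 1)"
    proof (induction k)
      case (Suc k)
      then show ?case
        using n by (auto simp: glauber_def heat_bath_def)
    qed simp
    finally show ?thesis using mean0 by (simp add: w_def)
  qed
  have sup: "\<bar>P k x\<bar> \<le> \<rho> ^ k * S" if x: "x \<in> configs n" for k x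
  proof -
    obtain \<delta> where \<delta>: "\<forall>v<n. \<forall>x\<in>configs n. \<bar>P k (x(v := 1)) - P k (x(v := -1))\<bar> \<le> \<delta> v"
      "(\<Sum>v<n. \<delta> v) \<le> \<rho> ^ k * S" using osc by blast
    \<comment> \<open>As the mean of \<open>P k\<close> vanishes, its value at \<open>x\<close> is
      an average of the differences \<open>P k x - P k y\<close>.\<close>
    have "\<bar>P k x\<bar> = \<bar>\<Sum>y\<in>configs n. w y * (P k x - P k y)\<bar>"
      using mean[of k] sum_w by (simp add: right_diff_distrib sum_subtractf flip: sum_distrib_right)
    also have "\<dots> \<le> (\<Sum>y\<in>configs n. w y * (\<rho> ^ k * S))"
    proof (rule order_trans[OF sum_abs sum_mono])
      fix y assume y: "y \<in> configs n"
      have "\<bar>P k x - P k y\<bar> \<le> \<rho> ^ k * S"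
        using osc_sum_bound[of n "P k" \<delta> x y] \<delta> x y by auto
      then show "\<bar>w y * (P k x - P k y)\<bar> \<le> w y * (\<rho> ^ k * S)"
        using w y by (auto simp: abs_mult intro!: mult_mono)
    qed
    finally show ?thesis using sum_w by (simp flip: sum_distrib_right)
  qed
  have a0: "a 0 = (\<Sum>x\<in>configs n. w x * (f x)\<^sup>2)"
    by (simp add: a_def P_def power2_eq_square)
  have "a 1 \<le> \<rho> * a 0"
  proof (cases "a 0 > 0")
    case True
    show ?thesis
    proof (rule doubling_decay[of a, OF True \<rho>])
      fix j :: nat
      have "(a (2 ^ j))\<^sup>2 \<le> a 0 * (\<Sum>x\<in>configs n. w x * (P (2 ^ j) x)\<^sup>2)"
        unfolding a0 unfolding a_def using w by (intro weighted_Cauchy_Schwarz) (auto intro: less_imp_le)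
      \<comment> \<open>Half of the \<open>2 ^ Suc j\<close> steps are moved to the other side of
        the inner product.\<close>
      also have "(\<Sum>x\<in>configs n. w x * (P (2 ^ j) x)\<^sup>2) = a (2 ^ Suc j)"
      proof -
        have "a (2 ^ Suc j) = (\<Sum>x\<in>configs n. w x * (f x * (glauber n w ^^ (2 ^ j)) (P (2 ^ j)) x))"
          by (simp add: a_def P_def mult_2 funpow_add)
        also have "\<dots> = (\<Sum>x\<in>configs n. w x * (P (2 ^ j) x * P (2 ^ j) x))"
          unfolding glauber_pow_self_adjoint[OF w] by (simp add: P_def)
        finally show ?thesis by (simp add: power2_eq_square)
      qed
      finally show "(a (2 ^ j))\<^sup>2 \<le> a 0 * a (2 ^ Suc j)" .
    next
      fix k :: nat
      have "a k \<le> (\<Sum>x\<in>configs n. w x * (\<bar>f x\<bar> * (\<rho> ^ k * S)))"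
        unfolding a_def
      proof (intro sum_mono mult_left_mono)
        fix x assume x: "x \<in> configs n"
        have "f x * P k x \<le> \<bar>f x\<bar> * \<bar>P k x\<bar>" by (simp flip: abs_mult)
        also have "\<dots> \<le> \<bar>f x\<bar> * (\<rho> ^ k * S)" using sup[OF x] by (intro mult_left_mono) auto
        finally show "f x * P k x \<le> \<bar>f x\<bar> * (\<rho> ^ k * S)" .
        show "0 \<le> w x" using w x by (auto intro: less_imp_le)
      qed
      also have "\<dots> = (\<Sum>x\<in>configs n. w x * \<bar>f x\<bar>) * S * \<rho> ^ k"
        by (simp add: sum_distrib_left sum_distrib_right algebra_simps)
      finally show "a k \<le> (\<Sum>x\<in>configs n. w x * \<bar>f x\<bar>) * S * \<rho> ^ k" .
    qed
  next
    \<comment> \<open>\<open>doubling_decay\<close> asks for \<open>a 0 > 0\<close>; if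
      \<open>a 0\<close> vanishes, positivity of the weights forces \<open>f\<close> to vanish on
      all configurations.\<close>
    case False
    have nonneg: "w x * (f x)\<^sup>2 \<ge> 0" if "x \<in> configs n" for x
      using w that by (simp add: less_imp_le)
    with False have "a 0 = 0"
      unfolding a0 using sum_nonneg[of "configs n" "\<lambda>x. w x * (f x)\<^sup>2"] by fastforce
    then have "\<forall>x\<in>configs n. w x * (f x)\<^sup>2 = 0"
      unfolding a0 using nonneg by (subst (asm) sum_nonneg_eq_0_iff) (auto simp: finite_configs)
    then have "f x = 0" if "x \<in> configs n" for x
      using w that by fastforce
    with \<open>a 0 = 0\<close> show ?thesis by (simp add: a_def)
  qed
  then show ?thesis
    unfolding a0 \<rho>_def unfolding a_def P_def w_def by (simp only: One_nat_def funpow.simps o_apply id_apply)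
qed

text \<open>The gap \<open>\<eta> / n\<close> and the Dirichlet form carry the same factor
  \<open>1 / n\<close> from choosing the vertex at random, so the constant does not depend on
  \<open>n\<close>. The 4 is that of the fibre estimate.\<close>

lemma ising_poincare:
  fixes f :: "(nat \<Rightarrow> real) \<Rightarrow> real" and h :: "nat \<Rightarrow> real"
  assumes ep: "edge_params n \<theta>" and ht: "high_temperature \<eta> n \<theta>" and \<eta>: "\<eta> > 0" and n: "n > 0"
  defines "p \<equiv> ising n h \<theta>"
  shows "measure_pmf.expectation p (\<lambda>x. (f x - measure_pmf.expectation p f)\<^sup>2)
    \<le> (\<Sum>v<n. measure_pmf.expectation p (\<lambda>x. (f (x(v := 1)) - f (x(v := -1)))\<^sup>2)) / (4 * \<eta>)"
proof -
  define w where "w = pmf p"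
  define g where "g x = f x - measure_pmf.expectation p f" for x
  have E: "measure_pmf.expectation p F = (\<Sum>x\<in>configs n. w x * F x)" for F :: "_ \<Rightarrow> real"
    by (simp add: p_def w_def expectation_ising)
  have w: "\<forall>x\<in>configs n. w x > 0" by (simp add: w_def p_def pmf_ising_pos)
  have sum_w: "(\<Sum>x\<in>configs n. w x) = 1"
    using E[of "\<lambda>_. 1"] by simp
  have "(\<Sum>x\<in>configs n. w x * g x) = 0"
    using sum_w by (simp add: g_def right_diff_distrib sum_subtractf E flip: sum_distrib_right)
  then have gap: "(\<Sum>x\<in>configs n. w x * (g x * glauber n w g x))
      \<le> (1 - \<eta> / real n) * (\<Sum>x\<in>configs n. w x * (g x)\<^sup>2)"
    unfolding w_def p_def by (intro glauber_spectral_gap[OF ep ht n])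
  have "(\<eta> / real n) * (\<Sum>x\<in>configs n. w x * (g x)\<^sup>2)
      \<le> (\<Sum>x\<in>configs n. w x * (g x)\<^sup>2) - (\<Sum>x\<in>configs n. w x * (g x * glauber n w g x))"
    using gap by (simp add: algebra_simps)
  also have "\<dots> = (\<Sum>x\<in>configs n. w x * (g x * (g x - glauber n w g x)))"
    by (simp add: right_diff_distrib sum_subtractf power2_eq_square)
  also have "\<dots> \<le> (\<Sum>v<n. \<Sum>x\<in>configs n. w x * (g (x(v := 1)) - g (x(v := -1)))\<^sup>2) / (4 * real n)"
    by (rule glauber_dirichlet[OF w n])
  finally have *: "(\<eta> / real n) * (\<Sum>x\<in>configs n. w x * (g x)\<^sup>2)
      \<le> (\<Sum>v<n. \<Sum>x\<in>configs n. w x * (g (x(v := 1)) - g (x(v := -1)))\<^sup>2) / (4 * real n)" .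
  have "A \<le> B / (4 * \<eta>)" if "(\<eta> / real n) * A \<le> B / (4 * real n)" for A B
    using that n \<eta> by (simp add: field_simps)
  from this[OF *] have "(\<Sum>x\<in>configs n. w x * (g x)\<^sup>2)
      \<le> (\<Sum>v<n. \<Sum>x\<in>configs n. w x * (g (x(v := 1)) - g (x(v := -1)))\<^sup>2) / (4 * \<eta>)" .
  then have "measure_pmf.expectation p (\<lambda>x. (g x)\<^sup>2)
      \<le> (\<Sum>v<n. measure_pmf.expectation p (\<lambda>x. (g (x(v := 1)) - g (x(v := -1)))\<^sup>2)) / (4 * \<eta>)"
    unfolding E .
  moreover have "g a - g b = f a - f b" for a b
    by (simp add: g_def)
  ultimately have "measure_pmf.expectation p (\<lambda>x. (g x)\<^sup>2)
      \<le> (\<Sum>v<n. measure_pmf.expectation p (\<lambda>x. (f (x(v := 1)) - f (x(v := -1)))\<^sup>2)) / (4 * \<eta>)"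
    by (simp only:)
  then show ?thesis
    unfolding g_def .
qed

section \<open>Variances of linear and quadratic forms\<close>

lemma expectation_ising_sum:
  fixes f :: "'i \<Rightarrow> (nat \<Rightarrow> real) \<Rightarrow> real"
  shows "measure_pmf.expectation (ising n h \<theta>) (\<lambda>x. \<Sum>i\<in>I. f i x)
    = (\<Sum>i\<in>I. measure_pmf.expectation (ising n h \<theta>) (f i))"
  by (intro Bochner_Integration.integral_sum) simp

text \<open>Without external field the exponent is even, so a global change of sign preserves the
  law. Signs change only below \<open>n\<close>, since configurations equal \<open>undefined\<close>
  elsewhere.\<close>

lemma node_mean_zero:
  assumes nf: "no_external_field n h" and v: "v < n"
  shows "measure_pmf.expectation (ising n h \<theta>) (\<lambda>x. x v) = 0"
proof -
  define neg where "neg x = (\<lambda>i. if i < n then - x i else (x i :: real))" for x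
  have neg: "neg x \<in> configs n" if "x \<in> configs n" for x
    using that by (auto simp: neg_def configs_def PiE_iff extensional_def)
  have inv: "neg (neg x) = x" for x by (auto simp: neg_def)
  have "pair_form n \<theta> (neg x) = pair_form n \<theta> x" for x
    unfolding pair_form_def by (intro sum.cong refl) (auto simp: vertex_pairs_def neg_def)
  then have "ising_exponent n h \<theta> (neg x) = ising_exponent n h \<theta> x" for x
    using nf by (simp add: ising_exponent_pair_form no_external_field_def)
  then have pmf: "pmf (ising n h \<theta>) (neg x) = pmf (ising n h \<theta>) x" if "x \<in> configs n" for x
    using that neg[OF that] by (simp add: pmf_ising)
  have "(\<Sum>x\<in>configs n. pmf (ising n h \<theta>) x * x v) = (\<Sum>x\<in>configs n. pmf (ising n h \<theta>) (neg x) * neg x v)"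
    by (rule sum.reindex_bij_witness[of _ neg neg]) (auto simp: inv neg)
  also have "\<dots> = - (\<Sum>x\<in>configs n. pmf (ising n h \<theta>) x * x v)"
    unfolding sum_negf[symmetric] using v by (intro sum.cong refl) (simp add: pmf, simp add: neg_def)
  finally show ?thesis by (simp add: expectation_ising)
qed

lemma expectation_linear_form_zero:
  assumes "no_external_field n h" and "I \<subseteq> {..<n}"
  shows "measure_pmf.expectation (ising n h \<theta>) (\<lambda>x. \<Sum>u\<in>I. a u * x u) = 0"
  unfolding expectation_ising_sum
  using assms by (intro sum.neutral) (auto simp: node_mean_zero)

text \<open>The flip differences are the constants \<open>2 * a v\<close> for \<open>v\<close> in
  \<open>I\<close> and 0 otherwise, and the vanishing mean makes the variance a second
  moment.\<close>

lemma linear_form_second_moment: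
  assumes ep: "edge_params n \<theta>" and ht: "high_temperature \<eta> n \<theta>" and \<eta>: "\<eta> > 0"
    and nf: "no_external_field n h" and I: "I \<subseteq> {..<n}" and n: "n > 0"
  shows "measure_pmf.expectation (ising n h \<theta>) (\<lambda>x. (\<Sum>u\<in>I. a u * x u)\<^sup>2) \<le> (\<Sum>u\<in>I. (a u)\<^sup>2) / \<eta>"
proof -
  let ?E = "measure_pmf.expectation (ising n h \<theta>)"
  define f where "f x = (\<Sum>u\<in>I. a u * x u)" for x :: "nat \<Rightarrow> real"
  have fin: "finite I" using I finite_subset by blast
  have flip: "f (x(v := 1)) - f (x(v := -1)) = (if v \<in> I then 2 * a v else 0)" for x v
  proof -
    have "f (x(v := 1)) - f (x(v := -1)) = (\<Sum>u\<in>I. if u = v then 2 * a v else 0)"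
      unfolding f_def sum_subtractf[symmetric] by (intro sum.cong) auto
    then show ?thesis using fin by simp
  qed
  have Ef: "?E f = 0"
    unfolding f_def by (rule expectation_linear_form_zero[OF nf I])
  have "?E (\<lambda>x. (f x)\<^sup>2) \<le> (\<Sum>v<n. ?E (\<lambda>x. (f (x(v := 1)) - f (x(v := -1)))\<^sup>2)) / (4 * \<eta>)"
    using ising_poincare[OF ep ht \<eta> n, of h f] unfolding Ef by simp
  also have "(\<Sum>v<n. ?E (\<lambda>x. (f (x(v := 1)) - f (x(v := -1)))\<^sup>2)) = (\<Sum>v<n. if v \<in> I then 4 * (a v)\<^sup>2 else 0)"
    unfolding flip by (intro sum.cong refl) auto
  also have "\<dots> = 4 * (\<Sum>u\<in>I. (a u)\<^sup>2)"
    using I by (simp add: sum_distrib_left sum.inter_restrict[symmetric] Int_absorb1)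
  finally show ?thesis by (simp add: f_def)
qed

lemma expectation_pair_form:
  "measure_pmf.expectation (ising n h \<theta>) (pair_form n a)
    = (\<Sum>(u, v)\<in>vertex_pairs n. a u v * edge_marginal (ising n h \<theta>) u v)"
proof -
  have "pair_form n a = (\<lambda>x. \<Sum>e\<in>vertex_pairs n. a (fst e) (snd e) * (x (fst e) * x (snd e)))"
    by (auto simp: pair_form_def case_prod_unfold)
  then show ?thesis
    by (simp add: expectation_ising_sum edge_marginal_def case_prod_unfold)
qed

text \<open>Flipping \<open>v\<close> yields twice the linear form of column \<open>v\<close>, which
  is centred because there is no field, so the bound on linear forms applies to it. Each use of the
  Poincare inequality costs one factor \<open>1 / \<eta>\<close>; the 2 counts every pair from both
  ends.\<close>

lemma pair_form_variance:
  assumes ep: "edge_params n \<theta>" and ht: "high_temperature \<eta> n \<theta>" and \<eta>: "\<eta> > 0"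
    and nf: "no_external_field n h" and n: "n > 0"
    and sym: "\<And>u v. u < n \<Longrightarrow> v < n \<Longrightarrow> a u v = a v u"
  shows "measure_pmf.expectation (ising n h \<theta>)
      (\<lambda>x. (pair_form n a x - measure_pmf.expectation (ising n h \<theta>) (pair_form n a))\<^sup>2)
    \<le> 2 / \<eta>\<^sup>2 * (\<Sum>(u, v)\<in>vertex_pairs n. (a u v)\<^sup>2)"
proof -
  let ?E = "measure_pmf.expectation (ising n h \<theta>)"
  define L where "L v x = (\<Sum>u\<in>{..<n} - {v}. a u v * x u)" for v and x :: "nat \<Rightarrow> real"
  have flip: "(pair_form n a (x(v := 1)) - pair_form n a (x(v := -1)))\<^sup>2 = 4 * (L v x)\<^sup>2"
    if "v < n" for x v
    using pair_form_flip[of v n a x, OF that sym] by (simp add: L_def power_mult_distrib)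
  have "?E (\<lambda>x. (pair_form n a x - ?E (pair_form n a))\<^sup>2)
      \<le> (\<Sum>v<n. ?E (\<lambda>x. (pair_form n a (x(v := 1)) - pair_form n a (x(v := -1)))\<^sup>2)) / (4 * \<eta>)"
    by (rule ising_poincare[OF ep ht \<eta> n])
  also have "(\<Sum>v<n. ?E (\<lambda>x. (pair_form n a (x(v := 1)) - pair_form n a (x(v := -1)))\<^sup>2))
      = 4 * (\<Sum>v<n. ?E (\<lambda>x. (L v x)\<^sup>2))"
    by (simp add: flip sum_distrib_left)
  also have "4 * (\<Sum>v<n. ?E (\<lambda>x. (L v x)\<^sup>2)) / (4 * \<eta>)
      \<le> 4 * (\<Sum>v<n. (\<Sum>u\<in>{..<n} - {v}. (a u v)\<^sup>2) / \<eta>) / (4 * \<eta>)"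
    unfolding L_def using \<eta>
    by (intro divide_right_mono mult_left_mono sum_mono linear_form_second_moment[OF ep ht \<eta> nf _ n]) auto
  also have "\<dots> = (\<Sum>v<n. \<Sum>u\<in>{..<n} - {v}. (a u v)\<^sup>2) / \<eta>\<^sup>2"
    using \<eta> by (simp add: sum_divide_distrib[symmetric] power2_eq_square)
  also have "\<dots> = 2 / \<eta>\<^sup>2 * (\<Sum>(u, v)\<in>vertex_pairs n. (a u v)\<^sup>2)"
    by (subst sum_vertex_pairs_symmetric) (auto simp: sym)
  finally show ?thesis .
qed

lemma edge_marginal_commute: "edge_marginal p u v = edge_marginal p v u"
  by (simp add: edge_marginal_def mult.commute)

lemma expectation_ising_cong:
  fixes f g :: "(nat \<Rightarrow> real) \<Rightarrow> real"
  assumes "\<And>x. x \<in> configs n \<Longrightarrow> f x = g x"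
  shows "measure_pmf.expectation (ising n h \<theta>) f = measure_pmf.expectation (ising n h \<theta>) g"
  unfolding expectation_ising using assms by (intro sum.cong) auto

text \<open>
  With \<open>a u = \<mu>\<^bsub>uv\<^esub>\<close>, the sum \<open>S\<close> of squares is \<open>E (x\<^sub>v \<Sum> a\<^sub>u x\<^sub>u)\<close>, so Cauchy--Schwarz and the bound on
  linear forms give \<open>S\<^sup>2 \<le> S / \<eta>\<close>.
\<close>

lemma sum_edge_marginal_squares:
  assumes ep: "edge_params n \<theta>" and ht: "high_temperature \<eta> n \<theta>" and \<eta>: "\<eta> > 0"
    and nf: "no_external_field n h" and v: "v < n"
  shows "(\<Sum>u<n. (edge_marginal (ising n h \<theta>) u v)\<^sup>2) \<le> 1 / \<eta>"
proof -
  let ?E = "measure_pmf.expectation (ising n h \<theta>)"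
  let ?w = "pmf (ising n h \<theta>)"
  define a where "a u = edge_marginal (ising n h \<theta>) u v" for u
  define f where "f x = (\<Sum>u<n. a u * x u)" for x :: "nat \<Rightarrow> real"
  define S where "S = (\<Sum>u<n. (a u)\<^sup>2)"
  have "?E (\<lambda>x. x v * f x) = ?E (\<lambda>x. \<Sum>u<n. a u * (x u * x v))"
    by (simp add: f_def sum_distrib_left mult_ac)
  also have "\<dots> = S"
    by (simp add: expectation_ising_sum S_def a_def edge_marginal_def power2_eq_square)
  finally have S: "S = (\<Sum>x\<in>configs n. ?w x * (x v * f x))"
    by (simp add: expectation_ising)
  have "S\<^sup>2 \<le> (\<Sum>x\<in>configs n. ?w x * (x v)\<^sup>2) * (\<Sum>x\<in>configs n. ?w x * (f x)\<^sup>2)"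
    unfolding S by (rule weighted_Cauchy_Schwarz) simp
  also have "(\<Sum>x\<in>configs n. ?w x * (x v)\<^sup>2) = (\<Sum>x\<in>configs n. ?w x * 1)"
    using configs_value[OF _ v] by (intro sum.cong refl) fastforce
  also have "\<dots> = 1"
    using expectation_ising[of n h \<theta> "\<lambda>_. 1"] by simp
  also have "(\<Sum>x\<in>configs n. ?w x * (f x)\<^sup>2) = ?E (\<lambda>x. (f x)\<^sup>2)"
    by (simp add: expectation_ising)
  also have "\<dots> \<le> S / \<eta>"
    unfolding f_def S_def using v by (intro linear_form_second_moment[OF ep ht \<eta> nf]) auto
  finally have "S * S \<le> S * (1 / \<eta>)"
    by (simp add: power2_eq_square)
  moreover have "S \<ge> 0"
    unfolding S_def by (intro sum_nonneg) simp
  moreover have "1 / \<eta> \<ge> 0" using \<eta> by simp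
  ultimately have "S \<le> 1 / \<eta>"
    by (cases "S = 0") (simp, metis less_eq_real_def mult_le_cancel_left_pos)
  then show ?thesis by (simp add: S_def a_def)
qed

section \<open>Divergence, identifiability and product distributions\<close>

lemma ising_exponent_no_field:
  assumes "no_external_field n h"
  shows "ising_exponent n h \<theta> x = pair_form n \<theta> x"
  using assms by (simp add: ising_exponent_pair_form no_external_field_def)

lemma pair_form_diff: "pair_form n a x - pair_form n b x = pair_form n (\<lambda>u v. a u v - b u v) x"
  by (simp add: pair_form_def sum_subtractf[symmetric] case_prod_unfold left_diff_distrib)

text \<open>The log-likelihood ratio is the quadratic form with coefficients
  \<open>\<theta> - \<theta>'\<close> plus a constant; the constant, a difference of log partition
  functions, cancels between the two directions.\<close>

lemma d_SKL_ising:
  assumes nf: "no_external_field n h" and nf': "no_external_field n h'"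
  shows "d_SKL (ising n h \<theta>) (ising n h' \<theta>') = ereal (\<Sum>(u, v)\<in>vertex_pairs n.
    (\<theta> u v - \<theta>' u v) * (edge_marginal (ising n h \<theta>) u v - edge_marginal (ising n h' \<theta>') u v))"
proof -
  let ?p = "ising n h \<theta>" and ?q = "ising n h' \<theta>'"
  define c where "c = ln (partition_function n h' \<theta>') - ln (partition_function n h \<theta>)"
  define g where "g = pair_form n (\<lambda>u v. \<theta> u v - \<theta>' u v)"
  have lnp: "ln (pmf ?p x / pmf ?q x) = g x + c" if "x \<in> configs n" for x
    using that partition_function_pos[of n h \<theta>] partition_function_pos[of n h' \<theta>']
    by (simp add: pmf_ising ln_div ln_mult ising_exponent_no_field nf nf' g_def pair_form_diff[symmetric] c_def)
  have lnq: "ln (pmf ?q x / pmf ?p x) = - (g x + c)" if "x \<in> configs n" for x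
    using that pmf_ising_pos[OF that, of h \<theta>] pmf_ising_pos[OF that, of h' \<theta>'] lnp[OF that]
    by (simp add: ln_div)
  have fin: "finite (set_pmf ?p)" "finite (set_pmf ?q)"
    by (simp_all add: set_pmf_ising finite_configs)
  have E: "measure_pmf.expectation (ising n h \<theta>) (\<lambda>x. g x + c) = measure_pmf.expectation (ising n h \<theta>) g + c" for h \<theta>
    by simp
  have "d_KL ?p ?q = ereal (measure_pmf.expectation ?p (\<lambda>x. g x + c))"
    by (subst d_KL_finite[OF fin(2)])
       (auto simp: set_pmf_ising expectation_ising lnp intro!: sum.cong)
  moreover have "d_KL ?q ?p = ereal (- measure_pmf.expectation ?q (\<lambda>x. g x + c))"
    unfolding d_KL_finite[OF fin(1), of ?q, unfolded set_pmf_ising, OF order_refl]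
      expectation_ising sum_negf[symmetric] mult_minus_right[symmetric]
    using lnq by (intro arg_cong[where f = ereal] sum.cong refl) simp
  ultimately have "d_SKL ?p ?q = ereal (measure_pmf.expectation ?p g - measure_pmf.expectation ?q g)"
    unfolding E by (simp add: d_SKL_def)
  also have "measure_pmf.expectation ?p g - measure_pmf.expectation ?q g = (\<Sum>(u, v)\<in>vertex_pairs n.
      (\<theta> u v - \<theta>' u v) * (edge_marginal ?p u v - edge_marginal ?q u v))"
    unfolding g_def expectation_pair_form sum_subtractf[symmetric]
    by (intro sum.cong refl) (auto simp: algebra_simps)
  finally show ?thesis .
qed

text \<open>A mixed second difference of log probabilities isolates the parameter: flipping
  \<open>v\<close> removes the partition functions and leaves the local field at \<open>v\<close>,
  and flipping \<open>u\<close> in that removes everything except the edge between them.\<close>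

lemma ising_identifiable:
  assumes ep: "edge_params n \<theta>" "edge_params n \<theta>'"
    and eq: "ising n h \<theta> = ising n h' \<theta>'" and uv: "u < n" "v < n" "u \<noteq> v"
  shows "\<theta> u v = \<theta>' u v"
proof -
  define c where "c = ln (partition_function n h \<theta>) - ln (partition_function n h' \<theta>')"
  have H: "ising_exponent n h \<theta> x = ising_exponent n h' \<theta>' x + c" if "x \<in> configs n" for x
  proof -
    have "ln (pmf (ising n h \<theta>) x) = ln (pmf (ising n h' \<theta>') x)" by (simp add: eq)
    then show ?thesis
      using that partition_function_pos[of n h \<theta>] partition_function_pos[of n h' \<theta>']
      by (simp add: pmf_ising ln_div c_def)
  qed
  have lf: "local_field n h \<theta> v x = local_field n h' \<theta>' v x" if "x \<in> configs n" for x
    using ising_exponent_flip[OF ep(1) uv(2), of h x] ising_exponent_flip[OF ep(2) uv(2), of h' x]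
      H[OF configs_update[OF that uv(2), of 1]] H[OF configs_update[OF that uv(2), of "-1"]]
    by simp
  obtain x where x: "x \<in> configs n"
    using set_pmf_not_empty[of "ising n h \<theta>"] by (auto simp: set_pmf_ising)
  show ?thesis
    using local_field_flip[OF uv(1,3), of h \<theta> x] local_field_flip[OF uv(1,3), of h' \<theta>' x]
      lf[OF configs_update[OF x uv(1), of 1]] lf[OF configs_update[OF x uv(1), of "-1"]]
    by simp
qed

text \<open>Expectations factor over a product law, and the node means vanish by spin symmetry. This
  expresses the null hypothesis of the independence test through marginals.\<close>

lemma edge_marginal_product_dist:
  assumes p: "ising n h \<theta> \<in> product_dists n" and nf: "no_external_field n h"
    and uv: "u < n" "v < n" "u \<noteq> v"
  shows "edge_marginal (ising n h \<theta>) u v = 0"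
proof -
  obtain r where r: "ising n h \<theta> = Pi_pmf {..<n} undefined r"
    and rset: "\<forall>v<n. set_pmf (r v) \<subseteq> {-1, 1}"
    using p by (auto simp: product_dists_def)
  have int: "integrable (measure_pmf (r w)) f" if "w < n" for w and f :: "real \<Rightarrow> real"
    using rset that by (intro integrable_measure_pmf_finite) (meson finite.intros finite_subset)
  have nonneg: "0 \<le> 1 + z" if "w < n" "z \<in> set_pmf (r w)" for w z
  proof -
    have "z \<in> {-1, 1}" using rset that by blast
    then show ?thesis by auto
  qed
  \<comment> \<open>Shifted by 1, because the product rule for expectations requires nonnegative factors.\<close>
  define f where "f I w z = (if w \<in> I then 1 + z else (1::real))" for I :: "nat set" and w z
  have fprod: "(\<Prod>w\<in>{..<n}. f I w (x w)) = (\<Prod>w\<in>I. 1 + x w)" if "I \<subseteq> {..<n}" for I x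
    using that by (simp add: f_def prod.inter_restrict[symmetric] Int_absorb1)
  have Eprod: "measure_pmf.expectation (ising n h \<theta>) (\<lambda>x. \<Prod>w\<in>I. 1 + x w)
      = (\<Prod>w\<in>I. measure_pmf.expectation (r w) (\<lambda>z. 1 + z))" if I: "I \<subseteq> {..<n}" for I
  proof -
    have "measure_pmf.expectation (ising n h \<theta>) (\<lambda>x. \<Prod>w\<in>{..<n}. f I w (x w))
      = (\<Prod>w\<in>{..<n}. measure_pmf.expectation (r w) (f I w))"
      unfolding r using int nonneg
      by (intro expectation_prod_Pi_pmf) (auto simp: f_def)
    also have "\<dots> = (\<Prod>w\<in>{..<n}. if w \<in> I then measure_pmf.expectation (r w) (\<lambda>z. 1 + z) else 1)"
      unfolding f_def by (intro prod.cong refl) simp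
    finally show ?thesis
      using I by (simp add: fprod prod.inter_restrict[symmetric] Int_absorb1)
  qed
  have mean1: "measure_pmf.expectation (r w) (\<lambda>z. 1 + z) = 1" if "w < n" for w
    using Eprod[of "{w}"] node_mean_zero[OF nf that, of \<theta>] that by simp
  have "measure_pmf.expectation (ising n h \<theta>) (\<lambda>x. (1 + x u) * (1 + x v)) = 1"
    using Eprod[of "{u, v}"] mean1 uv by simp
  moreover have "(\<lambda>x. (1 + x u) * (1 + x v)) = (\<lambda>x::nat \<Rightarrow> real. 1 + x u + x v + x u * x v)"
    by (auto simp: algebra_simps)
  ultimately show ?thesis
    using node_mean_zero[OF nf uv(1), of \<theta>] node_mean_zero[OF nf uv(2), of \<theta>]
    by (simp add: edge_marginal_def)
qed

text \<open>This is the uniform law, the reference model of the independence test: the divergence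
  from it bounds the divergence from the product distributions from above.\<close>

lemma ising_zero_product_dist:
  assumes nf: "no_external_field n h"
  shows "ising n h (\<lambda>_ _. 0) \<in> product_dists n"
proof -
  define r where "r = (\<lambda>_::nat. pmf_of_set {-1, 1::real})"
  have "ising n h (\<lambda>_ _. 0) = Pi_pmf {..<n} undefined r"
  proof (rule pmf_eqI)
    fix x :: "nat \<Rightarrow> real"
    have Z: "partition_function n h (\<lambda>_ _. 0) = 2 ^ n"
      by (simp add: partition_function_def ising_exponent_no_field[OF nf] pair_form_def configs_def
          card_PiE case_prod_unfold)
    show "pmf (ising n h (\<lambda>_ _. 0)) x = pmf (Pi_pmf {..<n} undefined r) x"
    proof (cases "x \<in> configs n")
      case True
      then have "\<forall>w. w \<notin> {..<n} \<longrightarrow> x w = undefined" "\<forall>w<n. x w \<in> {-1, 1}"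
        by (auto simp: configs_def PiE_iff extensional_def)
      then have "pmf (Pi_pmf {..<n} undefined r) x = (\<Prod>w<n. 1 / 2)"
        by (subst pmf_Pi') (auto simp: r_def indicator_def intro!: prod.cong)
      with True show ?thesis
        by (simp add: pmf_ising Z ising_exponent_no_field[OF nf] pair_form_def case_prod_unfold power_one_over)
    next
      case False
      have "pmf (Pi_pmf {..<n} undefined r) x = 0"
      proof (cases "\<forall>w. w \<notin> {..<n} \<longrightarrow> x w = undefined")
        case True
        with False obtain w where "w < n" "x w \<notin> {-1, 1}"
          by (auto simp: configs_def PiE_iff extensional_def)
        then have "(\<Prod>w<n. pmf (r w) (x w)) = 0"
          by (intro prod_zero) (auto simp: r_def indicator_def)
        then show ?thesis using True by (subst pmf_Pi') auto
      next
        case False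
        then show ?thesis by (subst pmf_Pi) auto
      qed
      with False show ?thesis by (simp add: pmf_ising)
    qed
  qed
  moreover have "\<forall>v<n. set_pmf (r v) \<subseteq> {-1, 1}"
    by (simp add: r_def)
  ultimately show ?thesis
    unfolding product_dists_def by blast
qed

section \<open>Moments of sums over independent samples\<close>

lemma finite_set_replicate_pmf:
  assumes "finite (set_pmf p)"
  shows "finite (set_pmf (replicate_pmf k p))"
proof -
  have "set_pmf (replicate_pmf k p) = {xs. set xs \<subseteq> set_pmf p \<and> length xs = k}"
    unfolding set_replicate_pmf by auto
  then show ?thesis
    using finite_lists_length_eq[OF assms] by simp
qed

lemma expectation_bind_finite:
  fixes h :: "'b \<Rightarrow> real"
  assumes "finite (set_pmf p)" "\<And>x. x \<in> set_pmf p \<Longrightarrow> finite (set_pmf (f x))"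
  shows "measure_pmf.expectation (p \<bind> f) h
    = measure_pmf.expectation p (\<lambda>x. measure_pmf.expectation (f x) h)"
  using assms
  by (subst pmf_expectation_bind[of "set_pmf p"])
     (auto simp: integral_measure_pmf_real[of "set_pmf p"] mult.commute)

lemma expectation_cong_pmf:
  fixes f g :: "'a \<Rightarrow> real"
  assumes "\<And>x. x \<in> set_pmf p \<Longrightarrow> f x = g x"
  shows "measure_pmf.expectation p f = measure_pmf.expectation p g"
  using assms by (intro integral_cong_AE) (auto simp: AE_measure_pmf_iff)

lemma expectation_mono_finite:
  fixes f g :: "'a \<Rightarrow> real"
  assumes "finite (set_pmf p)" "\<And>x. x \<in> set_pmf p \<Longrightarrow> f x \<le> g x"
  shows "measure_pmf.expectation p f \<le> measure_pmf.expectation p g"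
  using assms by (intro integral_mono_AE integrable_measure_pmf_finite) (auto simp: AE_measure_pmf_iff)

lemma expectation_replicate_Suc:
  fixes F :: "'a list \<Rightarrow> real"
  assumes "finite (set_pmf p)"
  shows "measure_pmf.expectation (replicate_pmf (Suc k) p) F
    = measure_pmf.expectation p (\<lambda>x. measure_pmf.expectation (replicate_pmf k p) (\<lambda>xs. F (x # xs)))"
  using assms finite_set_replicate_pmf[OF assms, of k]
  by (simp add: expectation_bind_finite)

lemma expectation_replicate_add:
  fixes F :: "'a list \<Rightarrow> real"
  assumes "finite (set_pmf p)"
  shows "measure_pmf.expectation (replicate_pmf (j + k) p) F
    = measure_pmf.expectation (replicate_pmf j p)
        (\<lambda>xs. measure_pmf.expectation (replicate_pmf k p) (\<lambda>ys. F (xs @ ys)))"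
  using finite_set_replicate_pmf[OF assms]
  by (simp add: replicate_pmf_distrib expectation_bind_finite)

lemma expectation_replicate_sum_zero:
  fixes g :: "'a \<Rightarrow> real"
  assumes fin: "finite (set_pmf p)" and g: "measure_pmf.expectation p g = 0"
  shows "measure_pmf.expectation (replicate_pmf k p) (\<lambda>xs. \<Sum>x\<leftarrow>xs. g x) = 0"
proof (induction k)
  case (Suc k)
  have int: "integrable (measure_pmf (replicate_pmf k p)) f" "integrable (measure_pmf p) f'"
    for f :: "'a list \<Rightarrow> real" and f' :: "'a \<Rightarrow> real"
    using fin finite_set_replicate_pmf[OF fin] by (auto intro: integrable_measure_pmf_finite)
  show ?case
    unfolding expectation_replicate_Suc[OF fin] using Suc g int by simp
qed simp

text \<open>The cross term between the first sample and the rest vanishes in expectation, so second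
  moments add.\<close>

lemma expectation_replicate_sum_square:
  fixes g :: "'a \<Rightarrow> real"
  assumes fin: "finite (set_pmf p)" and g: "measure_pmf.expectation p g = 0"
  shows "measure_pmf.expectation (replicate_pmf k p) (\<lambda>xs. (\<Sum>x\<leftarrow>xs. g x)\<^sup>2)
    = real k * measure_pmf.expectation p (\<lambda>x. (g x)\<^sup>2)"
proof (induction k)
  case (Suc k)
  let ?Ek = "measure_pmf.expectation (replicate_pmf k p)"
  have int: "integrable (measure_pmf (replicate_pmf k p)) f" "integrable (measure_pmf p) f'"
    for f :: "'a list \<Rightarrow> real" and f' :: "'a \<Rightarrow> real"
    using fin finite_set_replicate_pmf[OF fin] by (auto intro: integrable_measure_pmf_finite)
  have "?Ek (\<lambda>xs. (\<Sum>x\<leftarrow>x # xs. g x)\<^sup>2) = (g x)\<^sup>2 + ?Ek (\<lambda>xs. (\<Sum>x\<leftarrow>xs. g x)\<^sup>2)" for x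
  proof -
    have "?Ek (\<lambda>xs. (\<Sum>x\<leftarrow>x # xs. g x)\<^sup>2)
        = ?Ek (\<lambda>xs. (g x)\<^sup>2 + 2 * g x * (\<Sum>x\<leftarrow>xs. g x) + (\<Sum>x\<leftarrow>xs. g x)\<^sup>2)"
      by (simp add: power2_sum algebra_simps)
    also have "\<dots> = (g x)\<^sup>2 + 2 * g x * ?Ek (\<lambda>xs. \<Sum>x\<leftarrow>xs. g x) + ?Ek (\<lambda>xs. (\<Sum>x\<leftarrow>xs. g x)\<^sup>2)"
      by (simp add: int)
    finally show ?thesis
      by (simp add: expectation_replicate_sum_zero[OF fin g])
  qed
  then show ?case
    unfolding expectation_replicate_Suc[OF fin] using Suc int by (simp add: algebra_simps)
qed simp

section \<open>The test statistic\<close>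

definition pair_sum :: "(nat \<Rightarrow> nat \<Rightarrow> real) \<Rightarrow> (nat \<Rightarrow> real) list \<Rightarrow> nat \<Rightarrow> nat \<Rightarrow> real" where
  "pair_sum M xs u v = (\<Sum>x\<leftarrow>xs. x u * x v - M u v)"

text \<open>With independent halves every summand has mean \<open>k^2\<close> times a squared
  difference of marginals. Cutting both halves to length \<open>k\<close> drops the last sample when
  \<open>k\<close> is half of an odd number, rounded down.\<close>

definition test_stat :: "nat \<Rightarrow> (nat \<Rightarrow> nat \<Rightarrow> real) \<Rightarrow> nat \<Rightarrow> (nat \<Rightarrow> real) list \<Rightarrow> real" where
  "test_stat n M k xs
    = (\<Sum>(u, v)\<in>vertex_pairs n. pair_sum M (take k xs) u v * pair_sum M (take k (drop k xs)) u v)"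

text \<open>Recentring from \<open>M\<close> to the true marginals splits a pair sum into noise and
  a drift proportional to the number of samples.\<close>

lemma pair_sum_shift: "pair_sum M xs u v = pair_sum M' xs u v + real (length xs) * (M' u v - M u v)"
  by (induction xs) (auto simp: pair_sum_def algebra_simps)

lemma pair_form_diff_const:
  "(\<Sum>(u, v)\<in>vertex_pairs n. b u v * (x u * x v - M u v))
    = pair_form n b x - (\<Sum>(u, v)\<in>vertex_pairs n. b u v * M u v)"
  by (simp add: pair_form_def case_prod_unfold right_diff_distrib sum_subtractf)

text \<open>Exchanging the two sums turns a weighted combination of correlated pair sums into a sum
  of one quadratic form over independent samples, to which the variance bound applies.\<close>

lemma sum_pair_sum:
  "(\<Sum>(u, v)\<in>vertex_pairs n. b u v * pair_sum M xs u v)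
    = (\<Sum>x\<leftarrow>xs. pair_form n b x - (\<Sum>(u, v)\<in>vertex_pairs n. b u v * M u v))"
proof (induction xs)
  case Nil
  then show ?case by (simp add: pair_sum_def case_prod_unfold)
next
  case (Cons x xs)
  have "(\<Sum>(u, v)\<in>vertex_pairs n. b u v * pair_sum M (x # xs) u v)
      = (\<Sum>(u, v)\<in>vertex_pairs n. b u v * (x u * x v - M u v))
        + (\<Sum>(u, v)\<in>vertex_pairs n. b u v * pair_sum M xs u v)"
    by (simp add: pair_sum_def case_prod_unfold distrib_left sum.distrib)
  then show ?case
    by (simp only: Cons.IH pair_form_diff_const list.map sum_list.Cons)
qed

locale ising_samples =
  fixes n :: nat and h :: "nat \<Rightarrow> real" and \<theta> :: "nat \<Rightarrow> nat \<Rightarrow> real" and \<eta> :: real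
  assumes ep: "edge_params n \<theta>" and ht: "high_temperature \<eta> n \<theta>" and \<eta>: "\<eta> > 0"
    and nf: "no_external_field n h" and n: "n > 0"
begin

abbreviation "p \<equiv> ising n h \<theta>"
abbreviation "\<mu> \<equiv> edge_marginal p"

lemma fin: "finite (set_pmf p)"
  by (simp add: set_pmf_ising finite_configs)

lemma fin_rep: "finite (set_pmf (replicate_pmf k p))"
  by (rule finite_set_replicate_pmf[OF fin])

lemma integrable_rep [simp]: "integrable (measure_pmf (replicate_pmf k p)) (f :: _ \<Rightarrow> real)"
  by (rule integrable_measure_pmf_finite[OF fin_rep])

lemma weighted_pair_sum_second_moment:
  assumes sym: "\<And>u v. u < n \<Longrightarrow> v < n \<Longrightarrow> b u v = b v u"
  shows "measure_pmf.expectation (replicate_pmf k p)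
      (\<lambda>xs. (\<Sum>(u, v)\<in>vertex_pairs n. b u v * pair_sum \<mu> xs u v)\<^sup>2)
    \<le> real k * (2 / \<eta>\<^sup>2 * (\<Sum>(u, v)\<in>vertex_pairs n. (b u v)\<^sup>2))"
proof -
  define g where "g = (\<lambda>x. pair_form n b x - measure_pmf.expectation p (pair_form n b))"
  have g0: "measure_pmf.expectation p g = 0"
    by (simp add: g_def)
  have "(\<Sum>(u, v)\<in>vertex_pairs n. b u v * pair_sum \<mu> xs u v) = (\<Sum>x\<leftarrow>xs. g x)" for xs
    unfolding sum_pair_sum g_def expectation_pair_form ..
  then have "measure_pmf.expectation (replicate_pmf k p)
      (\<lambda>xs. (\<Sum>(u, v)\<in>vertex_pairs n. b u v * pair_sum \<mu> xs u v)\<^sup>2)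
    = real k * measure_pmf.expectation p (\<lambda>x. (g x)\<^sup>2)"
    by (simp add: expectation_replicate_sum_square[OF fin g0])
  also have "\<dots> \<le> real k * (2 / \<eta>\<^sup>2 * (\<Sum>(u, v)\<in>vertex_pairs n. (b u v)\<^sup>2))"
    unfolding g_def by (intro mult_left_mono pair_form_variance[OF ep ht \<eta> nf n sym]) auto
  finally show ?thesis .
qed

text \<open>A product of two signs has square 1, so its variance is at most 1.\<close>

lemma pair_sum_second_moment:
  assumes uv: "u < n" "v < n"
  shows "measure_pmf.expectation (replicate_pmf k p) (\<lambda>xs. (pair_sum \<mu> xs u v)\<^sup>2) \<le> real k"
proof -
  define g where "g = (\<lambda>x. x u * x v - \<mu> u v)"
  have g0: "measure_pmf.expectation p g = 0"
    by (simp add: g_def edge_marginal_def)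
  have "measure_pmf.expectation p (\<lambda>x. (g x)\<^sup>2)
      = measure_pmf.expectation p (\<lambda>x. (x u * x v)\<^sup>2 - 2 * \<mu> u v * (x u * x v) + (\<mu> u v)\<^sup>2)"
    by (simp add: g_def power2_diff algebra_simps)
  also have "\<dots> = measure_pmf.expectation p (\<lambda>x. (x u * x v)\<^sup>2) - (\<mu> u v)\<^sup>2"
    by (simp add: edge_marginal_def power2_eq_square)
  also have "measure_pmf.expectation p (\<lambda>x. (x u * x v)\<^sup>2) = measure_pmf.expectation p (\<lambda>_. 1)"
  proof (rule expectation_ising_cong)
    fix x assume "x \<in> configs n"
    then show "(x u * x v)\<^sup>2 = 1"
      using configs_value[of x n u] configs_value[of x n v] uv by auto
  qed
  finally have "measure_pmf.expectation p (\<lambda>x. (g x)\<^sup>2) \<le> 1" by simp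
  then show ?thesis
    using expectation_replicate_sum_square[OF fin g0, of k] mult_left_mono[of _ 1 "real k"]
    by (simp add: pair_sum_def g_def)
qed

section \<open>Decomposition and concentration of the statistic\<close>

definition sq_dist :: "(nat \<Rightarrow> nat \<Rightarrow> real) \<Rightarrow> real" where
  "sq_dist M = (\<Sum>(u, v)\<in>vertex_pairs n. (\<mu> u v - M u v)\<^sup>2)"

definition product_sum :: "(nat \<Rightarrow> nat \<Rightarrow> real) \<Rightarrow> (nat \<Rightarrow> real) list \<Rightarrow> (nat \<Rightarrow> real) list \<Rightarrow> real" where
  "product_sum M xs ys = (\<Sum>(u, v)\<in>vertex_pairs n. pair_sum M xs u v * pair_sum M ys u v)"

text \<open>Both factors are noise plus the same drift; expanding leaves noise times noise and, for
  each half, drift times noise.\<close>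

lemma product_sum_decomp:
  assumes "length xs = k" "length ys = k"
  shows "product_sum M xs ys - (real k)\<^sup>2 * sq_dist M
    = (\<Sum>(u, v)\<in>vertex_pairs n. pair_sum \<mu> xs u v * pair_sum \<mu> ys u v)
      + real k * (\<Sum>(u, v)\<in>vertex_pairs n. (\<mu> u v - M u v) * pair_sum \<mu> xs u v)
      + real k * (\<Sum>(u, v)\<in>vertex_pairs n. (\<mu> u v - M u v) * pair_sum \<mu> ys u v)"
  unfolding product_sum_def sq_dist_def sum_distrib_left sum.distrib[symmetric] sum_subtractf[symmetric]
proof (intro sum.cong refl, clarify)
  fix u v
  show "pair_sum M xs u v * pair_sum M ys u v - (real k)\<^sup>2 * (\<mu> u v - M u v)\<^sup>2
    = pair_sum \<mu> xs u v * pair_sum \<mu> ys u v + real k * ((\<mu> u v - M u v) * pair_sum \<mu> xs u v)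
      + real k * ((\<mu> u v - M u v) * pair_sum \<mu> ys u v)"
    unfolding pair_sum_shift[of M xs u v \<mu>] pair_sum_shift[of M ys u v \<mu>] assms
    by (simp add: algebra_simps power2_eq_square)
qed

text \<open>Given \<open>xs\<close>, the term \<open>X\<close> is a weighted pair sum in
  \<open>ys\<close> whose weights are the noise of \<open>xs\<close>; bounding it over
  \<open>ys\<close> and then averaging the squared weights gives the order \<open>k^2 n^2\<close>.
  The inequality \<open>cube\<close> disposes of the cross terms at the price of a factor 3, whence
  6 = 3 * 2 and 12 = 3 * 4.\<close>

lemma product_sum_second_moment:
  assumes sym: "\<And>u v. u < n \<Longrightarrow> v < n \<Longrightarrow> M u v = M v u"
  shows "measure_pmf.expectation (replicate_pmf k p) (\<lambda>xs. measure_pmf.expectation (replicate_pmf k p)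
      (\<lambda>ys. (product_sum M xs ys - (real k)\<^sup>2 * sq_dist M)\<^sup>2))
    \<le> 6 / \<eta>\<^sup>2 * (real k)\<^sup>2 * (real n)\<^sup>2 + 12 / \<eta>\<^sup>2 * real k ^ 3 * sq_dist M"
proof -
  let ?E = "measure_pmf.expectation (replicate_pmf k p)"
  let ?V = "vertex_pairs n"
  define X where "X xs ys = (\<Sum>(u, v)\<in>?V. pair_sum \<mu> xs u v * pair_sum \<mu> ys u v)" for xs ys
  define Y where "Y xs = (\<Sum>(u, v)\<in>?V. (\<mu> u v - M u v) * pair_sum \<mu> xs u v)" for xs
  have symmu: "pair_sum \<mu> xs u v = pair_sum \<mu> xs v u" for xs u v
    by (simp add: pair_sum_def edge_marginal_commute[of p u v] mult.commute)
  have cube: "(a + b + c)\<^sup>2 \<le> 3 * (a\<^sup>2 + b\<^sup>2 + c\<^sup>2)" for a b c :: real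
  proof -
    have "0 \<le> (a - b)\<^sup>2 + (b - c)\<^sup>2 + (a - c)\<^sup>2" by simp
    then show ?thesis by (simp add: power2_eq_square algebra_simps)
  qed
  have EY: "?E (\<lambda>ys. (Y ys)\<^sup>2) \<le> real k * (2 / \<eta>\<^sup>2 * sq_dist M)"
    unfolding Y_def sq_dist_def
    by (rule weighted_pair_sum_second_moment) (simp add: sym edge_marginal_commute)
  have EX1: "?E (\<lambda>ys. (X xs ys)\<^sup>2) \<le> real k * (2 / \<eta>\<^sup>2 * (\<Sum>(u, v)\<in>?V. (pair_sum \<mu> xs u v)\<^sup>2))" for xs
    unfolding X_def by (rule weighted_pair_sum_second_moment) (rule symmu)
  have inner: "?E (\<lambda>ys. (product_sum M xs ys - (real k)\<^sup>2 * sq_dist M)\<^sup>2)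
      \<le> 3 * (?E (\<lambda>ys. (X xs ys)\<^sup>2) + (real k)\<^sup>2 * (Y xs)\<^sup>2 + (real k)\<^sup>2 * ?E (\<lambda>ys. (Y ys)\<^sup>2))"
    if "xs \<in> set_pmf (replicate_pmf k p)" for xs
  proof -
    have "?E (\<lambda>ys. (product_sum M xs ys - (real k)\<^sup>2 * sq_dist M)\<^sup>2)
        \<le> ?E (\<lambda>ys. 3 * ((X xs ys)\<^sup>2 + (real k)\<^sup>2 * (Y xs)\<^sup>2 + (real k)\<^sup>2 * (Y ys)\<^sup>2))"
    proof (rule expectation_mono_finite[OF fin_rep])
      fix ys assume "ys \<in> set_pmf (replicate_pmf k p)"
      then have "length xs = k" "length ys = k"
        using that by (auto simp: set_replicate_pmf)
      then show "(product_sum M xs ys - (real k)\<^sup>2 * sq_dist M)\<^sup>2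
          \<le> 3 * ((X xs ys)\<^sup>2 + (real k)\<^sup>2 * (Y xs)\<^sup>2 + (real k)\<^sup>2 * (Y ys)\<^sup>2)"
        unfolding product_sum_decomp[OF \<open>length xs = k\<close> \<open>length ys = k\<close>] X_def[symmetric] Y_def[symmetric]
        using cube[of "X xs ys" "real k * Y xs" "real k * Y ys"] by (simp add: power_mult_distrib)
    qed
    also have "\<dots> = 3 * (?E (\<lambda>ys. (X xs ys)\<^sup>2) + (real k)\<^sup>2 * (Y xs)\<^sup>2 + (real k)\<^sup>2 * ?E (\<lambda>ys. (Y ys)\<^sup>2))"
      by simp
    finally show ?thesis .
  qed
  have EX: "?E (\<lambda>xs. ?E (\<lambda>ys. (X xs ys)\<^sup>2)) \<le> 2 / \<eta>\<^sup>2 * (real k)\<^sup>2 * (real n)\<^sup>2"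
  proof -
    have "?E (\<lambda>xs. ?E (\<lambda>ys. (X xs ys)\<^sup>2))
        \<le> ?E (\<lambda>xs. real k * (2 / \<eta>\<^sup>2 * (\<Sum>e\<in>?V. (pair_sum \<mu> xs (fst e) (snd e))\<^sup>2)))"
      using EX1 by (intro expectation_mono_finite fin_rep) (simp add: case_prod_unfold)
    also have "\<dots> = real k * (2 / \<eta>\<^sup>2 * (\<Sum>e\<in>?V. ?E (\<lambda>xs. (pair_sum \<mu> xs (fst e) (snd e))\<^sup>2)))"
      by (simp add: Bochner_Integration.integral_sum)
    also have "\<dots> \<le> real k * (2 / \<eta>\<^sup>2 * (\<Sum>e\<in>?V. real k))"
      by (intro mult_left_mono sum_mono pair_sum_second_moment) (auto simp: vertex_pairs_def)
    also have "\<dots> \<le> real k * (2 / \<eta>\<^sup>2 * ((real n)\<^sup>2 * real k))"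
      using card_vertex_pairs_le[of n]
      by (intro mult_left_mono) (auto intro!: mult_right_mono simp flip: of_nat_power)
    finally show ?thesis by (simp add: power2_eq_square mult_ac)
  qed
  have "?E (\<lambda>xs. ?E (\<lambda>ys. (product_sum M xs ys - (real k)\<^sup>2 * sq_dist M)\<^sup>2))
      \<le> ?E (\<lambda>xs. 3 * (?E (\<lambda>ys. (X xs ys)\<^sup>2) + (real k)\<^sup>2 * (Y xs)\<^sup>2 + (real k)\<^sup>2 * ?E (\<lambda>ys. (Y ys)\<^sup>2)))"
    by (rule expectation_mono_finite[OF fin_rep inner])
  also have "\<dots> = 3 * (?E (\<lambda>xs. ?E (\<lambda>ys. (X xs ys)\<^sup>2)) + (real k)\<^sup>2 * ?E (\<lambda>ys. (Y ys)\<^sup>2)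
      + (real k)\<^sup>2 * ?E (\<lambda>ys. (Y ys)\<^sup>2))"
    by simp
  also have "\<dots> \<le> 3 * (2 / \<eta>\<^sup>2 * (real k)\<^sup>2 * (real n)\<^sup>2 + (real k)\<^sup>2 * (real k * (2 / \<eta>\<^sup>2 * sq_dist M))
      + (real k)\<^sup>2 * (real k * (2 / \<eta>\<^sup>2 * sq_dist M)))"
    using EX EY by (intro mult_left_mono add_mono) auto
  also have "\<dots> = 6 / \<eta>\<^sup>2 * (real k)\<^sup>2 * (real n)\<^sup>2 + 12 / \<eta>\<^sup>2 * real k ^ 3 * sq_dist M"
    by (simp add: algebra_simps power2_eq_square power3_eq_cube)
  finally show ?thesis .
qed

text \<open>Chebyshev's inequality. The \<open>r\<close> samples beyond the two halves do not enter
  the statistic, so averaging over them changes nothing.\<close>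

lemma test_stat_deviation:
  assumes sym: "\<And>u v. u < n \<Longrightarrow> v < n \<Longrightarrow> M u v = M v u" and km: "2 * k \<le> m" and t: "t > 0"
  shows "measure_pmf.prob (replicate_pmf m p) {xs. \<bar>test_stat n M k xs - (real k)\<^sup>2 * sq_dist M\<bar> \<ge> t}
    \<le> (6 / \<eta>\<^sup>2 * (real k)\<^sup>2 * (real n)\<^sup>2 + 12 / \<eta>\<^sup>2 * real k ^ 3 * sq_dist M) / t\<^sup>2"
proof -
  define F where "F = (\<lambda>xs. (test_stat n M k xs - (real k)\<^sup>2 * sq_dist M)\<^sup>2)"
  obtain r where m: "m = k + (k + r)"
    using km by (metis add.assoc le_Suc_ex mult_2)
  have "{xs. \<bar>test_stat n M k xs - (real k)\<^sup>2 * sq_dist M\<bar> \<ge> t} = {xs \<in> space (replicate_pmf m p). F xs \<ge> t\<^sup>2}"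
    using t by (auto simp: F_def abs_le_square_iff[symmetric])
  then have "measure_pmf.prob (replicate_pmf m p) {xs. \<bar>test_stat n M k xs - (real k)\<^sup>2 * sq_dist M\<bar> \<ge> t}
      \<le> measure_pmf.expectation (replicate_pmf m p) F / t\<^sup>2"
    using t integral_Markov_inequality_measure[of "replicate_pmf m p" F UNIV "t\<^sup>2"]
    by (simp add: F_def)
  also have "measure_pmf.expectation (replicate_pmf m p) F
     = measure_pmf.expectation (replicate_pmf k p) (\<lambda>xs. measure_pmf.expectation (replicate_pmf k p)
         (\<lambda>ys. measure_pmf.expectation (replicate_pmf r p) (\<lambda>zs. F (xs @ ys @ zs))))"
    unfolding m expectation_replicate_add[OF fin] ..
  also have "\<dots> = measure_pmf.expectation (replicate_pmf k p) (\<lambda>xs. measure_pmf.expectation (replicate_pmf k p)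
         (\<lambda>ys. (product_sum M xs ys - (real k)\<^sup>2 * sq_dist M)\<^sup>2))"
    by (intro expectation_cong_pmf)
       (simp add: set_replicate_pmf F_def test_stat_def product_sum_def)
  also have "\<dots> \<le> 6 / \<eta>\<^sup>2 * (real k)\<^sup>2 * (real n)\<^sup>2 + 12 / \<eta>\<^sup>2 * real k ^ 3 * sq_dist M"
    by (rule product_sum_second_moment[OF sym])
  finally show ?thesis
    by (simp add: divide_right_mono)
qed

text \<open>At distance zero the \<open>k^3\<close> term disappears and the failure probability is
  at most \<open>6 c n^2 / s^2\<close> for \<open>s = k \<tau>\<close>. The constant 144 is dictated
  by the far case and leaves ample room here.\<close>

lemma test_stat_null:
  assumes sym: "\<And>u v. u < n \<Longrightarrow> v < n \<Longrightarrow> M u v = M v u" and km: "2 * k \<le> m"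
    and null: "sq_dist M = 0" and \<tau>: "real k * \<tau> \<ge> 144 / \<eta>\<^sup>2 * real n" and k: "k > 0"
  shows "measure_pmf.prob (replicate_pmf m p) {xs. test_stat n M k xs > (real k)\<^sup>2 * \<tau>} \<le> 1 / 3"
proof -
  define c where "c = 1 / \<eta>\<^sup>2"
  have "\<eta> \<le> 1" by (rule high_temperature_le_one[OF ht n])
  then have c: "c \<ge> 1" using \<eta> by (simp add: c_def power_le_one)
  define s where "s = real k * \<tau>"
  have s: "s \<ge> 144 * c * real n" using \<tau> by (simp add: s_def c_def)
  have s0: "s > 0" using s c n by (smt (verit) mult_pos_pos of_nat_0_less_iff)
  have t: "(real k)\<^sup>2 * \<tau> = real k * s" by (simp add: s_def power2_eq_square)
  have t0: "real k * s > 0" using s0 k by simp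
  have "measure_pmf.prob (replicate_pmf m p) {xs. test_stat n M k xs > (real k)\<^sup>2 * \<tau>}
      \<le> measure_pmf.prob (replicate_pmf m p) {xs. \<bar>test_stat n M k xs - (real k)\<^sup>2 * sq_dist M\<bar> \<ge> real k * s}"
    using t by (intro measure_pmf.finite_measure_mono) (auto simp: null)
  also have "\<dots> \<le> (6 / \<eta>\<^sup>2 * (real k)\<^sup>2 * (real n)\<^sup>2) / (real k * s)\<^sup>2"
    using test_stat_deviation[of M k m, OF sym km t0] by (simp add: null)
  also have "\<dots> = 6 * c * (real n)\<^sup>2 / s\<^sup>2"
    using k by (simp add: c_def power_mult_distrib)
  also have "\<dots> \<le> 1 / 3"
  proof -
    have "c * 1 \<le> c * c" using c by (intro mult_left_mono) auto
    then have "18 * c \<le> (144 * c)\<^sup>2" using c unfolding power2_eq_square by linarith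
    then have "18 * c * (real n)\<^sup>2 \<le> (144 * c * real n)\<^sup>2"
      unfolding power_mult_distrib[of "144 * c"] by (intro mult_right_mono) auto
    also have "\<dots> \<le> s\<^sup>2" using s c by (intro power_mono) auto
    finally show ?thesis using s0 by (simp add: divide_le_eq)
  qed
  finally show ?thesis .
qed

text \<open>The mean is \<open>k * s\<close> and at least twice the threshold, so acceptance means a
  deviation of at least half the mean. The two error terms are \<open>24 c n^2 / s^2\<close> and
  \<open>48 c / s\<close>; \<open>s \<ge> 288 c n\<close> and \<open>n \<le> s\<close> make them at
  most 1/12 and 1/6.\<close>

lemma test_stat_far:
  assumes sym: "\<And>u v. u < n \<Longrightarrow> v < n \<Longrightarrow> M u v = M v u" and km: "2 * k \<le> m"
    and far: "sq_dist M \<ge> 2 * \<tau>" and \<tau>: "real k * \<tau> \<ge> 144 / \<eta>\<^sup>2 * real n" and k: "k > 0"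
  shows "measure_pmf.prob (replicate_pmf m p) {xs. test_stat n M k xs \<le> (real k)\<^sup>2 * \<tau>} \<le> 1 / 3"
proof -
  define c where "c = 1 / \<eta>\<^sup>2"
  have "\<eta> \<le> 1" by (rule high_temperature_le_one[OF ht n])
  then have c: "c \<ge> 1" using \<eta> by (simp add: c_def power_le_one)
  define L where "L = sq_dist M"
  define s where "s = real k * L"
  have "s \<ge> 2 * (real k * \<tau>)"
    using mult_left_mono[OF far, of "real k"] by (simp add: s_def L_def)
  then have s: "s \<ge> 288 * c * real n" using \<tau> by (simp add: c_def)
  have s0: "s > 0" using s c n by (smt (verit) mult_pos_pos of_nat_0_less_iff)
  have t0: "real k * s / 2 > 0" using s0 k by simp
  have "measure_pmf.prob (replicate_pmf m p) {xs. test_stat n M k xs \<le> (real k)\<^sup>2 * \<tau>}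
      \<le> measure_pmf.prob (replicate_pmf m p) {xs. \<bar>test_stat n M k xs - (real k)\<^sup>2 * sq_dist M\<bar> \<ge> real k * s / 2}"
  proof (intro measure_pmf.finite_measure_mono subsetI)
    fix xs assume "xs \<in> {xs. test_stat n M k xs \<le> (real k)\<^sup>2 * \<tau>}"
    moreover have "(real k)\<^sup>2 * (2 * \<tau>) \<le> (real k)\<^sup>2 * L"
      using far by (intro mult_left_mono) (auto simp: L_def)
    moreover have "(real k)\<^sup>2 * L = real k * s"
      by (simp add: s_def power2_eq_square)
    ultimately have "test_stat n M k xs - (real k)\<^sup>2 * L \<le> - (real k * s / 2)"
      unfolding mem_Collect_eq by linarith
    then show "xs \<in> {xs. \<bar>test_stat n M k xs - (real k)\<^sup>2 * sq_dist M\<bar> \<ge> real k * s / 2}"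
      using abs_ge_minus_self[of "test_stat n M k xs - (real k)\<^sup>2 * L"]
      unfolding mem_Collect_eq L_def by linarith
  qed simp
  also have "\<dots> \<le> (6 / \<eta>\<^sup>2 * (real k)\<^sup>2 * (real n)\<^sup>2 + 12 / \<eta>\<^sup>2 * real k ^ 3 * sq_dist M) / (real k * s / 2)\<^sup>2"
    by (rule test_stat_deviation[of M k m, OF sym km t0])
  also have "\<dots> = (real k)\<^sup>2 * (6 * c * (real n)\<^sup>2 + 12 * c * s) / ((real k)\<^sup>2 * (s / 2)\<^sup>2)"
    by (simp add: c_def s_def L_def algebra_simps power2_eq_square power3_eq_cube)
  also have "\<dots> = (6 * c * (real n)\<^sup>2 + 12 * c * s) / (s / 2)\<^sup>2"
    using k by simp
  also have "\<dots> \<le> 1 / 3"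
  proof -
    have "real n \<le> 288 * c * real n" using c mult_right_mono[of 1 "288 * c" "real n"] by simp
    then have ns: "real n \<le> s" using s by linarith
    have n1: "real n \<ge> 1" using n by simp
    have "288 * c \<le> s" using s mult_left_mono[OF n1, of "288 * c"] c by linarith
    then have "288 * c * s \<le> s * s" using s0 by (intro mult_right_mono) auto
    moreover have "72 * c * (real n)\<^sup>2 \<le> s * s / 4"
    proof -
      have "288 * c * real n * real n \<le> s * s"
        using s ns s0 by (intro mult_mono) auto
      then show ?thesis by (simp add: power2_eq_square)
    qed
    ultimately have "72 * c * (real n)\<^sup>2 + 144 * c * s \<le> s * s"
      using mult_nonneg_nonneg[of s s] s0 by linarith
    then show ?thesis using s0 by (simp add: divide_le_eq power2_eq_square)
  qed
  finally show ?thesis .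
qed

end

section \<open>Timed total correctness\<close>

text \<open>Total correctness with a step bound. The state comes last so that
  \<open>runs_in c T Q\<close> is itself a predicate on states and sequential programs nest as
  continuations.\<close>

definition runs_in :: "prog \<Rightarrow> nat \<Rightarrow> (ram_state \<Rightarrow> bool) \<Rightarrow> ram_state \<Rightarrow> bool" where
  "runs_in c T Q s \<longleftrightarrow> (\<exists>t s'. exec c s t s' \<and> t \<le> T \<and> Q s')"

lemma runs_in_mono:
  "runs_in c T Q s \<Longrightarrow> T \<le> T' \<Longrightarrow> (\<And>s'. Q s' \<Longrightarrow> Q' s') \<Longrightarrow> runs_in c T' Q' s"
  unfolding runs_in_def by (meson order_trans)

lemma runs_in_Skip: "Q s \<Longrightarrow> runs_in Skip 1 Q s"
  unfolding runs_in_def by (blast intro: exec.Skip)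

lemma runs_in_NSet: "Q ((fst s)(nval a s := nval e s), snd s) \<Longrightarrow> runs_in (NSet a e) 1 Q s"
  unfolding runs_in_def by (blast intro: exec.NSet)

lemma runs_in_RSet: "Q (fst s, (snd s)(nval a s := rval e s)) \<Longrightarrow> runs_in (RSet a e) 1 Q s"
  unfolding runs_in_def by (blast intro: exec.RSet)

lemma runs_in_Seq: "runs_in c1 T1 (runs_in c2 T2 Q) s \<Longrightarrow> runs_in (Seq c1 c2) (T1 + T2) Q s"
  unfolding runs_in_def by (meson add_mono exec.Seq)

lemma runs_in_Cond:
  assumes "tval b s \<Longrightarrow> runs_in c1 T Q s" "\<not> tval b s \<Longrightarrow> runs_in c2 T Q s"
  shows "runs_in (Cond b c1 c2) (1 + T) Q s"
proof (cases "tval b s")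
  case True
  with assms(1) show ?thesis
    unfolding runs_in_def by (meson add_le_cancel_left exec.CondTrue)
next
  case False
  with assms(2) show ?thesis
    unfolding runs_in_def by (meson add_le_cancel_left exec.CondFalse)
qed

text \<open>Each of the \<open>N\<close> rounds costs one test and at most \<open>T\<close> steps,
  and the final failing test costs one more.\<close>

lemma runs_in_While:
  assumes init: "I 0 s"
    and guard: "\<And>i s. i \<le> N \<Longrightarrow> I i s \<Longrightarrow> tval b s \<longleftrightarrow> i < N"
    and step: "\<And>i s. i < N \<Longrightarrow> I i s \<Longrightarrow> runs_in c T (I (Suc i)) s"
    and post: "\<And>s. I N s \<Longrightarrow> Q s"
  shows "runs_in (While b c) (N * (T + 1) + 1) Q s"
proof -
  have "runs_in (While b c) ((N - i) * (T + 1) + 1) Q s" if "i \<le> N" "I i s" for i s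
    using that
  proof (induction "N - i" arbitrary: i s)
    case 0
    then have "i = N" by simp
    with 0 guard[of N s] post[of s] have "\<not> tval b s" "Q s" by auto
    then show ?case
      unfolding runs_in_def using exec.WhileFalse[of b s c]
      by (intro exI[of _ "1::nat"] exI[of _ s]) auto
  next
    case (Suc l)
    then have i: "i < N" by simp
    with step[OF i Suc.prems(2)] obtain t1 s1
      where s1: "exec c s t1 s1" "t1 \<le> T" "I (Suc i) s1"
      unfolding runs_in_def by blast
    have "runs_in (While b c) ((N - Suc i) * (T + 1) + 1) Q s1"
      using Suc.hyps i s1(3) by (intro Suc.hyps(1)) auto
    then obtain t2 s2 where s2: "exec (While b c) s1 t2 s2" "t2 \<le> (N - Suc i) * (T + 1) + 1" "Q s2"
      unfolding runs_in_def by blast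
    have "exec (While b c) s (1 + t1 + t2) s2"
      using guard[of i s] i Suc.prems s1 s2 by (intro exec.WhileTrue) auto
    moreover have "1 + t1 + t2 \<le> (N - i) * (T + 1) + 1"
    proof -
      have "N - i = Suc (N - Suc i)" using i by simp
      then show ?thesis using s1(2) s2(2) by simp
    qed
    ultimately show ?case using s2(3) unfolding runs_in_def by blast
  qed
  from this[of 0 s] init show ?thesis by simp
qed

section \<open>The testing programs\<close>

abbreviation reg :: "nat \<Rightarrow> nexp" where
  "reg r \<equiv> NMem (NConst r)"

abbreviation set_reg :: "nat \<Rightarrow> nexp \<Rightarrow> prog" where
  "set_reg r e \<equiv> NSet (NConst r) e"

text \<open>
  Natural registers: 0, 1, 2 hold \<open>n\<close>, \<open>d\<close>, \<open>m\<close>; 3 holds \<open>k = m div 2\<close>; 4 is the address of the first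
  sample; 5, 6 are the vertices \<open>u\<close>, \<open>v\<close>; 7 is a loop counter; 8 is the address of the current
  sample; 9, 10 count agreements in the two halves; 11 is the address of row \<open>u\<close> of the reference
  marginals; 12 holds \<open>n\<^sup>2\<close>; 13 is a rejection flag; 14, 15 delimit the table of parameters. The
  only real cell ever written is 0: it first holds \<open>\<epsilon>\<close>, then the statistic minus the threshold.
\<close>

definition count_body :: "nat \<Rightarrow> prog" where
  "count_body r = Seq
     (Cond (RLess (ROfNat (NConst 0)) (RMul (RMem (NAdd (reg 8) (reg 5))) (RMem (NAdd (reg 8) (reg 6)))))
        (set_reg r (NAdd (reg r) (NConst 1))) Skip)
     (Seq (set_reg 8 (NAdd (reg 8) (reg 0))) (set_reg 7 (NAdd (reg 7) (NConst 1))))"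

text \<open>Register 8 is not reset: it ends just behind the block of samples read, so a second call
  continues with the second half.\<close>

definition count_prog :: "nat \<Rightarrow> prog" where
  "count_prog r = Seq (set_reg r (NConst 0)) (Seq (set_reg 7 (NConst 0))
     (While (NLess (reg 7) (reg 3)) (count_body r)))"

text \<open>Counting in a natural register instead of summing reals leaves real cell 0 to the
  statistic, and no other real cell has to be overwritten.\<close>

definition agreements :: "(nat \<Rightarrow> real) \<Rightarrow> nat \<Rightarrow> nat \<Rightarrow> nat \<Rightarrow> nat \<Rightarrow> nat \<Rightarrow> nat" where
  "agreements g b n u v k = (\<Sum>i<k. if 0 < g (b + i * n + u) * g (b + i * n + v) then 1 else 0)"

lemma runs_in_count_prog:
  assumes r: "r = 9 \<or> r = 10"
    and Q: "Q (f(r := agreements g (f 8) (f 0) (f 5) (f 6) (f 3), 7 := f 3, 8 := f 8 + f 3 * f 0), g)"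
  shows "runs_in (count_prog r) (5 * f 3 + 3) Q (f, g)"
proof -
  define I where "I i s \<longleftrightarrow> s = (f(r := agreements g (f 8) (f 0) (f 5) (f 6) i, 7 := i, 8 := f 8 + i * f 0), g)"
    for i and s :: ram_state
  have "runs_in (count_prog r) (1 + (1 + (f 3 * (4 + 1) + 1))) Q (f, g)"
    unfolding count_prog_def
  proof (intro runs_in_Seq runs_in_NSet runs_in_While[where I = I])
    show "I 0 ((fst ((fst (f, g))(nval (NConst r) (f, g) := nval (NConst 0) (f, g)), snd (f, g)))
          (nval (NConst 7) ((fst (f, g))(nval (NConst r) (f, g) := nval (NConst 0) (f, g)), snd (f, g)) :=
             nval (NConst 0) ((fst (f, g))(nval (NConst r) (f, g) := nval (NConst 0) (f, g)), snd (f, g))),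
         snd ((fst (f, g))(nval (NConst r) (f, g) := nval (NConst 0) (f, g)), snd (f, g)))"
      using r by (auto simp: I_def agreements_def fun_eq_iff)
  next
    fix i s assume "I i s"
    then show "tval (NLess (reg 7) (reg 3)) s \<longleftrightarrow> i < f 3"
      using r by (auto simp: I_def)
  next
    fix i s assume I: "I i s"
    have "runs_in (count_body r) (1 + 1 + (1 + 1)) (I (Suc i)) s"
      unfolding count_body_def
      by (intro runs_in_Seq runs_in_Cond runs_in_NSet runs_in_Skip)
         (use r I in \<open>auto simp: I_def agreements_def fun_eq_iff algebra_simps\<close>)
    then show "runs_in (count_body r) 4 (I (Suc i)) s"
      by (rule runs_in_mono) auto
  next
    fix s assume "I (f 3) s"
    then show "Q s" using Q by (simp add: I_def)
  qed
  then show ?thesis by (rule runs_in_mono) (auto simp: algebra_simps)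
qed

text \<open>
  A sum of \<open>k\<close> signs of which \<open>a\<close> are positive is \<open>2 a - k\<close>.
\<close>

definition deviation_term :: "nat \<Rightarrow> rexp \<Rightarrow> rexp" where
  "deviation_term r M = RSub (RSub (RAdd (ROfNat (reg r)) (ROfNat (reg r))) (ROfNat (reg 3)))
     (RMul (ROfNat (reg 3)) M)"

definition pair_body :: "rexp \<Rightarrow> prog" where
  "pair_body M = Seq (set_reg 8 (reg 4)) (Seq (count_prog 9) (Seq (count_prog 10)
     (Seq (RSet (NConst 0) (RAdd (RMem (NConst 0)) (RMul (deviation_term 9 M) (deviation_term 10 M))))
       (set_reg 6 (NAdd (reg 6) (NConst 1))))))"

definition pair_value :: "(nat \<Rightarrow> real) \<Rightarrow> (nat \<Rightarrow> real) \<Rightarrow> nat \<Rightarrow> nat \<Rightarrow> nat \<Rightarrow> nat \<Rightarrow> nat \<Rightarrow> nat \<Rightarrow> real" where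
  "pair_value g tbl a b n k u v =
     (2 * real (agreements g b n u v k) - real k - real k * tbl (a + v)) *
     (2 * real (agreements g (b + k * n) n u v k) - real k - real k * tbl (a + v))"

lemma agreements_upd0: "b > 0 \<Longrightarrow> agreements (g(0 := y)) b n u v k = agreements g b n u v k"
  by (simp add: agreements_def)

text \<open>The reference is an arbitrary expression, so that a constant 0 and a table lookup share
  one proof. Its value is assumed for all registers with a positive row address and for every
  content of cell 0, because both change along the way.\<close>

lemma runs_in_pair_body:
  assumes M: "\<And>f y. f 11 > 0 \<Longrightarrow> rval M (f, g(0 := y)) = tbl (f 11 + f 6)"
    and f: "f 4 > 0" "f 11 > 0"
    and Q: "\<And>f'. f' 6 = Suc (f 6) \<Longrightarrow> (\<And>r. r \<notin> {6..10} \<Longrightarrow> f' r = f r) \<Longrightarrow>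
      Q (f', g(0 := y + pair_value g tbl (f 11) (f 4) (f 0) (f 3) (f 5) (f 6)))"
  shows "runs_in (pair_body M) (10 * f 3 + 9) Q (f, g(0 := y))"
proof -
  let ?g = "g(0 := y)"
  define f1 where "f1 = f(8 := f 4)"
  define f2 where "f2 = f1(9 := agreements ?g (f1 8) (f1 0) (f1 5) (f1 6) (f1 3), 7 := f1 3, 8 := f1 8 + f1 3 * f1 0)"
  define f3 where "f3 = f2(10 := agreements ?g (f2 8) (f2 0) (f2 5) (f2 6) (f2 3), 7 := f2 3, 8 := f2 8 + f2 3 * f2 0)"
  have M3: "rval M (f3, ?g) = tbl (f 11 + f 6)"
    using M[of f3 y] f by (simp add: f3_def f2_def f1_def)
  have "runs_in (pair_body M) (1 + ((5 * f1 3 + 3) + ((5 * f2 3 + 3) + (1 + 1)))) Q (f, ?g)"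
    unfolding pair_body_def
  proof (rule runs_in_Seq, rule runs_in_NSet, rule runs_in_Seq)
    have "runs_in (count_prog 9) (5 * f1 3 + 3) (runs_in
        (Seq (count_prog 10) (Seq (RSet (NConst 0) (RAdd (RMem (NConst 0)) (RMul (deviation_term 9 M) (deviation_term 10 M))))
       (set_reg 6 (NAdd (reg 6) (NConst 1))))) ((5 * f2 3 + 3) + (1 + 1)) Q) (f1, ?g)"
    proof (rule runs_in_count_prog)
      show "runs_in (Seq (count_prog 10) (Seq (RSet (NConst 0) (RAdd (RMem (NConst 0)) (RMul (deviation_term 9 M) (deviation_term 10 M))))
        (set_reg 6 (NAdd (reg 6) (NConst 1))))) ((5 * f2 3 + 3) + (1 + 1)) Q
        (f1(9 := agreements ?g (f1 8) (f1 0) (f1 5) (f1 6) (f1 3), 7 := f1 3, 8 := f1 8 + f1 3 * f1 0), ?g)"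
        unfolding f2_def[symmetric]
      proof (rule runs_in_Seq, rule runs_in_count_prog)
        show "runs_in (Seq (RSet (NConst 0) (RAdd (RMem (NConst 0)) (RMul (deviation_term 9 M) (deviation_term 10 M))))
          (set_reg 6 (NAdd (reg 6) (NConst 1)))) (1 + 1) Q
          (f2(10 := agreements ?g (f2 8) (f2 0) (f2 5) (f2 6) (f2 3), 7 := f2 3, 8 := f2 8 + f2 3 * f2 0), ?g)"
          unfolding f3_def[symmetric]
        proof (rule runs_in_Seq, rule runs_in_RSet, rule runs_in_NSet)
          have f36: "f3 6 = f 6" by (simp add: f3_def f2_def f1_def)
          have val: "pair_value g tbl (f 11) (f 4) (f 0) (f 3) (f 5) (f 6)
              = rval (deviation_term 9 M) (f3, ?g) * rval (deviation_term 10 M) (f3, ?g)"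
            using f by (simp add: deviation_term_def M3)
              (simp add: f3_def f2_def f1_def pair_value_def agreements_upd0)
          have "Q (f3(6 := Suc (f 6)), g(0 := y + pair_value g tbl (f 11) (f 4) (f 0) (f 3) (f 5) (f 6)))"
            by (rule Q) (auto simp: f3_def f2_def f1_def)
          then show "Q ((fst (fst (f3, ?g), (snd (f3, ?g))(nval (NConst 0) (f3, ?g) :=
              rval (RAdd (RMem (NConst 0)) (RMul (deviation_term 9 M) (deviation_term 10 M))) (f3, ?g))))
              (nval (NConst 6) (fst (f3, ?g), (snd (f3, ?g))(nval (NConst 0) (f3, ?g) :=
              rval (RAdd (RMem (NConst 0)) (RMul (deviation_term 9 M) (deviation_term 10 M))) (f3, ?g)))
              := nval (NAdd (reg 6) (NConst 1)) (fst (f3, ?g), (snd (f3, ?g))(nval (NConst 0) (f3, ?g) :=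
              rval (RAdd (RMem (NConst 0)) (RMul (deviation_term 9 M) (deviation_term 10 M))) (f3, ?g)))),
              snd (fst (f3, ?g), (snd (f3, ?g))(nval (NConst 0) (f3, ?g) :=
              rval (RAdd (RMem (NConst 0)) (RMul (deviation_term 9 M) (deviation_term 10 M))) (f3, ?g))))"
            unfolding val by (simp add: f36)
        qed
      qed simp
    qed simp
    then show "runs_in (count_prog 9) (5 * f1 3 + 3) (runs_in
        (Seq (count_prog 10) (Seq (RSet (NConst 0) (RAdd (RMem (NConst 0)) (RMul (deviation_term 9 M) (deviation_term 10 M))))
       (set_reg 6 (NAdd (reg 6) (NConst 1))))) ((5 * f2 3 + 3) + (1 + 1)) Q)
       ((fst (f, ?g))(nval (NConst 8) (f, ?g) := nval (reg 4) (f, ?g)), snd (f, ?g))"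
      by (simp add: f1_def)
  qed
  then show ?thesis by (simp add: f2_def f1_def add.commute)
qed

text \<open>The machine has no multiplication of naturals, so the row address in register 11
  advances by \<open>n\<close> along with \<open>u\<close>. Each pair is visited once, with the
  larger vertex in the outer loop.\<close>

definition core_prog :: "rexp \<Rightarrow> prog" where
  "core_prog M = Seq (set_reg 5 (NConst 0)) (While (NLess (reg 5) (reg 0))
     (Seq (set_reg 6 (NConst 0)) (Seq (While (NLess (reg 6) (reg 5)) (pair_body M))
       (Seq (set_reg 11 (NAdd (reg 11) (reg 0))) (set_reg 5 (NAdd (reg 5) (NConst 1)))))))"

lemma runs_in_core_prog:
  assumes M: "\<And>f y. f 11 > 0 \<Longrightarrow> rval M (f, g(0 := y)) = tbl (f 11 + f 6)"
    and f: "f 0 = n" "f 3 = k" "f 4 = b" "f 11 = a" "b > 0" "a > 0"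
    and Q: "\<And>f'. (\<And>r. r \<notin> {5..11} \<Longrightarrow> f' r = f r) \<Longrightarrow>
      Q (f', g(0 := y + (\<Sum>u<n. \<Sum>v<u. pair_value g tbl (a + u * n) b n k u v)))"
  shows "runs_in (core_prog M) (n * (n * (10 * k + 10) + 5) + 2) Q (f, g(0 := y))"
proof -
  define D where "D u v = pair_value g tbl (a + u * n) b n k u v" for u v
  define I where "I u s \<longleftrightarrow> (\<forall>r. r \<notin> {5..11} \<longrightarrow> fst s r = f r) \<and> fst s 5 = u \<and> fst s 11 = a + u * n
      \<and> snd s = g(0 := y + (\<Sum>u'<u. \<Sum>v<u'. D u' v))" for u and s :: ram_state
  define J where "J u v s \<longleftrightarrow> (\<forall>r. r \<notin> {5..11} \<longrightarrow> fst s r = f r) \<and> fst s 5 = u \<and> fst s 11 = a + u * n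
      \<and> fst s 6 = v \<and> snd s = g(0 := y + (\<Sum>u'<u. \<Sum>v<u'. D u' v) + (\<Sum>v'<v. D u v'))"
    for u v and s :: ram_state
  have inner: "runs_in (pair_body M) (10 * k + 9) (J u (Suc v)) s" if J: "J u v s" for u v s
  proof -
    obtain f' g' where s: "s = (f', g')" by (cases s)
    have f': "f' 0 = n" "f' 3 = k" "f' 4 = b" "f' 5 = u" "f' 6 = v" "f' 11 = a + u * n"
      and g': "g' = g(0 := y + (\<Sum>u'<u. \<Sum>v<u'. D u' v) + (\<Sum>v'<v. D u v'))"
      using J f by (auto simp: J_def s)
    have "runs_in (pair_body M) (10 * f' 3 + 9) (J u (Suc v))
        (f', g(0 := y + (\<Sum>u'<u. \<Sum>v<u'. D u' v) + (\<Sum>v'<v. D u v')))"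
    proof (rule runs_in_pair_body[OF M])
      fix f'' assume f'': "f'' 6 = Suc (f' 6)" "\<And>r. r \<notin> {6..10} \<Longrightarrow> f'' r = f' r"
      have "f'' r = f r" if "r \<notin> {5..11}" for r
        using that f''(2)[of r] J by (auto simp: J_def s)
      then show "J u (Suc v) (f'', g(0 := y + (\<Sum>u'<u. \<Sum>v<u'. D u' v) + (\<Sum>v'<v. D u v')
          + pair_value g tbl (f' 11) (f' 4) (f' 0) (f' 3) (f' 5) (f' 6)))"
        using f'' f' by (simp add: J_def D_def add.assoc)
    qed (use f' f in auto)
    then show ?thesis by (simp add: s g' f')
  qed
  have "runs_in (core_prog M) (1 + (n * ((1 + ((n * (10 * k + 9 + 1) + 1) + (1 + 1))) + 1) + 1)) Q (f, g(0 := y))"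
    unfolding core_prog_def
  proof (rule runs_in_Seq, rule runs_in_NSet, rule runs_in_While[where I = I])
    show "I 0 ((fst (f, g(0 := y)))(nval (NConst 5) (f, g(0 := y)) := nval (NConst 0) (f, g(0 := y))), snd (f, g(0 := y)))"
      using f by (auto simp: I_def)
  next
    fix u s assume "I u s"
    then show "tval (NLess (reg 5) (reg 0)) s \<longleftrightarrow> u < n"
      using f by (simp add: I_def)
  next
    fix u s assume u: "u < n" and I: "I u s"
    show "runs_in (Seq (set_reg 6 (NConst 0)) (Seq (While (NLess (reg 6) (reg 5)) (pair_body M))
       (Seq (set_reg 11 (NAdd (reg 11) (reg 0))) (set_reg 5 (NAdd (reg 5) (NConst 1))))))
       (1 + ((n * (10 * k + 9 + 1) + 1) + (1 + 1))) (I (Suc u)) s"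
    proof (rule runs_in_Seq, rule runs_in_NSet, rule runs_in_Seq)
      have "runs_in (While (NLess (reg 6) (reg 5)) (pair_body M)) (u * (10 * k + 9 + 1) + 1)
          (runs_in (Seq (set_reg 11 (NAdd (reg 11) (reg 0))) (set_reg 5 (NAdd (reg 5) (NConst 1)))) (1 + 1) (I (Suc u)))
          ((fst s)(nval (NConst 6) s := nval (NConst 0) s), snd s)"
      proof (rule runs_in_While[where I = "J u"])
        show "J u 0 ((fst s)(nval (NConst 6) s := nval (NConst 0) s), snd s)"
          using I by (simp add: I_def J_def)
      next
        fix v s assume "J u v s"
        then show "tval (NLess (reg 6) (reg 5)) s \<longleftrightarrow> v < u" by (simp add: J_def)
      next
        fix v s assume "J u v s"
        then show "runs_in (pair_body M) (10 * k + 9) (J u (Suc v)) s" by (rule inner)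
      next
        fix s assume J: "J u u s"
        show "runs_in (Seq (set_reg 11 (NAdd (reg 11) (reg 0))) (set_reg 5 (NAdd (reg 5) (NConst 1)))) (1 + 1) (I (Suc u)) s"
          by (intro runs_in_Seq runs_in_NSet) (use J f in \<open>auto simp: I_def J_def\<close>)
      qed
      then show "runs_in (While (NLess (reg 6) (reg 5)) (pair_body M)) (n * (10 * k + 9 + 1) + 1)
          (runs_in (Seq (set_reg 11 (NAdd (reg 11) (reg 0))) (set_reg 5 (NAdd (reg 5) (NConst 1)))) (1 + 1) (I (Suc u)))
          ((fst s)(nval (NConst 6) s := nval (NConst 0) s), snd s)"
        by (rule runs_in_mono) (use u in auto)
    qed
  next
    fix s assume "I n s"
    moreover obtain f' g' where "s = (f', g')" by (cases s)
    ultimately show "Q s"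
      using Q[of f'] by (simp add: I_def D_def)
  qed
  then show ?thesis by (rule runs_in_mono) (auto simp: algebra_simps)
qed

text \<open>Cell 0 starts at minus the threshold, so the verdict depends on a sign. A tie counts as
  passing, which matters when \<open>k = 0\<close> and both sides vanish.\<close>

definition main_prog :: "rexp \<Rightarrow> prog" where
  "main_prog M = Seq (RSet (NConst 0) (RSub (ROfNat (NConst 0)) (RDiv
       (RMul (ROfNat (NConst 2)) (RMul (RMul (ROfNat (reg 1)) (ROfNat (reg 1)))
         (RMul (RMul (RMem (NConst 0)) (RMem (NConst 0))) (RMul (ROfNat (reg 3)) (ROfNat (reg 3))))))
       (RMul (ROfNat (reg 0)) (ROfNat (reg 0))))))
     (Seq (core_prog M)
       (Cond (TAnd (TNot (RLess (ROfNat (NConst 0)) (RMem (NConst 0)))) (NLess (reg 13) (NConst 1)))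
         (set_reg 0 (NConst 1)) (set_reg 0 (NConst 0))))"

definition passes :: "(nat \<Rightarrow> real) \<Rightarrow> (nat \<Rightarrow> real) \<Rightarrow> nat \<Rightarrow> nat \<Rightarrow> nat \<Rightarrow> nat \<Rightarrow> nat \<Rightarrow> bool" where
  "passes g tbl a b n d k \<longleftrightarrow> (\<Sum>u<n. \<Sum>v<u. pair_value g tbl (a + u * n) b n k u v)
     \<le> (real k)\<^sup>2 * (2 * (real d)\<^sup>2 * (g 0)\<^sup>2 / (real n)\<^sup>2)"

lemma runs_in_main_prog:
  assumes M: "\<And>f y. f 11 > 0 \<Longrightarrow> rval M (f, g(0 := y)) = tbl (f 11 + f 6)"
    and f: "f 0 = n" "f 1 = d" "f 3 = k" "f 4 = b" "f 11 = a" "b > 0" "a > 0"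
  shows "runs_in (main_prog M) (n * (n * (10 * k + 10) + 5) + 5)
    (\<lambda>s. fst s 0 = (if passes g tbl a b n d k \<and> f 13 = 0 then 1 else 0)) (f, g)"
proof -
  define y where "y = - ((real k)\<^sup>2 * (2 * (real d)\<^sup>2 * (g 0)\<^sup>2 / (real n)\<^sup>2))"
  define S where "S = (\<Sum>u<n. \<Sum>v<u. pair_value g tbl (a + u * n) b n k u v)"
  let ?Q = "\<lambda>s. fst s 0 = (if passes g tbl a b n d k \<and> f 13 = 0 then 1 else (0::nat))"
  have passes: "passes g tbl a b n d k \<longleftrightarrow> \<not> 0 < y + S"
    by (auto simp: passes_def y_def S_def)
  have "runs_in (main_prog M) (1 + ((n * (n * (10 * k + 10) + 5) + 2) + (1 + 1))) ?Q (f, g)"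
    unfolding main_prog_def
  proof (rule runs_in_Seq, rule runs_in_RSet, rule runs_in_Seq)
    let ?c = "Cond (TAnd (TNot (RLess (ROfNat (NConst 0)) (RMem (NConst 0)))) (NLess (reg 13) (NConst 1)))
         (set_reg 0 (NConst 1)) (set_reg 0 (NConst 0))"
    have "runs_in (core_prog M) (n * (n * (10 * k + 10) + 5) + 2) (runs_in ?c (1 + 1) ?Q) (f, g(0 := y))"
    proof (rule runs_in_core_prog[OF M f(1,3,4,5,6,7)])
      fix f' assume f': "\<And>r. r \<notin> {5..11} \<Longrightarrow> f' r = f r"
      then have "f' 13 = f 13" by simp
      then show "runs_in ?c (1 + 1) ?Q (f', g(0 := y + (\<Sum>u<n. \<Sum>v<u. pair_value g tbl (a + u * n) b n k u v)))"
        unfolding S_def[symmetric]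
        by (intro runs_in_Cond runs_in_NSet) (auto simp: passes)
    qed
    moreover have "rval (RSub (ROfNat (NConst 0)) (RDiv
       (RMul (ROfNat (NConst 2)) (RMul (RMul (ROfNat (reg 1)) (ROfNat (reg 1)))
         (RMul (RMul (RMem (NConst 0)) (RMem (NConst 0))) (RMul (ROfNat (reg 3)) (ROfNat (reg 3))))))
       (RMul (ROfNat (reg 0)) (ROfNat (reg 0))))) (f, g) = y"
      using f by (simp add: y_def power2_eq_square algebra_simps)
    ultimately show "runs_in (core_prog M) (n * (n * (10 * k + 10) + 5) + 2) (runs_in ?c (1 + 1) ?Q)
       (fst (f, g), (snd (f, g))(nval (NConst 0) (f, g) := rval (RSub (ROfNat (NConst 0)) (RDiv
       (RMul (ROfNat (NConst 2)) (RMul (RMul (ROfNat (reg 1)) (ROfNat (reg 1)))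
         (RMul (RMul (RMem (NConst 0)) (RMem (NConst 0))) (RMul (ROfNat (reg 3)) (ROfNat (reg 3))))))
       (RMul (ROfNat (reg 0)) (ROfNat (reg 0))))) (f, g)))"
      by (simp only: fst_conv snd_conv nval.simps)
  qed
  then show ?thesis by (rule runs_in_mono) (auto simp: algebra_simps)
qed

text \<open>There is no division of naturals; counting up until \<open>2 k + 1 \<ge> m\<close> stops
  exactly at \<open>m div 2\<close> for either parity. The count starts from the initial value 0 of
  register 3.\<close>

definition halve_prog :: prog where
  "halve_prog = While (NLess (NAdd (NAdd (reg 3) (reg 3)) (NConst 1)) (reg 2))
     (set_reg 3 (NAdd (reg 3) (NConst 1)))"

lemma runs_in_halve_prog:
  assumes "f 3 = 0" and Q: "Q (f(3 := f 2 div 2), g)"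
  shows "runs_in halve_prog (2 * f 2 + 1) Q (f, g)"
proof -
  have "runs_in halve_prog ((f 2 div 2) * (1 + 1) + 1) Q (f, g)"
    unfolding halve_prog_def
  proof (rule runs_in_While[where I = "\<lambda>i s. s = (f(3 := i), g)"])
    show "(f, g) = (f(3 := 0), g)" using assms by auto
  next
    fix i s assume "s = (f(3 := i), g)"
    then show "runs_in (set_reg 3 (NAdd (reg 3) (NConst 1))) 1 (\<lambda>s. s = (f(3 := Suc i), g)) s"
      by (intro runs_in_NSet) simp
  qed (use Q in auto)
  then show ?thesis by (rule runs_in_mono) auto
qed

text \<open>Samples start at address 1, behind \<epsilon>. The reference marginals are the constant
  0; register 11 receives 1 to satisfy the positivity condition on row addresses.\<close>

definition independence_prog :: prog where
  "independence_prog = Seq halve_prog (Seq (set_reg 4 (NConst 1)) (Seq (set_reg 11 (NConst 1))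
     (main_prog (ROfNat (NConst 0)))))"

lemma runs_in_independence_prog:
  assumes f: "f 0 = n" "f 1 = d" "f 2 = m" "f 3 = 0" "f 13 = 0"
  shows "runs_in independence_prog (n * (n * (10 * m + 10) + 5) + 2 * m + 8)
    (\<lambda>s. fst s 0 = (if passes g (\<lambda>_. 0) 1 1 n d (m div 2) then 1 else 0)) (f, g)"
proof -
  define k where "k = m div 2"
  let ?Q = "\<lambda>s. fst s 0 = (if passes g (\<lambda>_. 0) 1 1 n d k then 1 else (0::nat))"
  define f1 where "f1 = f(3 := k)"
  define f2 where "f2 = f1(4 := 1, 11 := 1)"
  have "runs_in (main_prog (ROfNat (NConst 0))) (n * (n * (10 * k + 10) + 5) + 5)
    (\<lambda>s. fst s 0 = (if passes g (\<lambda>_. 0) 1 1 n d k \<and> f2 13 = 0 then 1 else 0)) (f2, g)"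
    by (rule runs_in_main_prog) (use f in \<open>auto simp: f2_def f1_def\<close>)
  then have main: "runs_in (main_prog (ROfNat (NConst 0))) (n * (n * (10 * k + 10) + 5) + 5) ?Q (f2, g)"
    using f by (simp add: f2_def f1_def)
  have "runs_in independence_prog ((2 * f 2 + 1) + (1 + (1 + (n * (n * (10 * k + 10) + 5) + 5)))) ?Q (f, g)"
    unfolding independence_prog_def
    by (intro runs_in_Seq runs_in_halve_prog runs_in_NSet)
       (use main f in \<open>simp_all add: f1_def f2_def k_def\<close>)
  then show ?thesis
    unfolding k_def
  proof (rule runs_in_mono)
    have "n * (n * (10 * k + 10) + 5) \<le> n * (n * (10 * m + 10) + 5)"
      by (intro mult_le_mono add_le_mono) (auto simp: k_def)
    then show "(2 * f 2 + 1) + (1 + (1 + (n * (n * (10 * (m div 2) + 10) + 5) + 5)))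
        \<le> n * (n * (10 * m + 10) + 5) + 2 * m + 8"
      using f by (simp add: k_def)
  qed
qed

definition square_prog :: prog where
  "square_prog = Seq (set_reg 7 (NConst 0)) (While (NLess (reg 7) (reg 0))
     (Seq (set_reg 12 (NAdd (reg 12) (reg 0))) (set_reg 7 (NAdd (reg 7) (NConst 1)))))"

lemma runs_in_square_prog:
  assumes "f 12 = 0" and Q: "Q (f(12 := f 0 * f 0, 7 := f 0), g)"
  shows "runs_in square_prog (3 * f 0 + 2) Q (f, g)"
proof -
  have "runs_in square_prog (1 + (f 0 * ((1 + 1) + 1) + 1)) Q (f, g)"
    unfolding square_prog_def
  proof (rule runs_in_Seq, rule runs_in_NSet, rule runs_in_While[where I = "\<lambda>i s. s = (f(12 := i * f 0, 7 := i), g)"])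
    fix i s assume "s = (f(12 := i * f 0, 7 := i), g)"
    then show "runs_in (Seq (set_reg 12 (NAdd (reg 12) (reg 0))) (set_reg 7 (NAdd (reg 7) (NConst 1)))) (1 + 1)
        (\<lambda>s. s = (f(12 := Suc i * f 0, 7 := Suc i), g)) s"
      by (intro runs_in_Seq runs_in_NSet) (auto simp: fun_eq_iff)
  qed (use assms in \<open>auto simp: fun_eq_iff\<close>)
  then show ?thesis by (rule runs_in_mono) (auto simp: algebra_simps)
qed

text \<open>
  The given model may violate the bound on the parameters; by identifiability it then differs from
  the unknown one and can be rejected outright.
\<close>

definition bound_prog :: prog where
  "bound_prog = Seq (set_reg 14 (NAdd (NConst 1) (reg 0))) (Seq (set_reg 15 (NAdd (reg 14) (reg 12)))
     (While (NLess (reg 14) (reg 15)) (Seq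
       (Cond (RLess (RDiv (ROfNat (NConst 1)) (RMul (ROfNat (NConst 16)) (RMul (ROfNat (reg 1)) (ROfNat (reg 1)))))
           (RMul (RMem (reg 14)) (RMem (reg 14))))
         (set_reg 13 (NConst 1)) Skip)
       (set_reg 14 (NAdd (reg 14) (NConst 1))))))"

text \<open>Squares are compared, as the language has no absolute value, and
  \<open>1 / (16 d^2)\<close> is the square of \<open>1 / (4 d)\<close>.\<close>

lemma runs_in_bound_prog:
  assumes f: "f 0 = n" "f 1 = d" "f 12 = N" "f 13 = 0"
    and Q: "\<And>f'. (\<And>r. r \<notin> {13, 14, 15} \<Longrightarrow> f' r = f r) \<Longrightarrow>
      f' 13 = (if \<exists>j<N. 1 / (16 * (real d * real d)) < g (1 + n + j) * g (1 + n + j) then 1 else 0) \<Longrightarrow> Q (f', g)"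
  shows "runs_in bound_prog (4 * N + 3) Q (f, g)"
proof -
  define bad where "bad j \<longleftrightarrow> 1 / (16 * (real d * real d)) < g (1 + n + j) * g (1 + n + j)" for j
  define I where "I i s \<longleftrightarrow> s = (f(14 := 1 + n + i, 15 := 1 + n + N, 13 := (if \<exists>j<i. bad j then 1 else 0)), g)"
    for i and s :: ram_state
  have "runs_in bound_prog (1 + (1 + (N * (((1 + 1) + 1) + 1) + 1))) Q (f, g)"
    unfolding bound_prog_def
  proof (rule runs_in_Seq, rule runs_in_NSet, rule runs_in_Seq, rule runs_in_NSet, rule runs_in_While[where I = I])
    fix i s assume I: "I i s"
    show "runs_in (Seq
       (Cond (RLess (RDiv (ROfNat (NConst 1)) (RMul (ROfNat (NConst 16)) (RMul (ROfNat (reg 1)) (ROfNat (reg 1)))))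
           (RMul (RMem (reg 14)) (RMem (reg 14))))
         (set_reg 13 (NConst 1)) Skip)
       (set_reg 14 (NAdd (reg 14) (NConst 1)))) ((1 + 1) + 1) (I (Suc i)) s"
      by (intro runs_in_Seq runs_in_Cond runs_in_NSet runs_in_Skip)
         (use I f in \<open>auto simp: I_def bad_def fun_eq_iff less_Suc_eq\<close>)
  next
    fix s assume "I N s"
    then have "s = (f(14 := 1 + n + N, 15 := 1 + n + N, 13 := (if \<exists>j<N. bad j then 1 else 0)), g)"
      by (simp only: I_def)
    then show "Q s"
      by (simp only: Q[of "f(14 := 1 + n + N, 15 := 1 + n + N, 13 := (if \<exists>j<N. bad j then 1 else 0))"]
          fun_upd_apply bad_def insert_iff empty_iff) (rule Q; simp)
  qed (use f in \<open>auto simp: I_def fun_eq_iff\<close>)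
  then show ?thesis by (rule runs_in_mono) (auto simp: algebra_simps)
qed

text \<open>The addresses follow the input layout: cell 0, then \<open>n\<close> fields,
  \<open>n^2\<close> parameters, \<open>n\<close> node marginals and \<open>n^2\<close> edge
  marginals, then the samples. Hence the edge marginals begin at \<open>1 + 2 n + n^2\<close> and
  the samples another \<open>n^2\<close> cells later.\<close>

definition identity_prog :: prog where
  "identity_prog = Seq halve_prog (Seq square_prog (Seq bound_prog
     (Seq (set_reg 11 (NAdd (NAdd (NConst 1) (NAdd (reg 0) (reg 0))) (reg 12)))
     (Seq (set_reg 4 (NAdd (reg 11) (reg 12)))
       (main_prog (RMem (NAdd (reg 11) (reg 6))))))))"

lemma runs_in_identity_prog:
  assumes f: "f 0 = n" "f 1 = d" "f 2 = m" "f 3 = 0" "f 12 = 0" "f 13 = 0"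
  shows "runs_in identity_prog (n * (n * (10 * m + 10) + 5) + 4 * (n * n) + 3 * n + 2 * m + 13)
    (\<lambda>s. fst s 0 = (if passes g g (1 + 2 * n + n * n) (1 + 2 * n + 2 * (n * n)) n d (m div 2)
       \<and> (\<forall>j<n * n. g (1 + n + j) * g (1 + n + j) \<le> 1 / (16 * (real d * real d))) then 1 else 0)) (f, g)"
proof -
  define k where "k = m div 2"
  define a where "a = 1 + 2 * n + n * n"
  define b where "b = 1 + 2 * n + 2 * (n * n)"
  let ?M = "RMem (NAdd (reg 11) (reg 6))"
  let ?ok = "\<forall>j<n * n. g (1 + n + j) * g (1 + n + j) \<le> 1 / (16 * (real d * real d))"
  let ?Q = "\<lambda>s. fst s 0 = (if passes g g a b n d k \<and> ?ok then 1 else (0::nat))"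
  define f1 where "f1 = f(3 := k)"
  define f2 where "f2 = f1(12 := n * n, 7 := n)"
  have main: "runs_in (main_prog ?M) (n * (n * (10 * k + 10) + 5) + 5) ?Q (f3(11 := a, 4 := b), g)"
    if f3: "\<And>r. r \<notin> {13, 14, 15} \<Longrightarrow> f3 r = f2 r"
      "f3 13 = (if \<exists>j<n * n. 1 / (16 * (real d * real d)) < g (1 + n + j) * g (1 + n + j) then 1 else 0)" for f3
  proof -
    have "runs_in (main_prog ?M) (n * (n * (10 * k + 10) + 5) + 5)
      (\<lambda>s. fst s 0 = (if passes g g a b n d k \<and> (f3(11 := a, 4 := b)) 13 = 0 then 1 else 0)) (f3(11 := a, 4 := b), g)"
      by (rule runs_in_main_prog) (use f f3(1) in \<open>auto simp: f2_def f1_def a_def b_def\<close>)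
    moreover have "(f3(11 := a, 4 := b)) 13 = 0 \<longleftrightarrow> ?ok"
      by (simp add: f3(2) flip: not_less)
    ultimately show ?thesis by simp
  qed
  have "runs_in identity_prog ((2 * f 2 + 1) + ((3 * f1 0 + 2) + ((4 * (n * n) + 3)
      + (1 + (1 + (n * (n * (10 * k + 10) + 5) + 5)))))) ?Q (f, g)"
    unfolding identity_prog_def
  proof (rule runs_in_Seq, rule runs_in_halve_prog, rule f, rule runs_in_Seq)
    let ?rest = "Seq (set_reg 11 (NAdd (NAdd (NConst 1) (NAdd (reg 0) (reg 0))) (reg 12)))
       (Seq (set_reg 4 (NAdd (reg 11) (reg 12))) (main_prog ?M))"
    let ?T = "1 + (1 + (n * (n * (10 * k + 10) + 5) + 5))"
    have "runs_in bound_prog (4 * (n * n) + 3) (runs_in ?rest ?T ?Q) (f2, g)"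
    proof (rule runs_in_bound_prog[where n = n and d = d])
      fix f3 assume f3: "\<And>r. r \<notin> {13, 14, 15} \<Longrightarrow> f3 r = f2 r"
        "f3 13 = (if \<exists>j<n * n. 1 / (16 * (real d * real d)) < g (1 + n + j) * g (1 + n + j) then 1 else 0)"
      have "f3 0 = n" "f3 12 = n * n"
        using f f3(1) by (auto simp: f2_def f1_def)
      then show "runs_in ?rest ?T ?Q (f3, g)"
        using main[OF f3]
        by (intro runs_in_Seq runs_in_NSet) (simp add: a_def b_def mult_2 add.assoc)
    qed (use f in \<open>auto simp: f2_def f1_def\<close>)
    then have "runs_in (Seq bound_prog ?rest) ((4 * (n * n) + 3) + ?T) ?Q (f2, g)"
      by (rule runs_in_Seq)
    moreover have "f1(12 := f1 0 * f1 0, 7 := f1 0) = f2" "f1 12 = 0"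
      using f by (simp_all add: f1_def f2_def)
    ultimately have "runs_in square_prog (3 * f1 0 + 2) (runs_in (Seq bound_prog ?rest) ((4 * (n * n) + 3) + ?T) ?Q) (f1, g)"
      by (intro runs_in_square_prog) (simp_all only:)
    then show "runs_in square_prog (3 * f1 0 + 2) (runs_in (Seq bound_prog ?rest) ((4 * (n * n) + 3) + ?T) ?Q)
        (f(3 := f 2 div 2), g)"
      using f by (simp only: f1_def k_def)
  qed
  then show ?thesis
    unfolding k_def a_def b_def
  proof (rule runs_in_mono)
    have "n * (n * (10 * k + 10) + 5) \<le> n * (n * (10 * m + 10) + 5)"
      by (intro mult_le_mono add_le_mono) (auto simp: k_def)
    then show "(2 * f 2 + 1) + ((3 * f1 0 + 2) + ((4 * (n * n) + 3)
      + (1 + (1 + (n * (n * (10 * (m div 2) + 10) + 5) + 5)))))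
        \<le> n * (n * (10 * m + 10) + 5) + 4 * (n * n) + 3 * n + 2 * m + 13"
      using f by (simp add: k_def f1_def)
  qed
qed

section \<open>Reading the input\<close>

lemma concat_uniform:
  assumes "\<forall>l\<in>set ls. length l = n"
  shows length_concat_uniform: "length (concat ls) = length ls * n"
    and nth_concat_uniform: "i < length ls \<Longrightarrow> u < n \<Longrightarrow> concat ls ! (i * n + u) = ls ! i ! u"
proof -
  show "length (concat ls) = length ls * n"
    using assms by (induction ls) auto
  show "concat ls ! (i * n + u) = ls ! i ! u" if "i < length ls" "u < n"
    using assms that
  proof (induction ls arbitrary: i)
    case (Cons l ls)
    then show ?case by (cases i) (auto simp: nth_append add.assoc)
  qed simp
qed

lemma index_less_square:
  assumes "i < m" "u < n"
  shows "i * n + u < m * (n::nat)"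
proof -
  have "i * n + u < Suc i * n" using assms(2) by simp
  also have "\<dots> \<le> m * n" using assms(1) by (intro mult_le_mono1) simp
  finally show ?thesis .
qed

lemma length_tables [simp]:
  "length (node_table n f) = n"
  "length (edge_table n F) = n * n"
  "length (sample_table n xs) = length xs * n"
proof -
  show "length (node_table n f) = n" by (simp add: node_table_def)
  show "length (edge_table n F) = n * n"
    unfolding edge_table_def by (subst length_concat_uniform[where n = n]) auto
  show "length (sample_table n xs) = length xs * n"
    unfolding sample_table_def by (subst length_concat_uniform[where n = n]) (auto simp: node_table_def)
qed

lemma nth_edge_table: "u < n \<Longrightarrow> v < n \<Longrightarrow> edge_table n F ! (u * n + v) = F u v"
  unfolding edge_table_def by (subst nth_concat_uniform[where n = n]) auto

lemma nth_sample_table: "i < length xs \<Longrightarrow> u < n \<Longrightarrow> sample_table n xs ! (i * n + u) = (xs ! i) u"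
  unfolding sample_table_def by (subst nth_concat_uniform[where n = n]) (auto simp: node_table_def)

lemma load_append: "load (as @ bs) (length as + i) = load bs i"
  by (simp add: load_def nth_append)

lemma load_append_left: "i < length as \<Longrightarrow> load (as @ bs) i = load as i"
  by (simp add: load_def nth_append)

lemma load_edge_table: "u < n \<Longrightarrow> v < n \<Longrightarrow> load (edge_table n F) (u * n + v) = F u v"
  using index_less_square[of u n v n] by (simp add: load_def nth_edge_table)

lemma load_sample_table: "i < length xs \<Longrightarrow> u < n \<Longrightarrow> load (sample_table n xs) (i * n + u) = (xs ! i) u"
  using index_less_square[of i "length xs" u n] by (simp add: load_def nth_sample_table)

lemma load_header:
  "load [a, b, c] 0 = a" "load [a, b, c] 1 = b" "load [a, b, c] 2 = c"
  "load [a, b, c] 3 = 0" "load [a, b, c] 12 = 0" "load [a, b, c] 13 = 0"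
  by (simp_all add: load_def)

lemma load_independence:
  assumes "i < length xs" "u < n"
  shows "load (\<epsilon> # sample_table n xs) (1 + i * n + u) = (xs ! i) u"
  using load_append[of "[\<epsilon>]" "sample_table n xs" "i * n + u"] load_sample_table[OF assms] by simp

lemma load_identity:
  fixes \<epsilon> :: real and n h A h' B xs
  defines "L \<equiv> load (\<epsilon> # node_table n h @ edge_table n A @ node_table n h' @ edge_table n B @ sample_table n xs)"
  shows "L 0 = \<epsilon>"
    and "u < n \<Longrightarrow> v < n \<Longrightarrow> L (1 + n + (u * n + v)) = A u v"
    and "u < n \<Longrightarrow> v < n \<Longrightarrow> L (1 + 2 * n + n * n + u * n + v) = B u v"
    and "i < length xs \<Longrightarrow> u < n \<Longrightarrow> L (1 + 2 * n + 2 * (n * n) + i * n + u) = (xs ! i) u"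
proof -
  show "L 0 = \<epsilon>" by (simp add: L_def load_def)
  show "L (1 + n + (u * n + v)) = A u v" if "u < n" "v < n"
  proof -
    have "L (1 + n + (u * n + v)) = load ((\<epsilon> # node_table n h) @ edge_table n A @ node_table n h' @ edge_table n B @ sample_table n xs) (length (\<epsilon> # node_table n h) + (u * n + v))"
      by (simp add: L_def mult_2 add_ac)
    also have "\<dots> = load (edge_table n A @ node_table n h' @ edge_table n B @ sample_table n xs) (u * n + v)"
      by (rule load_append)
    also have "\<dots> = load (edge_table n A) (u * n + v)"
      using index_less_square[OF that] by (intro load_append_left) simp
    finally show ?thesis
      using that by (simp add: load_edge_table)
  qed
  show "L (1 + 2 * n + n * n + u * n + v) = B u v" if "u < n" "v < n"
  proof -
    have "L (1 + 2 * n + n * n + u * n + v) = load ((\<epsilon> # node_table n h @ edge_table n A @ node_table n h') @ edge_table n B @ sample_table n xs) (length (\<epsilon> # node_table n h @ edge_table n A @ node_table n h') + (u * n + v))"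
      by (simp add: L_def mult_2 add_ac)
    also have "\<dots> = load (edge_table n B @ sample_table n xs) (u * n + v)"
      by (rule load_append)
    also have "\<dots> = load (edge_table n B) (u * n + v)"
      using index_less_square[OF that] by (intro load_append_left) simp
    finally show ?thesis
      using that by (simp add: load_edge_table)
  qed
  show "L (1 + 2 * n + 2 * (n * n) + i * n + u) = (xs ! i) u" if "i < length xs" "u < n"
  proof -
    have "L (1 + 2 * n + 2 * (n * n) + i * n + u) = load ((\<epsilon> # node_table n h @ edge_table n A @ node_table n h' @ edge_table n B) @ sample_table n xs) (length (\<epsilon> # node_table n h @ edge_table n A @ node_table n h' @ edge_table n B) + (i * n + u))"
      by (simp add: L_def mult_2 add_ac)
    also have "\<dots> = load (sample_table n xs) (i * n + u)"
      by (rule load_append)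
    finally show ?thesis
      using that by (simp add: load_sample_table)
  qed
qed

section \<open>The programs compute the statistic\<close>

lemma two_agreements:
  assumes "\<And>i. i < k \<Longrightarrow> g (b + i * n + u) * g (b + i * n + v) = 1 \<or> g (b + i * n + u) * g (b + i * n + v) = -1"
  shows "2 * real (agreements g b n u v k) - real k = (\<Sum>i<k. g (b + i * n + u) * g (b + i * n + v))"
  using assms
proof (induction k)
  case (Suc k)
  have "2 * real (agreements g b n u v k) - real k = (\<Sum>i<k. g (b + i * n + u) * g (b + i * n + v))"
    using Suc by simp
  then show ?case
    using Suc.prems[of k] by (auto simp: agreements_def)
qed (simp add: agreements_def)

lemma sum_below_vertex_pairs:
  "(\<Sum>u<n. \<Sum>v<u. F u v) = (\<Sum>(v, u)\<in>vertex_pairs n. F u v)"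
proof -
  have "(\<Sum>u<n. \<Sum>v<u. F u v) = (\<Sum>(u, v)\<in>Sigma {..<n} (\<lambda>u. {..<u}). F u v)"
    by (rule sum.Sigma) auto
  also have "\<dots> = (\<Sum>(v, u)\<in>vertex_pairs n. F u v)"
    by (rule sum.reindex_bij_witness[of _ prod.swap prod.swap]) (auto simp: vertex_pairs_def)
  finally show ?thesis .
qed

lemma pair_sum_nth:
  "pair_sum M xs u v = (\<Sum>i<length xs. (xs ! i) u * (xs ! i) v) - real (length xs) * M u v"
  by (simp add: pair_sum_def sum_list_sum_nth sum_subtractf atLeast0LessThan)

text \<open>Samples are signs, so the counts of agreements determine the sums exactly. The second
  half starts \<open>k * n\<close> cells after the first, and the reference entry of a pair is read
  from the row of its larger vertex.\<close>

lemma pair_values_test_stat: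
  assumes xs: "xs \<in> sample_lists n" and k: "2 * k \<le> length xs"
    and smp: "\<And>i u. i < length xs \<Longrightarrow> u < n \<Longrightarrow> g (b + i * n + u) = (xs ! i) u"
    and tbl: "\<And>u v. u < n \<Longrightarrow> v < u \<Longrightarrow> tbl (a + u * n + v) = M v u"
  shows "(\<Sum>u<n. \<Sum>v<u. pair_value g tbl (a + u * n) b n k u v) = test_stat n M k xs"
  unfolding sum_below_vertex_pairs test_stat_def
proof (intro sum.cong refl, clarify)
  fix v u assume "(v, u) \<in> vertex_pairs n"
  then have vu: "v < u" "u < n" "v < n" by (auto simp: vertex_pairs_def)
  have pm: "(xs ! i) u * (xs ! i) v = 1 \<or> (xs ! i) u * (xs ! i) v = -1" if "i < length xs" for i
  proof -
    have "xs ! i \<in> configs n"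
      using xs that by (auto simp: sample_lists_def in_lists_conv_set)
    with configs_value[OF this vu(2)] configs_value[OF this vu(3)] show ?thesis by auto
  qed
  have 1: "2 * real (agreements g b n u v k) - real k = (\<Sum>i<k. (xs ! i) u * (xs ! i) v)"
    using two_agreements[of k g b n u v] pm k smp vu by simp
  have smp2: "g (b + k * n + i * n + w) = (xs ! (k + i)) w" if "i < k" "w < n" for i w
    using smp[of "k + i" w] that k by (simp add: algebra_simps)
  have 2: "2 * real (agreements g (b + k * n) n u v k) - real k = (\<Sum>i<k. (xs ! (k + i)) u * (xs ! (k + i)) v)"
    using two_agreements[of k g "b + k * n" n u v] pm k smp2 vu by simp
  have "pair_sum M (take k xs) v u = (\<Sum>i<k. (xs ! i) u * (xs ! i) v) - real k * M v u"
    using k by (simp add: pair_sum_nth min_absorb2 mult.commute)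
  moreover have "pair_sum M (take k (drop k xs)) v u = (\<Sum>i<k. (xs ! (k + i)) u * (xs ! (k + i)) v) - real k * M v u"
    using k by (simp add: pair_sum_nth min_absorb2 mult.commute)
  ultimately show "pair_value g tbl (a + u * n) b n k u v
      = pair_sum M (take k xs) v u * pair_sum M (take k (drop k xs)) v u"
    unfolding pair_value_def 1 2 using tbl[OF vu(2,1)] by simp
qed

text \<open>The number multiplying \<open>k^2\<close> is half of
  \<open>4 d^2 \<epsilon>^2 / n^2\<close>, the lower bound on the squared distance in the far
  case.\<close>

definition threshold :: "nat \<Rightarrow> nat \<Rightarrow> real \<Rightarrow> nat \<Rightarrow> real" where
  "threshold n d \<epsilon> k = (real k)\<^sup>2 * (2 * (real d)\<^sup>2 * \<epsilon>\<^sup>2 / (real n)\<^sup>2)"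

lemma runs_in_verdict:
  assumes "runs_in c T (\<lambda>s. fst s 0 = (if P then 1 else 0)) s"
  shows "P \<Longrightarrow> accepts c s" and "\<not> P \<Longrightarrow> rejects c s" and "T \<le> T' \<Longrightarrow> halts_within c s T'"
  using assms unfolding runs_in_def accepts_def rejects_def halts_within_def
  by (auto, fastforce+)

lemma independence_verdict:
  assumes xs: "xs \<in> sample_lists n"
  shows "runs_in independence_prog (n * (n * (10 * length xs + 10) + 5) + 2 * length xs + 8)
    (\<lambda>s. fst s 0 = (if test_stat n (\<lambda>_ _. 0) (length xs div 2) xs \<le> threshold n d \<epsilon> (length xs div 2) then 1 else 0))
    (independence_input n d \<epsilon> xs)"
proof -
  let ?g = "load (\<epsilon> # sample_table n xs)" and ?f = "load [n, d, length xs]"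
  have "passes ?g (\<lambda>_. 0) 1 1 n d (length xs div 2)
      \<longleftrightarrow> test_stat n (\<lambda>_ _. 0) (length xs div 2) xs \<le> threshold n d \<epsilon> (length xs div 2)"
    unfolding passes_def threshold_def
    by (subst pair_values_test_stat[OF xs, where M = "\<lambda>_ _. 0"]) (auto simp: load_independence[simplified] load_def[of _ 0])
  then show ?thesis
    using runs_in_independence_prog[of ?f n d "length xs" ?g]
    by (simp only: independence_input_def init_state_def load_header)
qed

lemma identity_verdict:
  fixes n :: nat and h \<theta>
  assumes xs: "xs \<in> sample_lists n" and d: "d \<ge> 1"
  defines "M \<equiv> edge_marginal (ising n h \<theta>)"
  shows "runs_in identity_prog (n * (n * (10 * length xs + 10) + 5) + 4 * (n * n) + 3 * n + 2 * length xs + 13)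
    (\<lambda>s. fst s 0 = (if test_stat n M (length xs div 2) xs \<le> threshold n d \<epsilon> (length xs div 2)
        \<and> (\<forall>u<n. \<forall>v<n. \<bar>\<theta> u v\<bar> \<le> 1 / (4 * real d)) then 1 else 0))
    (identity_input n d \<epsilon> h \<theta> xs)"
proof -
  let ?g = "load (\<epsilon> # node_table n h @ edge_table n \<theta>
        @ node_table n (node_marginal (ising n h \<theta>)) @ edge_table n M @ sample_table n xs)"
  let ?f = "load [n, d, length xs]"
  note L = load_identity[where \<epsilon> = \<epsilon> and n = n and h = h and A = \<theta>
      and h' = "node_marginal (ising n h \<theta>)" and B = M and xs = xs]
  have "passes ?g ?g (1 + 2 * n + n * n) (1 + 2 * n + 2 * (n * n)) n d (length xs div 2)
      \<longleftrightarrow> test_stat n M (length xs div 2) xs \<le> threshold n d \<epsilon> (length xs div 2)"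
    unfolding passes_def threshold_def L(1)
    by (subst pair_values_test_stat[OF xs, where M = M])
       (use L(3,4) in \<open>auto simp: M_def edge_marginal_commute\<close>)
  moreover have "(\<forall>j<n * n. ?g (1 + n + j) * ?g (1 + n + j) \<le> 1 / (16 * (real d * real d)))
      \<longleftrightarrow> (\<forall>u<n. \<forall>v<n. \<bar>\<theta> u v\<bar> \<le> 1 / (4 * real d))"
  proof -
    have sq: "x * x \<le> 1 / (16 * (real d * real d)) \<longleftrightarrow> \<bar>x\<bar> \<le> 1 / (4 * real d)" for x :: real
    proof -
      have "1 / (16 * (real d * real d)) = (1 / (4 * real d))\<^sup>2"
        by (simp add: power2_eq_square)
      then show ?thesis
        using abs_le_square_iff[of x "1 / (4 * real d)"] by (simp add: power2_eq_square)
    qed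
    show ?thesis
      unfolding sq
    proof (intro iffI allI impI)
      fix u v assume "\<forall>j<n * n. \<bar>?g (1 + n + j)\<bar> \<le> 1 / (4 * real d)" "u < n" "v < n"
      then show "\<bar>\<theta> u v\<bar> \<le> 1 / (4 * real d)"
        using L(2)[of u v] index_less_square[of u n v n] by metis
    next
      fix j assume *: "\<forall>u<n. \<forall>v<n. \<bar>\<theta> u v\<bar> \<le> 1 / (4 * real d)" and j: "j < n * n"
      then have "n > 0" by (cases n) auto
      then have "j mod n < n" "j div n < n" "j = j div n * n + j mod n"
        using j by (auto simp: less_mult_imp_div_less)
      then show "\<bar>?g (1 + n + j)\<bar> \<le> 1 / (4 * real d)"
        using L(2)[of "j div n" "j mod n"] * by metis
    qed
  qed
  ultimately show ?thesis
    using runs_in_identity_prog[of ?f n d "length xs" ?g]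
    by (simp only: identity_input_def init_state_def load_header M_def)
qed

section \<open>Sample size\<close>

lemma sq_form_lower:
  fixes a b :: "'i \<Rightarrow> real"
  assumes "card I \<le> n\<^sup>2" and a: "\<And>i. i \<in> I \<Longrightarrow> \<bar>a i\<bar> \<le> 1 / (2 * real d)" and d: "d > 0"
    and \<epsilon>: "0 < \<epsilon>" "\<epsilon> \<le> (\<Sum>i\<in>I. a i * b i)"
  shows "4 * (real d)\<^sup>2 * \<epsilon>\<^sup>2 \<le> (real n)\<^sup>2 * (\<Sum>i\<in>I. (b i)\<^sup>2)"
proof -
  have B: "0 \<le> (\<Sum>i\<in>I. (b i)\<^sup>2)" by (intro sum_nonneg) simp
  have "(\<Sum>i\<in>I. (a i)\<^sup>2) \<le> (\<Sum>i\<in>I. (1 / (2 * real d))\<^sup>2)"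
    using a d by (intro sum_mono) (simp add: abs_le_square_iff[symmetric])
  also have "\<dots> \<le> (real n)\<^sup>2 * (1 / (2 * real d))\<^sup>2"
    using assms(1) by (simp add: mult_right_mono flip: of_nat_power)
  finally have A: "(\<Sum>i\<in>I. (a i)\<^sup>2) \<le> (real n)\<^sup>2 * (1 / (2 * real d))\<^sup>2" .
  have "\<epsilon>\<^sup>2 \<le> (\<Sum>i\<in>I. a i * b i)\<^sup>2"
    using \<epsilon> by (intro power_mono) auto
  also have "\<dots> \<le> (\<Sum>i\<in>I. (a i)\<^sup>2) * (\<Sum>i\<in>I. (b i)\<^sup>2)"
    by (rule Cauchy_Schwarz_ineq_sum)
  also have "\<dots> \<le> (real n)\<^sup>2 * (1 / (2 * real d))\<^sup>2 * (\<Sum>i\<in>I. (b i)\<^sup>2)"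
    by (rule mult_right_mono[OF A B])
  finally show ?thesis
    using d by (simp add: field_simps power2_eq_square)
qed

text \<open>The exponent 3 is what the error analysis asks for; \<open>n \<ge> 1\<close> allows
  enlarging it to 10/3.\<close>

lemma cube_le_powr: "n > 0 \<Longrightarrow> real n ^ 3 \<le> real n powr (10 / 3)"
  using powr_mono[of 3 "10 / 3" "real n"] by (simp add: powr_realpow)

context ising_samples
begin

text \<open>Every column of marginals has squared norm at most \<open>1 / \<eta>\<close>. The total
  limits how far apart two models can be, which excludes the far case when there are too few samples
  to form two halves.\<close>

lemma sum_pairs_marginal_squares: "(\<Sum>(u, v)\<in>vertex_pairs n. (\<mu> u v)\<^sup>2) \<le> real n / \<eta>"
proof -
  have "(\<Sum>(u, v)\<in>vertex_pairs n. (\<mu> u v)\<^sup>2) \<le> (\<Sum>(u, v)\<in>{..<n} \<times> {..<n}. (\<mu> u v)\<^sup>2)"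
    by (intro sum_mono2 vertex_pairs_subset) auto
  also have "\<dots> = (\<Sum>v<n. \<Sum>u<n. (\<mu> u v)\<^sup>2)"
    by (subst sum.swap) (simp add: sum.cartesian_product)
  also have "\<dots> \<le> (\<Sum>v<n. 1 / \<eta>)"
    by (intro sum_mono sum_edge_marginal_squares[OF ep ht \<eta> nf]) auto
  finally show ?thesis by simp
qed

lemma sq_dist_le:
  assumes "(\<Sum>(u, v)\<in>vertex_pairs n. (M u v)\<^sup>2) \<le> real n / \<eta>"
  shows "sq_dist M \<le> 4 * real n / \<eta>"
proof -
  have "sq_dist M \<le> (\<Sum>(u, v)\<in>vertex_pairs n. 2 * (\<mu> u v)\<^sup>2 + 2 * (M u v)\<^sup>2)"
    unfolding sq_dist_def
  proof (intro sum_mono, clarify)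
    fix u v
    have "0 \<le> (\<mu> u v + M u v)\<^sup>2" by simp
    then show "(\<mu> u v - M u v)\<^sup>2 \<le> 2 * (\<mu> u v)\<^sup>2 + 2 * (M u v)\<^sup>2"
      by (simp add: power2_eq_square algebra_simps)
  qed
  also have "\<dots> = 2 * (\<Sum>(u, v)\<in>vertex_pairs n. (\<mu> u v)\<^sup>2) + 2 * (\<Sum>(u, v)\<in>vertex_pairs n. (M u v)\<^sup>2)"
    by (simp add: case_prod_unfold sum.distrib sum_distrib_left)
  also have "\<dots> \<le> 4 * real n / \<eta>"
    using sum_pairs_marginal_squares assms by simp
  finally show ?thesis .
qed

section \<open>Calibration of the sample size and error probabilities\<close>

lemma sample_size:
  assumes d: "d \<ge> 1" and \<epsilon>: "\<epsilon> > 0" and m: "real m \<ge> sample_bound (216 / \<eta>\<^sup>2) 0 n d \<epsilon>"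
  shows "216 / \<eta>\<^sup>2 * real n ^ 3 \<le> real m * (\<epsilon>\<^sup>2 * (real d)\<^sup>2)"
proof -
  have pos: "\<epsilon>\<^sup>2 * (real d)\<^sup>2 > 0" using d \<epsilon> by simp
  have "216 / \<eta>\<^sup>2 * real n ^ 3 \<le> 216 / \<eta>\<^sup>2 * real n powr (10 / 3)"
    using cube_le_powr[OF n] by (intro mult_left_mono) auto
  also have "\<dots> = sample_bound (216 / \<eta>\<^sup>2) 0 n d \<epsilon> * (\<epsilon>\<^sup>2 * (real d)\<^sup>2)"
    using d \<epsilon> by (simp add: sample_bound_def)
  also have "\<dots> \<le> real m * (\<epsilon>\<^sup>2 * (real d)\<^sup>2)"
    using m pos by (intro mult_right_mono) auto
  finally show ?thesis .
qed

text \<open>A positive half satisfies \<open>m \<le> 3 * (m div 2)\<close>, with equality at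
  \<open>m = 3\<close>; this loss of 3/2 against \<open>m / 2\<close> explains
  \<open>216 = 144 * 3 / 2\<close>.\<close>

lemma half_sample_size:
  assumes d: "d \<ge> 1" and \<epsilon>: "\<epsilon> > 0" and m: "real m \<ge> sample_bound (216 / \<eta>\<^sup>2) 0 n d \<epsilon>"
    and k: "m div 2 > 0"
  shows "144 / \<eta>\<^sup>2 * real n \<le> real (m div 2) * (2 * (real d)\<^sup>2 * \<epsilon>\<^sup>2 / (real n)\<^sup>2)"
proof -
  have "m \<le> 3 * (m div 2)" using k by linarith
  then have "real m \<le> 3 * real (m div 2)"
    by (metis of_nat_le_iff of_nat_mult of_nat_numeral)
  then have "real m * (\<epsilon>\<^sup>2 * (real d)\<^sup>2) \<le> 3 * real (m div 2) * (\<epsilon>\<^sup>2 * (real d)\<^sup>2)"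
    by (intro mult_right_mono) auto
  with sample_size[OF d \<epsilon> m] have "216 / \<eta>\<^sup>2 * real n ^ 3 \<le> 3 * real (m div 2) * (\<epsilon>\<^sup>2 * (real d)\<^sup>2)"
    by linarith
  then have "(144 / \<eta>\<^sup>2 * real n) * (real n)\<^sup>2 \<le> real (m div 2) * (2 * (real d)\<^sup>2 * \<epsilon>\<^sup>2)"
    by (simp add: power2_eq_square power3_eq_cube algebra_simps)
  then show ?thesis
    using n by (simp add: pos_le_divide_eq)
qed

lemma tester_complete:
  assumes sym: "\<And>u v. u < n \<Longrightarrow> v < n \<Longrightarrow> M u v = M v u"
    and d: "d \<ge> 1" and \<epsilon>: "\<epsilon> > 0" and m: "real m \<ge> sample_bound (216 / \<eta>\<^sup>2) 0 n d \<epsilon>"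
    and null: "sq_dist M = 0"
  shows "measure_pmf.prob (replicate_pmf m p) {xs. test_stat n M (m div 2) xs \<le> threshold n d \<epsilon> (m div 2)} \<ge> 2 / 3"
proof (cases "m div 2 = 0")
  \<comment> \<open>With empty halves the statistic and the threshold are both 0, so passing is
    certain.\<close>
  case True
  then show ?thesis by (simp add: test_stat_def pair_sum_def threshold_def case_prod_unfold)
next
  case False
  let ?S = "{xs. test_stat n M (m div 2) xs > threshold n d \<epsilon> (m div 2)}"
  have "measure_pmf.prob (replicate_pmf m p) ?S \<le> 1 / 3"
    unfolding threshold_def
    by (rule test_stat_null) (use sym null half_sample_size[OF d \<epsilon> m] False in auto)
  moreover have "UNIV - ?S = {xs. test_stat n M (m div 2) xs \<le> threshold n d \<epsilon> (m div 2)}"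
    by auto
  ultimately show ?thesis
    using measure_pmf.prob_compl[of ?S "replicate_pmf m p"] by simp
qed

text \<open>
  For \<open>m = 1\<close> the statistic vanishes and the tester accepts; then the far case is impossible, because
  the edge marginals are square summable.
\<close>

lemma tester_sound:
  assumes sym: "\<And>u v. u < n \<Longrightarrow> v < n \<Longrightarrow> M u v = M v u"
    and d: "d \<ge> 1" and \<epsilon>: "\<epsilon> > 0" and m: "real m \<ge> sample_bound (216 / \<eta>\<^sup>2) 0 n d \<epsilon>"
    and M: "(\<Sum>(u, v)\<in>vertex_pairs n. (M u v)\<^sup>2) \<le> real n / \<eta>"
    and far: "4 * (real d)\<^sup>2 * \<epsilon>\<^sup>2 \<le> (real n)\<^sup>2 * sq_dist M"
  shows "measure_pmf.prob (replicate_pmf m p) {xs. \<not> test_stat n M (m div 2) xs \<le> threshold n d \<epsilon> (m div 2)} \<ge> 2 / 3"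
proof (cases "m div 2 = 0")
  case True
  then have "real m \<le> 1" by auto
  then have "real m * (\<epsilon>\<^sup>2 * (real d)\<^sup>2) \<le> 1 * (\<epsilon>\<^sup>2 * (real d)\<^sup>2)"
    by (intro mult_right_mono) auto
  with sample_size[OF d \<epsilon> m] have 1: "216 / \<eta>\<^sup>2 * real n ^ 3 \<le> \<epsilon>\<^sup>2 * (real d)\<^sup>2"
    by linarith
  have "(real n)\<^sup>2 * sq_dist M \<le> (real n)\<^sup>2 * (4 * real n / \<eta>)"
    using sq_dist_le[OF M] by (intro mult_left_mono) auto
  with far have "4 * (\<epsilon>\<^sup>2 * (real d)\<^sup>2) \<le> 4 * (1 / \<eta> * real n ^ 3)"
    by (simp add: power2_eq_square power3_eq_cube algebra_simps)
  with 1 have "216 / \<eta>\<^sup>2 * real n ^ 3 \<le> 1 / \<eta> * real n ^ 3" by linarith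
  moreover have "1 / \<eta> * real n ^ 3 < 216 / \<eta>\<^sup>2 * real n ^ 3"
    using high_temperature_le_one[OF ht n] \<eta> n
    by (intro mult_strict_right_mono) (auto simp: power2_eq_square field_simps)
  ultimately have False by linarith
  then show ?thesis ..
next
  case False
  let ?S = "{xs. test_stat n M (m div 2) xs \<le> threshold n d \<epsilon> (m div 2)}"
  have "2 * (2 * (real d)\<^sup>2 * \<epsilon>\<^sup>2 / (real n)\<^sup>2) \<le> sq_dist M"
    using far n by (simp add: pos_divide_le_eq mult.commute)
  then have "measure_pmf.prob (replicate_pmf m p) ?S \<le> 1 / 3"
    unfolding threshold_def
    by (intro test_stat_far) (use sym half_sample_size[OF d \<epsilon> m] False in auto)
  moreover have "UNIV - ?S = {xs. \<not> test_stat n M (m div 2) xs \<le> threshold n d \<epsilon> (m div 2)}"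
    by auto
  ultimately show ?thesis
    using measure_pmf.prob_compl[of ?S "replicate_pmf m p"] by simp
qed

text \<open>Transfers a bound from an event about the statistic to one about the program; the
  inclusion is asked only for lists of \<open>m\<close> configurations, which have probability
  1.\<close>

lemma prob_samples_mono:
  assumes "measure_pmf.prob (replicate_pmf m p) A \<ge> c"
    and "\<And>xs. xs \<in> sample_lists n \<Longrightarrow> length xs = m \<Longrightarrow> xs \<in> A \<Longrightarrow> xs \<in> B"
  shows "measure_pmf.prob (replicate_pmf m p) B \<ge> c"
proof -
  have "measure_pmf.prob (replicate_pmf m p) A \<le> measure_pmf.prob (replicate_pmf m p) B"
    using assms(2)
    by (intro measure_pmf.finite_measure_mono_AE)
       (auto simp: AE_measure_pmf_iff set_replicate_pmf set_pmf_ising sample_lists_def)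
  with assms(1) show ?thesis by linarith
qed

lemma far_sq_dist:
  assumes nf': "no_external_field n h'" and d: "d \<ge> 1" and \<epsilon>: "\<epsilon> > 0"
    and b: "\<And>u v. u < n \<Longrightarrow> v < n \<Longrightarrow> u \<noteq> v \<Longrightarrow> \<bar>\<theta> u v\<bar> \<le> 1 / (4 * real d)"
    and b': "\<And>u v. u < n \<Longrightarrow> v < n \<Longrightarrow> u \<noteq> v \<Longrightarrow> \<bar>\<theta>' u v\<bar> \<le> 1 / (4 * real d)"
    and far: "d_SKL p (ising n h' \<theta>') \<ge> ereal \<epsilon>"
  shows "4 * (real d)\<^sup>2 * \<epsilon>\<^sup>2 \<le> (real n)\<^sup>2 * sq_dist (edge_marginal (ising n h' \<theta>'))"
proof -
  have "\<epsilon> \<le> (\<Sum>e\<in>vertex_pairs n. (\<theta> (fst e) (snd e) - \<theta>' (fst e) (snd e)) *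
      (\<mu> (fst e) (snd e) - edge_marginal (ising n h' \<theta>') (fst e) (snd e)))"
    using far unfolding d_SKL_ising[OF nf nf'] by (simp add: case_prod_unfold)
  moreover have "\<bar>\<theta> u v - \<theta>' u v\<bar> \<le> 1 / (2 * real d)" if "(u, v) \<in> vertex_pairs n" for u v
  proof -
    have "u < n" "v < n" "u \<noteq> v" using that by (auto simp: vertex_pairs_def)
    then have "\<bar>\<theta> u v - \<theta>' u v\<bar> \<le> 1 / (4 * real d) + 1 / (4 * real d)"
      using b[of u v] b'[of u v] by linarith
    then show ?thesis by simp
  qed
  ultimately show ?thesis
    unfolding sq_dist_def case_prod_unfold using d \<epsilon>
    by (intro sq_form_lower[OF card_vertex_pairs_le, where a = "\<lambda>e. \<theta> (fst e) (snd e) - \<theta>' (fst e) (snd e)"]) auto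
qed

end

text \<open>Both hypotheses are compared with the field-free model without edges. It is one of the
  product distributions, so the divergence from it is at least the infimum, and its edge marginals
  are the constant 0 used by the program.\<close>

lemma independence_tester_correct:
  assumes \<eta>: "\<eta> > 0" and n: "n \<ge> 1" and d: "d \<ge> 1" and \<epsilon>: "\<epsilon> > 0"
    and ep: "edge_params n \<theta>" and nf: "no_external_field n h" and ht: "high_temperature \<eta> n \<theta>"
    and bd: "edge_params_bounded n \<theta> (1 / (4 * real d))"
    and m: "real m \<ge> sample_bound (216 / \<eta>\<^sup>2) 0 n d \<epsilon>"
  shows "ising n h \<theta> \<in> product_dists n \<Longrightarrow> measure_pmf.prob (replicate_pmf m (ising n h \<theta>))
      {xs. accepts independence_prog (independence_input n d \<epsilon> xs)} \<ge> 2 / 3"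
    and "d_SKL_prod (ising n h \<theta>) n \<ge> ereal \<epsilon> \<Longrightarrow> measure_pmf.prob (replicate_pmf m (ising n h \<theta>))
      {xs. rejects independence_prog (independence_input n d \<epsilon> xs)} \<ge> 2 / 3"
proof -
  interpret ising_samples n h \<theta> \<eta>
    using assms by unfold_locales auto
  note verdict = independence_verdict[THEN runs_in_verdict(1)] independence_verdict[THEN runs_in_verdict(2)]
  show "measure_pmf.prob (replicate_pmf m p) {xs. accepts independence_prog (independence_input n d \<epsilon> xs)} \<ge> 2 / 3"
    if "p \<in> product_dists n"
  proof (rule prob_samples_mono)
    have "sq_dist (\<lambda>_ _. 0) = 0"
      unfolding sq_dist_def
      by (intro sum.neutral) (auto simp: vertex_pairs_def edge_marginal_product_dist[OF that nf])
    then show "measure_pmf.prob (replicate_pmf m p)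
        {xs. test_stat n (\<lambda>_ _. 0) (m div 2) xs \<le> threshold n d \<epsilon> (m div 2)} \<ge> 2 / 3"
      by (intro tester_complete[OF _ d \<epsilon> m]) auto
  qed (use verdict(1) in auto)
  show "measure_pmf.prob (replicate_pmf m p) {xs. rejects independence_prog (independence_input n d \<epsilon> xs)} \<ge> 2 / 3"
    if far: "d_SKL_prod p n \<ge> ereal \<epsilon>"
  proof (rule prob_samples_mono)
    let ?q = "ising n h (\<lambda>_ _. 0)"
    have q: "?q \<in> product_dists n" by (rule ising_zero_product_dist[OF nf])
    have "ereal \<epsilon> \<le> d_SKL p ?q"
      using far unfolding d_SKL_prod_def by (rule order_trans) (rule INF_lower[OF q])
    then have "4 * (real d)\<^sup>2 * \<epsilon>\<^sup>2 \<le> (real n)\<^sup>2 * sq_dist (edge_marginal ?q)"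
      using bd by (intro far_sq_dist[OF nf d \<epsilon>]) (auto simp: edge_params_bounded_def)
    also have "sq_dist (edge_marginal ?q) = sq_dist (\<lambda>_ _. 0)"
      unfolding sq_dist_def
      by (intro sum.cong refl) (auto simp: vertex_pairs_def edge_marginal_product_dist[OF q nf])
    finally show "measure_pmf.prob (replicate_pmf m p)
        {xs. \<not> test_stat n (\<lambda>_ _. 0) (m div 2) xs \<le> threshold n d \<epsilon> (m div 2)} \<ge> 2 / 3"
      using \<eta> by (intro tester_sound[OF _ d \<epsilon> m]) (auto simp: case_prod_unfold)
  qed (use verdict(2) in auto)
qed

lemma identity_tester_correct:
  assumes \<eta>: "\<eta> > 0" and n: "n \<ge> 1" and d: "d \<ge> 1" and \<epsilon>: "\<epsilon> > 0"
    and ep: "edge_params n \<theta>" and nf: "no_external_field n h" and ht: "high_temperature \<eta> n \<theta>"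
    and bd: "edge_params_bounded n \<theta> (1 / (4 * real d))"
    and ep': "edge_params n \<theta>'" and nf': "no_external_field n h'" and ht': "high_temperature \<eta> n \<theta>'"
    and m: "real m \<ge> sample_bound (216 / \<eta>\<^sup>2) 0 n d \<epsilon>"
  shows "ising n h \<theta> = ising n h' \<theta>' \<Longrightarrow> measure_pmf.prob (replicate_pmf m (ising n h \<theta>))
      {xs. accepts identity_prog (identity_input n d \<epsilon> h' \<theta>' xs)} \<ge> 2 / 3"
    and "d_SKL (ising n h \<theta>) (ising n h' \<theta>') \<ge> ereal \<epsilon> \<Longrightarrow> measure_pmf.prob (replicate_pmf m (ising n h \<theta>))
      {xs. rejects identity_prog (identity_input n d \<epsilon> h' \<theta>' xs)} \<ge> 2 / 3"
proof -
  interpret ising_samples n h \<theta> \<eta>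
    using assms by unfold_locales auto
  interpret q: ising_samples n h' \<theta>' \<eta>
    using assms by unfold_locales auto
  let ?ok = "\<forall>u<n. \<forall>v<n. \<bar>\<theta>' u v\<bar> \<le> 1 / (4 * real d)"
  note verdict = identity_verdict[OF _ d, THEN runs_in_verdict(1)] identity_verdict[OF _ d, THEN runs_in_verdict(2)]
  show "measure_pmf.prob (replicate_pmf m p) {xs. accepts identity_prog (identity_input n d \<epsilon> h' \<theta>' xs)} \<ge> 2 / 3"
    if eq: "p = q.p"
  proof (rule prob_samples_mono)
    have "sq_dist q.\<mu> = 0"
      by (simp add: sq_dist_def eq case_prod_unfold)
    then show "measure_pmf.prob (replicate_pmf m p)
        {xs. test_stat n q.\<mu> (m div 2) xs \<le> threshold n d \<epsilon> (m div 2)} \<ge> 2 / 3"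
      by (intro tester_complete[OF _ d \<epsilon> m]) (auto simp: edge_marginal_commute)
    \<comment> \<open>Equal laws have equal parameters, so the given model inherits the bound of the
      unknown one and passes the check.\<close>
    have ok: ?ok
    proof (intro allI impI)
      fix u v assume uv: "u < n" "v < n"
      show "\<bar>\<theta>' u v\<bar> \<le> 1 / (4 * real d)"
      proof (cases "u = v")
        case True
        then show ?thesis using ep' uv by (simp add: edge_params_def)
      next
        case False
        then show ?thesis
          using ising_identifiable[OF ep ep' eq uv] bd uv by (metis edge_params_bounded_def)
      qed
    qed
    fix xs assume "xs \<in> sample_lists n" "length xs = m"
      "xs \<in> {xs. test_stat n q.\<mu> (m div 2) xs \<le> threshold n d \<epsilon> (m div 2)}"
    then show "xs \<in> {xs. accepts identity_prog (identity_input n d \<epsilon> h' \<theta>' xs)}"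
      using ok verdict(1)[of xs n h' \<theta>' \<epsilon>] by simp
  qed
  show "measure_pmf.prob (replicate_pmf m p) {xs. rejects identity_prog (identity_input n d \<epsilon> h' \<theta>' xs)} \<ge> 2 / 3"
    if far: "d_SKL p q.p \<ge> ereal \<epsilon>"
  proof (cases ?ok)
    \<comment> \<open>The check fails, and the program rejects whatever the samples are.\<close>
    case False
    show ?thesis
    proof (rule prob_samples_mono[where A = UNIV])
      fix xs assume "xs \<in> sample_lists n"
      then show "xs \<in> {xs. rejects identity_prog (identity_input n d \<epsilon> h' \<theta>' xs)}"
        using False verdict(2)[of xs n h' \<theta>' \<epsilon>] by auto
    qed simp
  next
    case True
    show ?thesis
    proof (rule prob_samples_mono)
      have "4 * (real d)\<^sup>2 * \<epsilon>\<^sup>2 \<le> (real n)\<^sup>2 * sq_dist q.\<mu>"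
        using bd True by (intro far_sq_dist[OF nf' d \<epsilon> _ _ far]) (auto simp: edge_params_bounded_def)
      then show "measure_pmf.prob (replicate_pmf m p)
          {xs. \<not> test_stat n q.\<mu> (m div 2) xs \<le> threshold n d \<epsilon> (m div 2)} \<ge> 2 / 3"
        using q.sum_pairs_marginal_squares
        by (intro tester_sound[OF _ d \<epsilon> m]) (auto simp: edge_marginal_commute)
      fix xs assume "xs \<in> sample_lists n" "length xs = m"
        "xs \<in> {xs. \<not> test_stat n q.\<mu> (m div 2) xs \<le> threshold n d \<epsilon> (m div 2)}"
      then show "xs \<in> {xs. rejects identity_prog (identity_input n d \<epsilon> h' \<theta>' xs)}"
        using verdict(2)[of xs n h' \<theta>' \<epsilon>] by auto
    qed
  qed
qed

text \<open>Every monomial is at most \<open>N^3\<close> and the coefficients add up to 47. The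
  expression is the time of the identity tester and exceeds that of the independence tester.\<close>

lemma running_time_bound:
  assumes "n \<ge> (1::nat)"
  shows "n * (n * (10 * m + 10) + 5) + 4 * (n * n) + 3 * n + 2 * m + 13 \<le> 50 * (n + m) ^ 3"
proof -
  define N where "N = n + m"
  have N: "n \<le> N" "m \<le> N" "1 \<le> N" using assms by (auto simp: N_def)
  have "n * n * m \<le> N * N * N" "n * n * 1 \<le> N * N * N" "n * 1 * 1 \<le> N * N * N"
    "1 * 1 * m \<le> N * N * N" "1 * 1 * 1 \<le> N * N * N"
    using N by (intro mult_le_mono; simp)+
  moreover have "n * (n * (10 * m + 10) + 5) = 10 * (n * n * m) + 10 * (n * n) + 5 * n"
    by (simp add: algebra_simps)
  ultimately have "n * (n * (10 * m + 10) + 5) + 4 * (n * n) + 3 * n + 2 * m + 13 \<le> 50 * (N * N * N)"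
    by linarith
  then show ?thesis by (simp add: N_def power3_eq_cube)
qed

theorem theorem7:
  fixes \<eta> :: real
  assumes "\<eta> > 0"
  shows "\<exists>C > 0. \<exists>k.
    (\<exists>alg.
      (\<exists>a b. \<forall>n \<ge> 1. \<forall>d \<ge> 1. \<forall>\<epsilon> > 0. \<forall>xs \<in> sample_lists n.
         halts_within alg (independence_input n d \<epsilon> xs) (a * (n + length xs) ^ b)) \<and>
      (\<forall>n \<ge> 1. \<forall>d \<ge> 1. \<forall>\<epsilon> > 0. \<forall>m h \<theta>.
         edge_params n \<theta> \<longrightarrow> no_external_field n h \<longrightarrow> high_temperature \<eta> n \<theta> \<longrightarrow>
         max_degree n \<theta> \<le> d \<longrightarrow> edge_params_bounded n \<theta> (1 / (4 * real d)) \<longrightarrow>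
         real m \<ge> sample_bound C k n d \<epsilon> \<longrightarrow>
           (ising n h \<theta> \<in> product_dists n \<longrightarrow>
              measure_pmf.prob (replicate_pmf m (ising n h \<theta>))
                {xs. accepts alg (independence_input n d \<epsilon> xs)} \<ge> 2/3) \<and>
           (d_SKL_prod (ising n h \<theta>) n \<ge> ereal \<epsilon> \<longrightarrow>
              measure_pmf.prob (replicate_pmf m (ising n h \<theta>))
                {xs. rejects alg (independence_input n d \<epsilon> xs)} \<ge> 2/3))) \<and>
    (\<exists>alg.
      (\<exists>a b. \<forall>n \<ge> 1. \<forall>d \<ge> 1. \<forall>\<epsilon> > 0. \<forall>h\<^sub>q \<theta>\<^sub>q. \<forall>xs \<in> sample_lists n.
         edge_params n \<theta>\<^sub>q \<longrightarrow> no_external_field n h\<^sub>q \<longrightarrow> high_temperature \<eta> n \<theta>\<^sub>q \<longrightarrow>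
         halts_within alg (identity_input n d \<epsilon> h\<^sub>q \<theta>\<^sub>q xs) (a * (n + length xs) ^ b)) \<and>
      (\<forall>n \<ge> 1. \<forall>d \<ge> 1. \<forall>\<epsilon> > 0. \<forall>m h \<theta> h\<^sub>q \<theta>\<^sub>q.
         edge_params n \<theta> \<longrightarrow> no_external_field n h \<longrightarrow> high_temperature \<eta> n \<theta> \<longrightarrow>
         max_degree n \<theta> \<le> d \<longrightarrow> edge_params_bounded n \<theta> (1 / (4 * real d)) \<longrightarrow>
         edge_params n \<theta>\<^sub>q \<longrightarrow> no_external_field n h\<^sub>q \<longrightarrow> high_temperature \<eta> n \<theta>\<^sub>q \<longrightarrow>
         real m \<ge> sample_bound C k n d \<epsilon> \<longrightarrow>
           (ising n h \<theta> = ising n h\<^sub>q \<theta>\<^sub>q \<longrightarrow>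
              measure_pmf.prob (replicate_pmf m (ising n h \<theta>))
                {xs. accepts alg (identity_input n d \<epsilon> h\<^sub>q \<theta>\<^sub>q xs)} \<ge> 2/3) \<and>
           (d_SKL (ising n h \<theta>) (ising n h\<^sub>q \<theta>\<^sub>q) \<ge> ereal \<epsilon> \<longrightarrow>
              measure_pmf.prob (replicate_pmf m (ising n h \<theta>))
                {xs. rejects alg (identity_input n d \<epsilon> h\<^sub>q \<theta>\<^sub>q xs)} \<ge> 2/3)))"
proof (intro exI[of _ "216 / \<eta>\<^sup>2"] exI[of _ "0::nat"] conjI)
  show "216 / \<eta>\<^sup>2 > 0" using assms by simp
  show "\<exists>alg.
      (\<exists>a b. \<forall>n \<ge> 1. \<forall>d \<ge> 1. \<forall>\<epsilon> > 0. \<forall>xs \<in> sample_lists n.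
         halts_within alg (independence_input n d \<epsilon> xs) (a * (n + length xs) ^ b)) \<and>
      (\<forall>n \<ge> 1. \<forall>d \<ge> 1. \<forall>\<epsilon> > 0. \<forall>m h \<theta>.
         edge_params n \<theta> \<longrightarrow> no_external_field n h \<longrightarrow> high_temperature \<eta> n \<theta> \<longrightarrow>
         max_degree n \<theta> \<le> d \<longrightarrow> edge_params_bounded n \<theta> (1 / (4 * real d)) \<longrightarrow>
         real m \<ge> sample_bound (216 / \<eta>\<^sup>2) 0 n d \<epsilon> \<longrightarrow>
           (ising n h \<theta> \<in> product_dists n \<longrightarrow>
              measure_pmf.prob (replicate_pmf m (ising n h \<theta>))
                {xs. accepts alg (independence_input n d \<epsilon> xs)} \<ge> 2/3) \<and>
           (d_SKL_prod (ising n h \<theta>) n \<ge> ereal \<epsilon> \<longrightarrow>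
              measure_pmf.prob (replicate_pmf m (ising n h \<theta>))
                {xs. rejects alg (independence_input n d \<epsilon> xs)} \<ge> 2/3))"
  proof (rule exI[of _ independence_prog], rule conjI)
    show "\<exists>a b. \<forall>n \<ge> 1. \<forall>d \<ge> 1. \<forall>\<epsilon> > 0. \<forall>xs \<in> sample_lists n.
         halts_within independence_prog (independence_input n d \<epsilon> xs) (a * (n + length xs) ^ b)"
    proof (rule exI[of _ 50], rule exI[of _ 3], intro allI impI ballI)
      fix n d :: nat and \<epsilon> :: real and xs
      assume "n \<ge> 1" "xs \<in> sample_lists n"
      then show "halts_within independence_prog (independence_input n d \<epsilon> xs) (50 * (n + length xs) ^ 3)"
        using running_time_bound[of n "length xs"]
        by (intro runs_in_verdict(3)[OF independence_verdict]) auto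
    qed
  qed (intro allI impI conjI independence_tester_correct[OF assms]; assumption)
  show "\<exists>alg.
      (\<exists>a b. \<forall>n \<ge> 1. \<forall>d \<ge> 1. \<forall>\<epsilon> > 0. \<forall>h\<^sub>q \<theta>\<^sub>q. \<forall>xs \<in> sample_lists n.
         edge_params n \<theta>\<^sub>q \<longrightarrow> no_external_field n h\<^sub>q \<longrightarrow> high_temperature \<eta> n \<theta>\<^sub>q \<longrightarrow>
         halts_within alg (identity_input n d \<epsilon> h\<^sub>q \<theta>\<^sub>q xs) (a * (n + length xs) ^ b)) \<and>
      (\<forall>n \<ge> 1. \<forall>d \<ge> 1. \<forall>\<epsilon> > 0. \<forall>m h \<theta> h\<^sub>q \<theta>\<^sub>q.
         edge_params n \<theta> \<longrightarrow> no_external_field n h \<longrightarrow> high_temperature \<eta> n \<theta> \<longrightarrow>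
         max_degree n \<theta> \<le> d \<longrightarrow> edge_params_bounded n \<theta> (1 / (4 * real d)) \<longrightarrow>
         edge_params n \<theta>\<^sub>q \<longrightarrow> no_external_field n h\<^sub>q \<longrightarrow> high_temperature \<eta> n \<theta>\<^sub>q \<longrightarrow>
         real m \<ge> sample_bound (216 / \<eta>\<^sup>2) 0 n d \<epsilon> \<longrightarrow>
           (ising n h \<theta> = ising n h\<^sub>q \<theta>\<^sub>q \<longrightarrow>
              measure_pmf.prob (replicate_pmf m (ising n h \<theta>))
                {xs. accepts alg (identity_input n d \<epsilon> h\<^sub>q \<theta>\<^sub>q xs)} \<ge> 2/3) \<and>
           (d_SKL (ising n h \<theta>) (ising n h\<^sub>q \<theta>\<^sub>q) \<ge> ereal \<epsilon> \<longrightarrow>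
              measure_pmf.prob (replicate_pmf m (ising n h \<theta>))
                {xs. rejects alg (identity_input n d \<epsilon> h\<^sub>q \<theta>\<^sub>q xs)} \<ge> 2/3))"
  proof (rule exI[of _ identity_prog], rule conjI)
    show "\<exists>a b. \<forall>n \<ge> 1. \<forall>d \<ge> 1. \<forall>\<epsilon> > 0. \<forall>h\<^sub>q \<theta>\<^sub>q. \<forall>xs \<in> sample_lists n.
         edge_params n \<theta>\<^sub>q \<longrightarrow> no_external_field n h\<^sub>q \<longrightarrow> high_temperature \<eta> n \<theta>\<^sub>q \<longrightarrow>
         halts_within identity_prog (identity_input n d \<epsilon> h\<^sub>q \<theta>\<^sub>q xs) (a * (n + length xs) ^ b)"
    proof (rule exI[of _ 50], rule exI[of _ 3], intro allI impI ballI)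
      fix n d :: nat and \<epsilon> :: real and h\<^sub>q \<theta>\<^sub>q xs
      assume "n \<ge> 1" "d \<ge> 1" "xs \<in> sample_lists n"
      then show "halts_within identity_prog (identity_input n d \<epsilon> h\<^sub>q \<theta>\<^sub>q xs) (50 * (n + length xs) ^ 3)"
        using running_time_bound[of n "length xs"]
        by (intro runs_in_verdict(3)[OF identity_verdict]) auto
    qed
  qed (intro allI impI conjI identity_tester_correct[OF assms]; assumption)
qed

end
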